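(* Let $P_r^{(k)}$ be a $k$-uniform hyperpath with the hyperedge set $\{e_1^{(k)},\dots,e_r^{(k)}\}$. Let the $k$-uniform hypergraph $\mathcal{H}$ be the coalescence of the hyperpath $P_r^{(k)}$ at a cored vertex on the hyperedge $e_l^{(k)}$ with a $k$-uniform hypergraph $\mathcal{H}_0$ at its vertex $v_0$, where $2\le l\le\lceil\frac r2\rceil$ and $r\ge3$. Let the $k$-uniform hypergraph $\mathcal{H}_2$ be obtained by moving $\mathcal{H}_0$ to a cored vertex on $e_{l-1}^{(k)}$, i.e. $\mathcal{H}_2$ is the coalescence of $P_r^{(k)}$ at a cored vertex on $e_{l-1}^{(k)}$ with $\mathcal{H}_0$ at $v_0$ ($\mathcal{H}_2$ is said to be the second path-sliding transformation of $\mathcal{H}$). Then $\mathcal{H}_2\prec_\alpha\mathcal{H}$ for $k\ge3$ and $0<\alpha<1$.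
   Context: Hypergraphs are finite; $k$-uniform means every hyperedge has exactly $k$ vertices. The hyperpath $P_r^{(k)}$ is obtained from the path graph with consecutive edges $e_1,\dots,e_r$ by inserting $k-2$ new vertices (of degree one) into each edge, giving consecutive hyperedges $e_1^{(k)},\dots,e_r^{(k)}$. A cored vertex is a vertex of degree one; here it refers to degrees in the hyperpath. The coalescence of two disjoint hypergraphs at vertices $x$ and $y$ is obtained by identifying $x$ with $y$. For a $k$-uniform hypergraph $\mathcal{H}$ on $[n]$, $\mathcal{A}(\mathcal{H})$ is the $k$-order $n$-dimensional tensor with entry $\frac1{(k-1)!}$ at $(i_1,\dots,i_k)$ if $\{i_1,\dots,i_k\}\in E(\mathcal{H})$ and $0$ otherwise; $\mathcal{D}(\mathcal{H})$ is the diagonal tensor of vertex degrees; $\mathcal{A}_\alpha(\mathcal{H})=\alpha\mathcal{D}(\mathcal{H})+(1-\alpha)\mathcal{A}(\mathcal{H})$. For a tensor $\mathcal{T}$, $\mathrm{Tr}_d(\mathcal{T})$ is the sum of the $d$-th powers of all $n(k-1)^{n-1}$ eigenvalues of $\mathcal{T}$; in particular $\mathrm{Tr}_0(\mathcal{T})=n(k-1)^{n-1}$, and for $d\ge1$ $$\mathrm{Tr}_{d}(\mathcal{T})=(k-1)^{n-1}\sum_{d_1+\cdots+d_n=d}\ \prod_{i=1}^{n}\frac{1}{(d_i(k-1))!}\Big(\sum_{\gamma\in[n]^{k-1}}(\mathcal{T})_{i\gamma}\frac{\partial}{\partial a_{i\gamma}}\Big)^{d_i}\mathrm{tr}\big(A^{d(k-1)}\big),$$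 with $A=(a_{ij})$ an $n\times n$ matrix of indeterminates, $d_i\ge0$ integers, $\frac{\partial}{\partial a_{i\gamma}}=\frac{\partial}{\partial a_{i i_2}}\cdots\frac{\partial}{\partial a_{i i_k}}$ for $\gamma=i_2\cdots i_k$. $S_\alpha$-order: for $k$-uniform hypergraphs $\mathcal{G}_1,\mathcal{G}_2$ with $n$ vertices, $\mathcal{G}_1\prec_\alpha\mathcal{G}_2$ if there is $d\in\{1,\dots,n(k-1)^{n-1}-1\}$ with $\mathrm{Tr}_t(\mathcal{A}_\alpha(\mathcal{G}_1))=\mathrm{Tr}_t(\mathcal{A}_\alpha(\mathcal{G}_2))$ for $t=0,\dots,d-1$ and $\mathrm{Tr}_d(\mathcal{A}_\alpha(\mathcal{G}_1))<\mathrm{Tr}_d(\mathcal{A}_\alpha(\mathcal{G}_2))$.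
   Formalization: The formal theorem additionally assumes that v_0 lies on at least one hyperedge of H_0; if v_0 is isolated in H_0 (e.g. H_0 a single vertex), H and H_2 are isomorphic and the strict order fails. *)

theory Defs
  imports Complex_Main "HOL-Library.Poly_Mapping"
begin

section \<open>Hypergraphs\<close>

record 'a hypergraph =
  verts :: "'a set"
  hedges :: "'a set set"

definition k_uniform :: "nat \<Rightarrow> 'a hypergraph \<Rightarrow> bool" where
  "k_uniform k G \<longleftrightarrow> finite (verts G) \<and> (\<forall>e\<in>hedges G. e \<subseteq> verts G \<and> card e = k)"

definition vertex_degree :: "'a hypergraph \<Rightarrow> 'a \<Rightarrow> nat" where
  "vertex_degree G v = card {e \<in> hedges G. v \<in> e}"

definition cored_vertex :: "'a hypergraph \<Rightarrow> 'a \<Rightarrow> bool" where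
  "cored_vertex G v \<longleftrightarrow> v \<in> verts G \<and> vertex_degree G v = 1"

text \<open>
  The underlying path graph has vertices \<open>Joint 0, \<dots>, Joint r\<close>, its \<open>j\<close>-th edge
  (\<open>1 \<le> j \<le> r\<close>) joins \<open>Joint (j - 1)\<close> and \<open>Joint j\<close>, and \<open>Inserted j i\<close>
  (\<open>1 \<le> i \<le> k - 2\<close>) are the new vertices put into that edge.
\<close>

datatype path_vertex = Joint nat | Inserted nat nat

definition hyperpath_edge :: "nat \<Rightarrow> nat \<Rightarrow> path_vertex set" where
  "hyperpath_edge k j = {Joint (j - 1), Joint j} \<union> Inserted j ` {1..k - 2}"

definition hyperpath :: "nat \<Rightarrow> nat \<Rightarrow> path_vertex hypergraph" where
  "hyperpath k r =
     \<lparr>verts = Joint ` {0..r} \<union> {Inserted j i | j i. j \<in> {1..r} \<and> i \<in> {1..k - 2}},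
      hedges = hyperpath_edge k ` {1..r}\<rparr>"

text \<open>
  The sum type makes the two hypergraphs disjoint. The vertex \<open>y\<close> of the second one is
  represented by the vertex \<open>x\<close> of the first one with which it is identified.
\<close>

definition glue :: "'a \<Rightarrow> 'b \<Rightarrow> 'b \<Rightarrow> 'a + 'b" where
  "glue x y v = (if v = y then Inl x else Inr v)"

definition coalescence :: "'a hypergraph \<Rightarrow> 'a \<Rightarrow> 'b hypergraph \<Rightarrow> 'b \<Rightarrow> ('a + 'b) hypergraph" where
  "coalescence G x H y =
     \<lparr>verts = Inl ` verts G \<union> glue x y ` verts H,
      hedges = (`) Inl ` hedges G \<union> (`) (glue x y) ` hedges H\<rparr>"


section \<open>Tensors of a hypergraph\<close>

text \<open>
  A tensor of order \<open>k\<close> with index set \<open>V\<close> is a function on the lists of length \<open>k\<close> over \<open>V\<close>;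
  its dimension is \<open>card V\<close>. The index set of the tensors of a hypergraph is its vertex set
  itself instead of an enumeration of it by \<open>1, \<dots>, n\<close>.
\<close>

type_synonym 'a tensor = "'a list \<Rightarrow> real"

definition adjacency_tensor :: "nat \<Rightarrow> 'a hypergraph \<Rightarrow> 'a tensor" where
  "adjacency_tensor k G is = (if set is \<in> hedges G then 1 / fact (k - 1) else 0)"

definition degree_tensor :: "nat \<Rightarrow> 'a hypergraph \<Rightarrow> 'a tensor" where
  "degree_tensor k G is =
     (if is = replicate k (hd is) then real (vertex_degree G (hd is)) else 0)"

definition A_alpha :: "real \<Rightarrow> nat \<Rightarrow> 'a hypergraph \<Rightarrow> 'a tensor" where
  "A_alpha \<alpha> k G is = \<alpha> * degree_tensor k G is + (1 - \<alpha>) * adjacency_tensor k G is"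


section \<open>Polynomials in the entries of a matrix of indeterminates\<close>

text \<open>
  The indeterminate \<open>a\<^sub>i\<^sub>j\<close> is the pair \<open>(i, j)\<close>, a monomial is a finitely supported exponent
  function on the indeterminates, and a polynomial is a finitely supported coefficient function
  on the monomials.
\<close>

type_synonym 'a entry_poly = "('a \<times> 'a \<Rightarrow>\<^sub>0 nat) \<Rightarrow>\<^sub>0 real"

definition indet :: "'a \<times> 'a \<Rightarrow> 'a entry_poly" where
  "indet x = Poly_Mapping.single (Poly_Mapping.single x 1) 1"

definition pscale :: "real \<Rightarrow> 'a entry_poly \<Rightarrow> 'a entry_poly" where
  "pscale c p = Poly_Mapping.map ((*) c) p"

definition partial :: "'a \<times> 'a \<Rightarrow> 'a entry_poly \<Rightarrow> 'a entry_poly" where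
  "partial x p = (\<Sum>m\<in>Poly_Mapping.keys p.
     Poly_Mapping.single (m - Poly_Mapping.single x 1)
       (real (Poly_Mapping.lookup m x) * Poly_Mapping.lookup p m))"

text \<open>The \<open>m\<close>-th power of the matrix of indeterminates with rows and columns indexed by \<open>V\<close>.\<close>

fun indet_matrix_power :: "'a set \<Rightarrow> nat \<Rightarrow> 'a \<Rightarrow> 'a \<Rightarrow> 'a entry_poly" where
  "indet_matrix_power V 0 i j = (if i = j then 1 else 0)"
| "indet_matrix_power V (Suc m) i j = (\<Sum>l\<in>V. indet (i, l) * indet_matrix_power V m l j)"

definition trace_power :: "'a set \<Rightarrow> nat \<Rightarrow> 'a entry_poly" where
  "trace_power V m = (\<Sum>i\<in>V. indet_matrix_power V m i i)"


section \<open>Traces of tensors\<close>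

definition tensor_diff_op :: "'a set \<Rightarrow> nat \<Rightarrow> 'a tensor \<Rightarrow> 'a \<Rightarrow> 'a entry_poly \<Rightarrow> 'a entry_poly" where
  "tensor_diff_op V k T i p =
     (\<Sum>\<gamma>\<in>{\<gamma>. set \<gamma> \<subseteq> V \<and> length \<gamma> = k - 1}.
        pscale (T (i # \<gamma>)) (foldr (\<lambda>j. partial (i, j)) \<gamma> p))"

definition tensor_trace_factor ::
    "'a set \<Rightarrow> nat \<Rightarrow> 'a tensor \<Rightarrow> ('a \<Rightarrow> nat) \<Rightarrow> 'a \<Rightarrow> 'a entry_poly \<Rightarrow> 'a entry_poly" where
  "tensor_trace_factor V k T s i p =
     pscale (1 / fact (s i * (k - 1))) ((tensor_diff_op V k T i ^^ s i) p)"

text \<open>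
  The \<open>d\<close>-th order trace, i.e. the sum of the \<open>d\<close>-th powers of the \<open>n * (k - 1) ^ (n - 1)\<close>
  eigenvalues, through the formula of Morozov and Shakirov. The product of differential operators
  over the indices is their composition; they commute (\<open>comp_fun_commute_tensor_trace_factor\<close>
  below), so \<open>Finite_Set.fold\<close> composes them in any order. They are applied to a homogeneous
  polynomial of degree \<open>d * (k - 1)\<close> and their total order is \<open>d * (k - 1)\<close>, so the result
  is a constant polynomial, and the coefficient of the monomial \<open>0\<close> is its value.
\<close>

definition tensor_trace :: "'a set \<Rightarrow> nat \<Rightarrow> 'a tensor \<Rightarrow> nat \<Rightarrow> real" where
  "tensor_trace V k T d =
     (if d = 0 then real (card V * (k - 1) ^ (card V - 1))
      else real ((k - 1) ^ (card V - 1)) *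
        (\<Sum>s\<in>{s. (\<forall>i. i \<notin> V \<longrightarrow> s i = 0) \<and> sum s V = d}.
           Poly_Mapping.lookup
             (Finite_Set.fold (tensor_trace_factor V k T s) (trace_power V (d * (k - 1))) V) 0))"


subsection \<open>The differential operators commute\<close>

lemma lookup_pscale [simp]:
  "Poly_Mapping.lookup (pscale c p) m = c * Poly_Mapping.lookup p m"
  by (simp add: pscale_def Poly_Mapping.map.rep_eq when_def)

lemma lookup_partial:
  "Poly_Mapping.lookup (partial x p) m =
     real (Suc (Poly_Mapping.lookup m x)) *
       Poly_Mapping.lookup p (m + Poly_Mapping.single x 1)"
proof -
  let ?s = "Poly_Mapping.single x (1::nat)"
  let ?t = "\<lambda>m'. real (Poly_Mapping.lookup m' x) * Poly_Mapping.lookup p m'"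
  have eq: "(if m' - ?s = m then ?t m' else 0) = (if m' = m + ?s then ?t m' else 0)" for m'
  proof (cases "Poly_Mapping.lookup m' x = 0")
    case False
    have "m' = m' - ?s + ?s"
      using False by (intro poly_mapping_eqI) (auto simp: lookup_add lookup_minus lookup_single when_def)
    then show ?thesis
      by (metis add_diff_cancel_right')
  qed simp
  have "Poly_Mapping.lookup (partial x p) m
      = (\<Sum>m'\<in>Poly_Mapping.keys p. if m' - ?s = m then ?t m' else 0)"
    by (simp add: partial_def lookup_sum lookup_single when_def)
  also have "\<dots> = (\<Sum>m'\<in>Poly_Mapping.keys p. if m' = m + ?s then ?t m' else 0)"
    by (simp only: eq)
  also have "\<dots> = ?t (m + ?s)"
    by (auto simp: sum.delta in_keys_iff)
  finally show ?thesis
    by (simp add: lookup_add lookup_single)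
qed

lemma partial_commute: "partial x (partial y p) = partial y (partial x p)"
  by (intro poly_mapping_eqI)
    (auto simp: lookup_partial lookup_add lookup_single when_def add_ac)

lemma partial_pscale: "partial x (pscale c p) = pscale c (partial x p)"
  by (intro poly_mapping_eqI) (simp add: lookup_partial)

lemma partial_sum: "partial x (\<Sum>a\<in>A. f a) = (\<Sum>a\<in>A. partial x (f a))"
  by (intro poly_mapping_eqI) (simp add: lookup_partial lookup_sum sum_distrib_left)

lemma pscale_sum: "pscale c (\<Sum>a\<in>A. f a) = (\<Sum>a\<in>A. pscale c (f a))"
  by (intro poly_mapping_eqI) (simp add: lookup_sum sum_distrib_left)

lemma pscale_commute: "pscale c (pscale d p) = pscale d (pscale c p)"
  by (intro poly_mapping_eqI) simp

lemma foldr_partial_pscale: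
  "foldr (\<lambda>j. partial (i, j)) \<gamma> (pscale c p) = pscale c (foldr (\<lambda>j. partial (i, j)) \<gamma> p)"
  by (induction \<gamma>) (simp_all add: partial_pscale)

lemma partial_tensor_diff_op:
  "partial x (tensor_diff_op V k T i p) = tensor_diff_op V k T i (partial x p)"
proof -
  have "partial x (foldr (\<lambda>j. partial (i, j)) \<gamma> p) = foldr (\<lambda>j. partial (i, j)) \<gamma> (partial x p)" for \<gamma>
    by (induction \<gamma>) (simp_all add: partial_commute[of x])
  then show ?thesis
    by (simp add: tensor_diff_op_def partial_sum partial_pscale)
qed

lemma pscale_tensor_diff_op:
  "tensor_diff_op V k T i (pscale c p) = pscale c (tensor_diff_op V k T i p)"
  by (simp add: tensor_diff_op_def pscale_sum foldr_partial_pscale pscale_commute[of c])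

lemma tensor_diff_op_sum:
  "tensor_diff_op V k T i (\<Sum>a\<in>A. f a) = (\<Sum>a\<in>A. tensor_diff_op V k T i (f a))"
proof -
  have "foldr (\<lambda>j. partial (i, j)) \<gamma> (\<Sum>a\<in>A. f a) = (\<Sum>a\<in>A. foldr (\<lambda>j. partial (i, j)) \<gamma> (f a))" for \<gamma>
    by (induction \<gamma>) (simp_all add: partial_sum)
  then show ?thesis
    unfolding tensor_diff_op_def by (simp add: pscale_sum) (rule sum.swap)
qed

lemma tensor_diff_op_commute:
  "tensor_diff_op V k T i (tensor_diff_op V k T j p) = tensor_diff_op V k T j (tensor_diff_op V k T i p)"
proof -
  have "tensor_diff_op V k T j (foldr (\<lambda>l. partial (i, l)) \<gamma> p)
      = foldr (\<lambda>l. partial (i, l)) \<gamma> (tensor_diff_op V k T j p)" for \<gamma>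
    by (induction \<gamma>) (simp_all flip: partial_tensor_diff_op)
  then show ?thesis
    by (simp add: tensor_diff_op_def[of V k T i] tensor_diff_op_sum pscale_tensor_diff_op)
qed

lemma comp_fun_commute_tensor_trace_factor: "comp_fun_commute (tensor_trace_factor V k T s)"
proof
  fix i j
  have scale: "(tensor_diff_op V k T i ^^ a) (pscale c p) = pscale c ((tensor_diff_op V k T i ^^ a) p)"
    for i a c p
    by (induction a) (simp_all add: pscale_tensor_diff_op)
  have one: "tensor_diff_op V k T i ((tensor_diff_op V k T j ^^ b) p)
      = (tensor_diff_op V k T j ^^ b) (tensor_diff_op V k T i p)" for i j b p
    by (induction b) (simp_all add: tensor_diff_op_commute[of V k T i])
  have "(tensor_diff_op V k T i ^^ a) ((tensor_diff_op V k T j ^^ b) p)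
      = (tensor_diff_op V k T j ^^ b) ((tensor_diff_op V k T i ^^ a) p)" for i j a b p
    by (induction a) (simp_all add: one)
  then show "tensor_trace_factor V k T s j \<circ> tensor_trace_factor V k T s i
      = tensor_trace_factor V k T s i \<circ> tensor_trace_factor V k T s j"
    by (auto simp: fun_eq_iff tensor_trace_factor_def scale intro: pscale_commute)
qed


section \<open>The order by spectral moments\<close>

definition S_alpha_less :: "real \<Rightarrow> nat \<Rightarrow> 'a hypergraph \<Rightarrow> 'b hypergraph \<Rightarrow> bool" where
  "S_alpha_less \<alpha> k G1 G2 \<longleftrightarrow>
     k_uniform k G1 \<and> k_uniform k G2 \<and> card (verts G1) = card (verts G2) \<and>
     (\<exists>d\<in>{1..card (verts G1) * (k - 1) ^ (card (verts G1) - 1) - 1}.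
        (\<forall>t<d. tensor_trace (verts G1) k (A_alpha \<alpha> k G1) t =
                tensor_trace (verts G2) k (A_alpha \<alpha> k G2) t) \<and>
        tensor_trace (verts G1) k (A_alpha \<alpha> k G1) d <
        tensor_trace (verts G2) k (A_alpha \<alpha> k G2) d)"

end

theory Submission
  imports Defs "HOL-Library.Multiset" "HOL-Combinatorics.Transposition"
begin

text \<open>
  In the expanded trace formula \<open>Tr\<^sub>d\<close> is a sum over the ways to choose \<open>d\<close> tensor entries, each of
  which is a loop \<open>i\<dots>i\<close> of weight \<open>\<alpha> deg i\<close> or an edge seen from one of its vertices \<open>i\<close>. The
  choice counts with the number of closed walks that traverse the chosen arcs exactly once, so all
  terms are nonnegative and the set of used edges is connected. An edge of the path is a bridge,
  hence a balanced choice that uses it uses it from each of its \<open>k\<close> vertices: a set with \<open>m\<close> path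
  edges needs \<open>d \<ge> k m\<close>, and \<open>d \<ge> k (m + 1)\<close> if it also contains edges of \<open>\<H>\<^sub>0\<close>.

  For \<open>d \<le> k (l - 1) + 2\<close> at most \<open>l - 1\<close> path edges occur, and \<open>l - 1\<close> only without edges of \<open>\<H>\<^sub>0\<close>.
  Translation along the path matches all edge sets of the two hypergraphs except two intervals of
  \<open>l - 1\<close> edges in each: \<open>e\<^sub>1, \<dots>, e\<^bsub>l-1\<^esub>\<close> and \<open>e\<^sub>2, \<dots>, e\<^sub>l\<close> for \<open>\<H>\<close>, and
  \<open>e\<^sub>1, \<dots>, e\<^bsub>l-1\<^esub>\<close> and \<open>e\<^sub>l, \<dots>, e\<^bsub>2l-2\<^esub>\<close> for \<open>\<H>\<^sub>2\<close>. These are four copies of one path, in which the end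
  vertex has degree 1 or 2 and one inserted vertex of the last edge has degree 1 or \<open>1 + deg v\<^sub>0\<close>. The difference
  of the traces is therefore a mixed second difference in these two degrees. It is nonnegative, and
  positive for \<open>d = k (l - 1) + 2\<close>, where one can use every edge once from each vertex and add one
  loop at each of the two vertices.
\<close>

section \<open>Coefficients of derivatives\<close>

text \<open>Monomials are handled as multisets of indeterminates, i.e. of arcs: the arcs of a walk
  then form its monomial, and each derivative adds one element.\<close>

definition expo :: "'b multiset \<Rightarrow> 'b \<Rightarrow>\<^sub>0 nat" where
  "expo M = (\<Sum>x\<in>#M. Poly_Mapping.single x 1)"

lemma expo_empty [simp]: "expo {#} = 0"
  and expo_add_mset [simp]: "expo (add_mset x M) = Poly_Mapping.single x 1 + expo M"
  by (simp_all add: expo_def)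

lemma lookup_expo [simp]: "Poly_Mapping.lookup (expo M) x = count M x"
  by (induction M) (auto simp: lookup_add lookup_single when_def)

lemma expo_inject [simp]: "expo M = expo N \<longleftrightarrow> M = N"
  by (metis lookup_expo multiset_eqI)

definition mfact :: "'b multiset \<Rightarrow> real" where
  "mfact M = (\<Prod>x\<in>set_mset M. fact (count M x))"

lemma mfact_empty [simp]: "mfact {#} = 1"
  by (simp add: mfact_def)

lemma mfact_pos: "mfact M > 0"
  by (auto simp: mfact_def intro!: prod_pos)

lemma mfact_superset:
  assumes "finite A" "set_mset M \<subseteq> A"
  shows "mfact M = (\<Prod>x\<in>A. fact (count M x))"
  unfolding mfact_def using assms
  by (intro prod.mono_neutral_left) (auto simp: not_in_iff)

lemma mfact_add_mset: "mfact (add_mset x M) = real (Suc (count M x)) * mfact M"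
proof -
  let ?A = "insert x (set_mset M)"
  have "mfact (add_mset x M) = (\<Prod>y\<in>?A. fact (count (add_mset x M) y))"
    by (intro mfact_superset) auto
  also have "\<dots> = (\<Prod>y\<in>?A. (if y = x then real (Suc (count M x)) else 1) * fact (count M y))"
    by (intro prod.cong) (auto simp: algebra_simps)
  also have "\<dots> = real (Suc (count M x)) * (\<Prod>y\<in>?A. fact (count M y))"
    by (simp only: prod.distrib) (simp add: prod.delta')
  also have "(\<Prod>y\<in>?A. fact (count M y)) = mfact M"
    by (intro mfact_superset[symmetric]) auto
  finally show ?thesis .
qed

text \<open>Weighting a coefficient by the factorials of its exponents turns \<^const>\<open>partial\<close> into a
  shift of the exponent.\<close>

definition ncoeff :: "('b \<times> 'b) multiset \<Rightarrow> 'b entry_poly \<Rightarrow> real" where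
  "ncoeff M p = mfact M * Poly_Mapping.lookup p (expo M)"

lemma ncoeff_partial: "ncoeff M (partial x p) = ncoeff (add_mset x M) p"
  by (simp add: ncoeff_def lookup_partial mfact_add_mset add.commute)

lemma ncoeff_pscale: "ncoeff M (pscale c p) = c * ncoeff M p"
  by (simp add: ncoeff_def)

lemma ncoeff_sum: "ncoeff M (\<Sum>a\<in>A. f a) = (\<Sum>a\<in>A. ncoeff M (f a))"
  by (simp add: ncoeff_def lookup_sum sum_distrib_left)

lemma ncoeff_foldr_partial:
  "ncoeff M (foldr (\<lambda>j. partial (i, j)) \<gamma> p) = ncoeff (image_mset (Pair i) (mset \<gamma>) + M) p"
  by (induction \<gamma> arbitrary: M) (simp_all add: ncoeff_partial)

abbreviation index_lists :: "'b set \<Rightarrow> nat \<Rightarrow> 'b list set" where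
  "index_lists V m \<equiv> {\<gamma>. set \<gamma> \<subseteq> V \<and> length \<gamma> = m}"

lemma ncoeff_tensor_diff_op:
  "ncoeff M (tensor_diff_op V k T i p) =
     (\<Sum>\<gamma>\<in>index_lists V (k - 1). T (i # \<gamma>) * ncoeff (image_mset (Pair i) (mset \<gamma>) + M) p)"
  by (simp add: tensor_diff_op_def ncoeff_sum ncoeff_pscale ncoeff_foldr_partial)

lemma sum_lists_Suc:
  fixes h :: "'c list \<Rightarrow> real"
  shows "(\<Sum>xs | set xs \<subseteq> A \<and> length xs = Suc n. h xs)
    = (\<Sum>xs | set xs \<subseteq> A \<and> length xs = n. \<Sum>x\<in>A. h (x # xs))"
proof -
  have "(\<Sum>xs | set xs \<subseteq> A \<and> length xs = Suc n. h xs)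
      = (\<Sum>(xs, x)\<in>{xs. set xs \<subseteq> A \<and> length xs = n} \<times> A. h (x # xs))"
    by (rule sum.reindex_bij_witness[of _ "\<lambda>(xs, x). x # xs" "\<lambda>xs. (tl xs, hd xs)"])
      (auto simp: length_Suc_conv)
  then show ?thesis
    by (simp add: sum.cartesian_product)
qed

lemma ncoeff_tensor_diff_op_power:
  "ncoeff M ((tensor_diff_op V k T i ^^ n) p) =
     (\<Sum>xs | set xs \<subseteq> index_lists V (k - 1) \<and> length xs = n.
        (\<Prod>\<gamma>\<leftarrow>xs. T (i # \<gamma>)) * ncoeff (image_mset (Pair i) (mset (concat xs)) + M) p)"
proof (induction n arbitrary: M)
  case (Suc n)
  have "ncoeff M ((tensor_diff_op V k T i ^^ Suc n) p) =
     (\<Sum>\<gamma>\<in>index_lists V (k - 1). \<Sum>xs | set xs \<subseteq> index_lists V (k - 1) \<and> length xs = n.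
        (\<Prod>\<gamma>\<leftarrow>\<gamma> # xs. T (i # \<gamma>)) * ncoeff (image_mset (Pair i) (mset (concat (\<gamma> # xs))) + M) p)"
    by (simp add: ncoeff_tensor_diff_op Suc.IH sum_distrib_left ac_simps)
  also have "\<dots> = (\<Sum>xs | set xs \<subseteq> index_lists V (k - 1) \<and> length xs = n. \<Sum>\<gamma>\<in>index_lists V (k - 1).
        (\<Prod>\<gamma>\<leftarrow>\<gamma> # xs. T (i # \<gamma>)) * ncoeff (image_mset (Pair i) (mset (concat (\<gamma> # xs))) + M) p)"
    by (rule sum.swap)
  also have "\<dots> = (\<Sum>xs | set xs \<subseteq> index_lists V (k - 1) \<and> length xs = Suc n.
        (\<Prod>\<gamma>\<leftarrow>xs. T (i # \<gamma>)) * ncoeff (image_mset (Pair i) (mset (concat xs)) + M) p)"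
    by (rule sum_lists_Suc[symmetric])
  finally show ?case .
next
  case 0
  have "{xs. set xs \<subseteq> index_lists V (k - 1) \<and> length xs = 0} = {[]}"
    by auto
  then show ?case
    by (simp only: sum.insert) simp
qed

text \<open>The fixed value \<open>c\<close> outside the index set makes the choice at
  \<open>a\<close> and the choices on \<open>A\<close> determine the function, as the induction over
  the operators requires.\<close>

lemma sum_default_funs_insert:
  fixes h :: "('b \<Rightarrow> 'c) \<Rightarrow> real"
  assumes "a \<notin> A"
  shows "(\<Sum>g | (\<forall>i\<in>insert a A. g i \<in> X i) \<and> (\<forall>i. i \<notin> insert a A \<longrightarrow> g i = c). h g)
    = (\<Sum>x\<in>X a. \<Sum>g | (\<forall>i\<in>A. g i \<in> X i) \<and> (\<forall>i. i \<notin> A \<longrightarrow> g i = c). h (g(a := x)))"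
    (is "sum h ?S = (\<Sum>x\<in>_. \<Sum>g\<in>?R. _)")
proof -
  have "sum h ?S = (\<Sum>(x, g)\<in>X a \<times> ?R. h (g(a := x)))"
    using assms
    by (intro sum.reindex_bij_witness[of _ "\<lambda>(x, g). g(a := x)" "\<lambda>g. (g a, g(a := c))"])
      (auto simp: fun_eq_iff)
  then show ?thesis
    by (simp add: sum.cartesian_product)
qed

text \<open>Each operator moves the arcs along which it differentiates into \<open>M\<close>, so the
  induction needs \<open>M\<close> arbitrary. The operators may be peeled off in any order because
  they commute.\<close>

lemma ncoeff_fold_trace_factor:
  assumes "finite A"
  shows "ncoeff M (Finite_Set.fold (tensor_trace_factor V k T s) p A) =
    (\<Sum>g | (\<forall>i\<in>A. g i \<in> {xs. set xs \<subseteq> index_lists V (k - 1) \<and> length xs = s i}) \<and> (\<forall>i. i \<notin> A \<longrightarrow> g i = []).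
       (\<Prod>i\<in>A. 1 / fact (s i * (k - 1))) * (\<Prod>i\<in>A. \<Prod>\<gamma>\<leftarrow>g i. T (i # \<gamma>)) *
       ncoeff ((\<Sum>i\<in>A. image_mset (Pair i) (mset (concat (g i)))) + M) p)"
    (is "_ = (\<Sum>g\<in>?S A. ?h A M g)")
  using assms
proof (induction A arbitrary: M)
  case empty
  have "?S {} = {\<lambda>_. []}"
    by auto
  then show ?case by simp
next
  case (insert a A)
  interpret comp_fun_commute "tensor_trace_factor V k T s"
    by (rule comp_fun_commute_tensor_trace_factor)
  let ?X = "\<lambda>i. {xs. set xs \<subseteq> index_lists V (k - 1) \<and> length xs = s i}"
  have upd: "?h (insert a A) M (g(a := xs)) =
      1 / fact (s a * (k - 1)) * (\<Prod>\<gamma>\<leftarrow>xs. T (a # \<gamma>)) *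
        ?h A (image_mset (Pair a) (mset (concat xs)) + M) g" for g xs
  proof -
    have "(\<Prod>i\<in>A. \<Prod>\<gamma>\<leftarrow>(g(a := xs)) i. T (i # \<gamma>)) = (\<Prod>i\<in>A. \<Prod>\<gamma>\<leftarrow>g i. T (i # \<gamma>))"
      and "(\<Sum>i\<in>A. image_mset (Pair i) (mset (concat ((g(a := xs)) i))))
         = (\<Sum>i\<in>A. image_mset (Pair i) (mset (concat (g i))))"
      using insert.hyps by (auto intro!: prod.cong sum.cong)
    then show ?thesis
      using insert.hyps by (simp add: ac_simps)
  qed
  have "ncoeff M (Finite_Set.fold (tensor_trace_factor V k T s) p (insert a A)) =
      (\<Sum>xs\<in>?X a. \<Sum>g\<in>?S A. ?h (insert a A) M (g(a := xs)))"
    using insert.hyps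
    by (simp only: upd)
      (simp add: tensor_trace_factor_def ncoeff_pscale ncoeff_tensor_diff_op_power insert.IH
        sum_distrib_left mult.assoc)
  also have "\<dots> = (\<Sum>g\<in>?S (insert a A). ?h (insert a A) M g)"
    by (rule sum_default_funs_insert[OF insert.hyps(2), symmetric])
  finally show ?case .
qed

section \<open>Traces of matrix powers as sums over closed walks\<close>

lemma indet_single_mult:
  "indet x * Poly_Mapping.single (expo M) 1 = Poly_Mapping.single (expo (add_mset x M)) 1"
  by (simp add: indet_def mult_single)

text \<open>A walk of \<open>n\<close> arcs from \<open>i\<close> to \<open>j\<close> is listed by
  its first \<open>n\<close> vertices. The condition \<open>hd (w @ [j]) = i\<close> also covers
  \<open>n = 0\<close>, where the list is empty and \<open>i = j\<close>.\<close>

lemma indet_matrix_power_walks: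
  assumes "finite V" "j \<in> V" "i \<in> V"
  shows "indet_matrix_power V n i j =
    (\<Sum>w | set w \<subseteq> V \<and> length w = n \<and> hd (w @ [j]) = i.
       Poly_Mapping.single (expo (mset (zip w (tl w @ [j])))) 1)"
  using assms(3)
proof (induction n arbitrary: i)
  case 0
  have "{w. set w \<subseteq> V \<and> length w = 0 \<and> hd (w @ [j]) = i} = (if i = j then {[]} else {})"
    by auto
  then show ?case
    by (simp only:) simp
next
  case (Suc n)
  let ?m = "\<lambda>w. Poly_Mapping.single (expo (mset (zip w (tl w @ [j])))) (1::real)"
  let ?W = "\<lambda>l. {w. set w \<subseteq> V \<and> length w = n \<and> hd (w @ [j]) = l}"
  let ?U = "{w. set w \<subseteq> V \<and> length w = n}"
  have fin: "finite ?U"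
    using assms by (simp add: finite_lists_length_eq)
  have cons: "?m (i # w) = indet (i, hd (w @ [j])) * ?m w" for w
    using indet_single_mult[of "(i, hd (w @ [j]))" "mset (zip w (tl w @ [j]))"] by (cases w) simp_all
  have "indet_matrix_power V (Suc n) i j = (\<Sum>l\<in>V. indet (i, l) * (\<Sum>w\<in>?W l. ?m w))"
    by (simp add: Suc.IH)
  also have "\<dots> = (\<Sum>l\<in>V. \<Sum>w\<in>{w \<in> ?U. hd (w @ [j]) = l}. ?m (i # w))"
    unfolding sum_distrib_left cons by (intro sum.cong) auto
  also have "\<dots> = (\<Sum>w\<in>?U. ?m (i # w))"
    using assms fin by (intro sum.group) (auto simp: neq_Nil_conv hd_append)
  also have "\<dots> = (\<Sum>w | set w \<subseteq> V \<and> length w = Suc n \<and> hd (w @ [j]) = i. ?m w)"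
    using Suc.prems
    by (intro sum.reindex_bij_witness[of _ tl "\<lambda>w. i # w"]) (auto simp: length_Suc_conv)
  finally show ?case .
qed

lemma zip_rotate1: "w \<noteq> [] \<Longrightarrow> zip w (rotate1 w) = zip w (tl w @ [hd w])"
  by (cases w) simp_all

lemma trace_power_walks:
  assumes "finite V" "n > 0"
  shows "trace_power V n =
    (\<Sum>w | set w \<subseteq> V \<and> length w = n. Poly_Mapping.single (expo (mset (zip w (rotate1 w)))) 1)"
proof -
  let ?U = "{w. set w \<subseteq> V \<and> length w = n}"
  have hd_last: "hd (w @ [i]) = hd w" if "w \<in> ?U" for w i
    using that assms by (cases w) auto
  have "trace_power V n = (\<Sum>i\<in>V. \<Sum>w\<in>{w \<in> ?U. hd w = i}.
      Poly_Mapping.single (expo (mset (zip w (rotate1 w)))) 1)"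
    unfolding trace_power_def using assms
    by (intro sum.cong refl)
      (auto simp: indet_matrix_power_walks zip_rotate1 intro!: sum.cong dest: hd_last)
  also have "\<dots> = (\<Sum>w\<in>?U. Poly_Mapping.single (expo (mset (zip w (rotate1 w)))) 1)"
    using assms by (intro sum.group) (auto simp: finite_lists_length_eq neq_Nil_conv)
  finally show ?thesis .
qed

section \<open>Closed walks and configurations\<close>

text \<open>Closed walks are cyclic lists with a marked start: \<open>rotate1\<close> supplies the
  successor of each vertex, and different starts count separately, as they do in a trace.\<close>

definition closed_walks :: "('b \<times> 'b) multiset \<Rightarrow> 'b list set" where
  "closed_walks M = {w. mset (zip w (rotate1 w)) = M}"

lemma closed_walk_fst: "w \<in> closed_walks M \<Longrightarrow> image_mset fst M = mset w"
  by (auto simp: closed_walks_def simp flip: mset_map)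

lemma closed_walk_snd: "w \<in> closed_walks M \<Longrightarrow> image_mset snd M = mset w"
  by (cases w) (auto simp: closed_walks_def simp flip: mset_map)

lemma closed_walk_length: "w \<in> closed_walks M \<Longrightarrow> length w = size M"
  by (auto simp: closed_walks_def)

lemma closed_walk_set: "w \<in> closed_walks M \<Longrightarrow> set w = fst ` set_mset M"
  using closed_walk_fst[of w M] by (metis set_image_mset set_mset_mset)

lemma finite_closed_walks [simp]: "finite (closed_walks M)"
  by (rule finite_subset[of _ "{w. set w \<subseteq> fst ` set_mset M \<and> length w = size M}"])
    (auto simp: closed_walk_length closed_walk_set finite_lists_length_eq)

lemma lookup_trace_power:
  assumes "finite V" "n > 0" "size M = n" "set_mset M \<subseteq> V \<times> V"
  shows "Poly_Mapping.lookup (trace_power V n) (expo M) = real (card (closed_walks M))"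
proof -
  let ?U = "{w. set w \<subseteq> V \<and> length w = n}"
  have "Poly_Mapping.lookup (trace_power V n) (expo M)
      = (\<Sum>w\<in>?U. if mset (zip w (rotate1 w)) = M then 1 else 0)"
    using assms by (simp add: trace_power_walks lookup_sum lookup_single when_def)
  also have "\<dots> = real (card (?U \<inter> closed_walks M))"
    using assms by (simp add: sum.If_cases finite_lists_length_eq closed_walks_def)
  also have "?U \<inter> closed_walks M = closed_walks M"
    using assms by (fastforce simp: closed_walk_length closed_walk_set)
  finally show ?thesis .
qed

section \<open>Choices of tensor entries and the expanded trace formula\<close>

definition support :: "('b \<Rightarrow> 'c list) \<Rightarrow> 'b set" where
  "support g = {i. g i \<noteq> []}"

definition arcs :: "('b \<Rightarrow> 'b list list) \<Rightarrow> ('b \<times> 'b) multiset" where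
  "arcs g = (\<Sum>i\<in>support g. image_mset (Pair i) (mset (concat (g i))))"

text \<open>The terms of the expanded product of the operators \<^const>\<open>tensor_diff_op\<close>: the \<open>i\<close>-th
  operator is taken \<open>length (g i)\<close> times, and \<open>g i\<close> lists the chosen summands.\<close>

definition configs :: "'b set \<Rightarrow> nat \<Rightarrow> nat \<Rightarrow> ('b \<Rightarrow> 'b list list) set" where
  "configs V k d = {g. support g \<subseteq> V \<and> (\<forall>i. set (g i) \<subseteq> index_lists V (k - 1)) \<and>
     (\<Sum>i\<in>V. length (g i)) = d}"

text \<open>The factor of a term that does not depend on the tensor. Differentiating the trace along
  all chosen arcs gives the factorials of the exponents times the number of closed walks; the
  denominator collects the normalising factorials of the trace formula.\<close>

definition config_coeff :: "nat \<Rightarrow> ('b \<Rightarrow> 'b list list) \<Rightarrow> real" where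
  "config_coeff k g = mfact (arcs g) * card (closed_walks (arcs g)) /
     (\<Prod>i\<in>support g. fact (length (g i) * (k - 1)))"

lemma config_coeff_nonneg: "config_coeff k g \<ge> 0"
  unfolding config_coeff_def using mfact_pos[of "arcs g"] by (intro divide_nonneg_nonneg prod_nonneg) auto

lemma arcs_superset:
  assumes "finite V" "support g \<subseteq> V"
  shows "arcs g = (\<Sum>i\<in>V. image_mset (Pair i) (mset (concat (g i))))"
  unfolding arcs_def using assms by (intro sum.mono_neutral_left) (auto simp: support_def)

lemma set_mset_arcs:
  assumes "finite (support g)"
  shows "set_mset (arcs g) = {(i, j). \<exists>\<gamma>\<in>set (g i). j \<in> set \<gamma>}"
  using assms unfolding arcs_def by (subst set_mset_sum) (force simp: support_def)+

lemma finite_configs: "finite V \<Longrightarrow> finite (configs V k d)"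
proof -
  assume V: "finite V"
  let ?X = "{xs. set xs \<subseteq> index_lists V (k - 1) \<and> length xs \<le> d}"
  have "configs V k d \<subseteq> {g. \<forall>i. (i \<in> V \<longrightarrow> g i \<in> ?X) \<and> (i \<notin> V \<longrightarrow> g i = [])}"
    using V by (fastforce simp: configs_def support_def intro: member_le_sum)
  moreover have "finite ?X"
    using V by (intro finite_lists_length_le) (simp add: finite_lists_length_eq)
  ultimately show ?thesis
    using finite_subset[OF _ finite_set_of_finite_funs[OF V, of ?X "[]"]] by blast
qed

lemma size_multiset_sum: "size (\<Sum>i\<in>A. f i) = (\<Sum>i\<in>A. size (f i))" for f :: "'b \<Rightarrow> 'c multiset"
  by (induction A rule: infinite_finite_induct) simp_all

lemma size_arcs:
  assumes "finite V" "g \<in> configs V k d"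
  shows "size (arcs g) = d * (k - 1)"
proof -
  have len: "length (concat (g i)) = length (g i) * (k - 1)" for i
  proof -
    have "\<forall>\<gamma>\<in>set (g i). length \<gamma> = k - 1"
      using assms by (auto simp: configs_def)
    then show ?thesis
      by (induction "g i" arbitrary: g rule: list.induct) (simp_all add: length_concat sum_list_triv cong: map_cong)
  qed
  have "size (arcs g) = (\<Sum>i\<in>V. length (concat (g i)))"
    using assms
    by (subst arcs_superset[of V]) (auto simp: configs_def size_multiset_sum simp del: length_concat)
  also have "\<dots> = d * (k - 1)"
    using assms by (simp only: len flip: sum_distrib_right) (simp add: configs_def)
  finally show ?thesis .
qed

text \<open>The sum over the exponents \<open>s\<close> disappears, because a choice of summands
  determines how often each operator is used: configurations are grouped by
  \<open>\<lambda>i. length (g i)\<close>.\<close>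

theorem tensor_trace_configs:
  assumes "finite V" "d > 0" "k \<ge> 2"
  shows "tensor_trace V k T d = real ((k - 1) ^ (card V - 1)) *
    (\<Sum>g\<in>configs V k d. config_coeff k g * (\<Prod>i\<in>V. \<Prod>\<gamma>\<leftarrow>g i. T (i # \<gamma>)))"
proof -
  let ?S = "{s. (\<forall>i. i \<notin> V \<longrightarrow> s i = 0) \<and> sum s V = d}"
  let ?C = "configs V k d"
  let ?h = "\<lambda>g. config_coeff k g * (\<Prod>i\<in>V. \<Prod>\<gamma>\<leftarrow>g i. T (i # \<gamma>))"
  have finS: "finite ?S"
  proof (rule finite_subset)
    show "?S \<subseteq> {s. \<forall>i. (i \<in> V \<longrightarrow> s i \<in> {..d}) \<and> (i \<notin> V \<longrightarrow> s i = 0)}"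
      using assms by (auto intro: member_le_sum)
  qed (intro finite_set_of_finite_funs assms finite_atMost)
  have "Poly_Mapping.lookup
      (Finite_Set.fold (tensor_trace_factor V k T s) (trace_power V (d * (k - 1))) V) 0
    = (\<Sum>g\<in>{g \<in> ?C. (\<lambda>i. length (g i)) = s}. ?h g)" if s: "s \<in> ?S" for s
  proof -
    have "Poly_Mapping.lookup
        (Finite_Set.fold (tensor_trace_factor V k T s) (trace_power V (d * (k - 1))) V) 0
      = ncoeff {#} (Finite_Set.fold (tensor_trace_factor V k T s) (trace_power V (d * (k - 1))) V)"
      by (simp add: ncoeff_def)
    also have "\<dots> = (\<Sum>g\<in>{g \<in> ?C. (\<lambda>i. length (g i)) = s}.
       (\<Prod>i\<in>V. 1 / fact (s i * (k - 1))) * (\<Prod>i\<in>V. \<Prod>\<gamma>\<leftarrow>g i. T (i # \<gamma>)) *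
       ncoeff ((\<Sum>i\<in>V. image_mset (Pair i) (mset (concat (g i)))) + {#}) (trace_power V (d * (k - 1))))"
      unfolding ncoeff_fold_trace_factor[OF assms(1)]
    proof (rule sum.cong)
      show "{g. (\<forall>i\<in>V. g i \<in> {xs. set xs \<subseteq> index_lists V (k - 1) \<and> length xs = s i}) \<and>
                (\<forall>i. i \<notin> V \<longrightarrow> g i = [])} = {g \<in> ?C. (\<lambda>i. length (g i)) = s}" (is "?L = ?R")
      proof (intro equalityI subsetI)
        fix g assume g: "g \<in> ?L"
        then have "length (g i) = s i" for i
          using s by (cases "i \<in> V") auto
        moreover from g have "set (g i) \<subseteq> index_lists V (k - 1)" for i
          by (cases "i \<in> V") auto
        ultimately show "g \<in> ?R"
          using g s by (auto simp: configs_def support_def)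
      next
        fix g assume g: "g \<in> ?R"
        then have "length (g i) = s i" for i
          by auto
        with g show "g \<in> ?L"
          by (auto simp: configs_def support_def)
      qed
    qed simp
    also have "\<dots> = (\<Sum>g\<in>{g \<in> ?C. (\<lambda>i. length (g i)) = s}. ?h g)"
    proof (rule sum.cong[OF refl])
      fix g assume "g \<in> {g \<in> ?C. (\<lambda>i. length (g i)) = s}"
      then have g: "g \<in> ?C" and s_eq: "s = (\<lambda>i. length (g i))"
        by auto
      have sup: "support g \<subseteq> V" and fin: "finite (support g)"
        using g assms by (auto simp: configs_def intro: finite_subset)
      have "(\<Prod>i\<in>support g. fact (length (g i) * (k - 1)))
          = (\<Prod>i\<in>V. fact (length (g i) * (k - 1)) :: real)"
        using assms sup by (intro prod.mono_neutral_left) (auto simp: support_def)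
      moreover have "set_mset (arcs g) \<subseteq> V \<times> V"
        using g fin by (fastforce simp: set_mset_arcs configs_def support_def)
      moreover have "size (arcs g) = d * (k - 1)"
        using g assms size_arcs by blast
      moreover have "d * (k - 1) > 0"
        using assms by simp
      ultimately show "(\<Prod>i\<in>V. 1 / fact (s i * (k - 1))) * (\<Prod>i\<in>V. \<Prod>\<gamma>\<leftarrow>g i. T (i # \<gamma>)) *
          ncoeff ((\<Sum>i\<in>V. image_mset (Pair i) (mset (concat (g i)))) + {#}) (trace_power V (d * (k - 1)))
        = ?h g"
        using arcs_superset[OF assms(1) sup] assms(1)
        by (simp add: ncoeff_def lookup_trace_power config_coeff_def s_eq prod_dividef)
    qed
    finally show ?thesis .
  qed
  then have "(\<Sum>s\<in>?S. Poly_Mapping.lookup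
      (Finite_Set.fold (tensor_trace_factor V k T s) (trace_power V (d * (k - 1))) V) 0)
    = (\<Sum>s\<in>?S. \<Sum>g\<in>{g \<in> ?C. (\<lambda>i. length (g i)) = s}. ?h g)"
    by (intro sum.cong) auto
  also have "\<dots> = (\<Sum>g\<in>?C. ?h g)"
    using finS finite_configs[OF assms(1)]
    by (intro sum.group) (auto simp: configs_def support_def)
  finally show ?thesis
    using assms by (simp add: tensor_trace_def)
qed

section \<open>Contributions of edge sets\<close>

text \<open>The constant list stands for the diagonal entry. The base vertex \<open>i\<close> is
  kept because the cost bound counts the vertices from which an edge is used.\<close>

definition uses_edge :: "nat \<Rightarrow> ('b \<Rightarrow> 'b list list) \<Rightarrow> 'b \<Rightarrow> 'b set \<Rightarrow> bool" where
  "uses_edge k g i e \<longleftrightarrow> (\<exists>\<gamma>\<in>set (g i). \<gamma> \<noteq> replicate (k - 1) i \<and> insert i (set \<gamma>) = e)"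

definition used_edges :: "nat \<Rightarrow> ('b \<Rightarrow> 'b list list) \<Rightarrow> 'b set set" where
  "used_edges k g = {e. \<exists>i. uses_edge k g i e}"

definition loop_count :: "nat \<Rightarrow> ('b \<Rightarrow> 'b list list) \<Rightarrow> 'b \<Rightarrow> nat" where
  "loop_count k g i = count_list (g i) (replicate (k - 1) i)"

text \<open>Here \<open>w i\<close> plays the role of the diagonal entry at \<open>i\<close>, and
  \<open>b\<close> that of the common value of all adjacency entries.\<close>

definition config_weight :: "nat \<Rightarrow> real \<Rightarrow> ('b \<Rightarrow> real) \<Rightarrow> ('b \<Rightarrow> 'b list list) \<Rightarrow> real" where
  "config_weight k b w g =
     (\<Prod>i\<in>support g. w i ^ loop_count k g i * b ^ (length (g i) - loop_count k g i))"

text \<open>The vertex set is \<open>\<Union>F\<close> and not that of an ambient hypergraph, so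
  that edge sets of different hypergraphs can be compared. By \<open>config_local\<close> nothing is
  lost for nonempty \<open>F\<close>.\<close>

definition part :: "nat \<Rightarrow> nat \<Rightarrow> real \<Rightarrow> ('b \<Rightarrow> real) \<Rightarrow> 'b set set \<Rightarrow> real" where
  "part k d b w F =
     (\<Sum>g | g \<in> configs (\<Union>F) k d \<and> used_edges k g = F. config_coeff k g * config_weight k b w g)"

text \<open>Configurations without edges are kept apart: for them \<open>\<Union>F\<close> would be
  empty, whereas a loop may sit at any vertex.\<close>

definition loop_part :: "nat \<Rightarrow> nat \<Rightarrow> real \<Rightarrow> ('b \<Rightarrow> real) \<Rightarrow> 'b set \<Rightarrow> real" where
  "loop_part k d b w V =
     (\<Sum>g | g \<in> configs V k d \<and> used_edges k g = {}. config_coeff k g * config_weight k b w g)"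

lemma config_finite_support: "\<lbrakk>finite V; g \<in> configs V k d\<rbrakk> \<Longrightarrow> finite (support g)"
  by (auto simp: configs_def intro: finite_subset)

lemma config_lists:
  "\<lbrakk>g \<in> configs V k d; \<gamma> \<in> set (g i)\<rbrakk> \<Longrightarrow> i \<in> V \<and> set \<gamma> \<subseteq> V \<and> length \<gamma> = k - 1"
  by (fastforce simp: configs_def support_def)

lemma uses_edge_mem: "uses_edge k g i e \<Longrightarrow> i \<in> e"
  by (auto simp: uses_edge_def)

lemma uses_edge_subset: "\<lbrakk>g \<in> configs V k d; uses_edge k g i e\<rbrakk> \<Longrightarrow> e \<subseteq> V"
  by (auto simp: uses_edge_def dest: config_lists)

lemma arc_edge:
  assumes "finite V" "g \<in> configs V k d" "(a, b) \<in># arcs g" "a \<noteq> b"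
  shows "\<exists>e. uses_edge k g a e \<and> b \<in> e"
proof -
  obtain \<gamma> where "\<gamma> \<in> set (g a)" "b \<in> set \<gamma>"
    using assms by (auto simp: set_mset_arcs config_finite_support)
  moreover from this assms(4) have "\<gamma> \<noteq> replicate (k - 1) a"
    by auto
  ultimately show ?thesis
    by (auto simp: uses_edge_def)
qed

lemma uses_edge_arc:
  assumes "finite V" "g \<in> configs V k d" "uses_edge k g a e" "b \<in> e" "a \<noteq> b"
  shows "(a, b) \<in># arcs g"
  using assms by (auto simp: set_mset_arcs config_finite_support uses_edge_def)

lemma uses_edge_neighbour:
  assumes "g \<in> configs V k d" "uses_edge k g a e"
  shows "\<exists>b\<in>e. b \<noteq> a"
proof -
  obtain \<gamma> where \<gamma>: "\<gamma> \<in> set (g a)" "\<gamma> \<noteq> replicate (k - 1) a" "insert a (set \<gamma>) = e"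
    using assms by (auto simp: uses_edge_def)
  moreover from this assms have "length \<gamma> = k - 1"
    by (auto dest: config_lists)
  ultimately show ?thesis
    by (metis insertI2 replicate_eqI)
qed

section \<open>Balance and connectivity of closed walks\<close>

lemma closed_walks_nonempty: "config_coeff k g \<noteq> 0 \<Longrightarrow> closed_walks (arcs g) \<noteq> {}"
  by (auto simp: config_coeff_def)

text \<open>Tails and heads of the arcs both enumerate the vertices of the walk, so as many arcs
  have their tail in \<open>B\<close> as have their head in \<open>B\<close>. If none left
  \<open>B\<close>, these would be the same arcs, and none could enter.\<close>

lemma closed_walk_balance:
  assumes "w \<in> closed_walks M" "(a, b) \<in># M" "a \<notin> B" "b \<in> B"
  shows "\<exists>a' b'. (a', b') \<in># M \<and> a' \<in> B \<and> b' \<notin> B"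
proof (rule ccontr)
  assume contr: "\<not> ?thesis"
  let ?out = "filter_mset (\<lambda>p. fst p \<in> B) M" and ?inn = "filter_mset (\<lambda>p. snd p \<in> B) M"
  have "size ?out = size (filter_mset (\<lambda>v. v \<in> B) (image_mset fst M))"
    by (simp add: filter_mset_image_mset)
  also have "\<dots> = size (filter_mset (\<lambda>v. v \<in> B) (image_mset snd M))"
    using assms(1) by (simp add: closed_walk_fst closed_walk_snd)
  also have "\<dots> = size ?inn"
    by (simp add: filter_mset_image_mset)
  finally have "size ?out = size ?inn" .
  moreover have "?out \<subseteq># ?inn"
    using contr by (intro mset_subset_eqI) (auto simp: count_eq_zero_iff)
  ultimately have "?out = ?inn"
    by (metis mset_subset_size nless_le subset_mset.less_le)
  moreover have "(a, b) \<in># ?inn" "(a, b) \<notin># ?out"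
    using assms by auto
  ultimately show False by simp
qed

lemma closed_walk_connected:
  assumes "w \<in> closed_walks M" "\<And>a b. (a, b) \<in># M \<Longrightarrow> a \<in> B \<longleftrightarrow> b \<in> B"
    and "(a, b) \<in># M" "(a', b') \<in># M"
  shows "a \<in> B \<longleftrightarrow> a' \<in> B"
proof -
  have chain: "\<forall>v\<in>set w. v \<in> B \<longleftrightarrow> hd w \<in> B"
    if "\<forall>(a, b)\<in>set (zip w (tl w)). a \<in> B \<longleftrightarrow> b \<in> B" for w
    using that
  proof (induction w)
    case (Cons u w)
    then show ?case by (cases w) auto
  qed simp
  have "w \<noteq> []"
    using assms by (auto simp: closed_walks_def)
  then have "set (zip w (tl w)) \<subseteq> set (zip w (rotate1 w))"
    by (cases w) (auto simp: set_zip nth_append)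
  also have "\<dots> = set_mset M"
    using assms(1) by (auto simp: closed_walks_def)
  finally have "\<forall>v\<in>set w. v \<in> B \<longleftrightarrow> hd w \<in> B"
    using assms(2) by (intro chain) auto
  moreover have "a \<in> set w" "a' \<in> set w"
    using assms by (force simp: closed_walk_set)+
  ultimately show ?thesis by blast
qed

text \<open>An arc that is not a loop lies in a used edge, and no used edge crosses the boundary of
  \<open>B\<close>; hence the walk stays on one side.\<close>

lemma config_edges_connected:
  assumes g: "finite V" "g \<in> configs V k d" "config_coeff k g \<noteq> 0"
    and B: "\<And>f. f \<in> used_edges k g \<Longrightarrow> f \<subseteq> B \<or> f \<inter> B = {}"
    and ab: "(a, b) \<in># arcs g" "(a', b') \<in># arcs g"
  shows "a \<in> B \<longleftrightarrow> a' \<in> B"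
proof -
  obtain w where "w \<in> closed_walks (arcs g)"
    using closed_walks_nonempty[OF g(3)] by auto
  moreover have "a \<in> B \<longleftrightarrow> b \<in> B" if ab: "(a, b) \<in># arcs g" for a b
  proof (cases "a = b")
    case False
    then obtain e where "uses_edge k g a e" "b \<in> e"
      using arc_edge[OF g(1,2) ab] by blast
    then show ?thesis
      using B[of e] uses_edge_mem[of k g a e] by (auto simp: used_edges_def)
  qed simp
  ultimately show ?thesis
    using closed_walk_connected ab by meson
qed

text \<open>Connectivity with \<open>B = \<Union>F\<close>: the arcs of a used edge lie there, so
  all other arcs start there too, loops included. Since \<open>k \<ge> 2\<close>, no chosen list is
  empty, so every chosen list yields an arc.\<close>

lemma config_local:
  assumes g: "finite V" "g \<in> configs V k d" "config_coeff k g \<noteq> 0"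
    and F: "used_edges k g = F" "F \<noteq> {}" and k: "k \<ge> 2"
  shows "g \<in> configs (\<Union>F) k d"
proof -
  obtain e i where e: "e \<in> F" "uses_edge k g i e"
    using F by (auto simp: used_edges_def)
  then obtain j where "j \<in> e" "j \<noteq> i"
    using uses_edge_neighbour[OF g(2)] by blast
  then have ij: "(i, j) \<in># arcs g"
    using uses_edge_arc[OF g(1,2) e(2)] by simp
  have lists: "i \<in> \<Union>F \<and> set \<gamma> \<subseteq> \<Union>F \<and> length \<gamma> = k - 1" if \<gamma>: "\<gamma> \<in> set (g i)" for i \<gamma>
  proof -
    have "set \<gamma> \<noteq> {}"
      using config_lists[OF g(2) \<gamma>] k by auto
    then obtain j' where "j' \<in> set \<gamma>"
      by (metis all_not_in_conv)
    then have "(i, j') \<in># arcs g"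
      using g \<gamma> by (auto simp: set_mset_arcs config_finite_support)
    moreover have "f \<subseteq> \<Union>F \<or> f \<inter> \<Union>F = {}" if "f \<in> used_edges k g" for f
      using that F(1) by blast
    ultimately have "i \<in> \<Union>F"
      using config_edges_connected[OF g _ _ ij, of "\<Union>F"] e(1) uses_edge_mem[OF e(2)] by blast
    moreover have "set \<gamma> \<subseteq> \<Union>F"
    proof (cases "\<gamma> = replicate (k - 1) i")
      case True
      then show ?thesis
        using \<open>i \<in> \<Union>F\<close> by auto
    next
      case False
      then have "insert i (set \<gamma>) \<in> F"
        using \<gamma> F by (auto simp: used_edges_def uses_edge_def)
      then show ?thesis by auto
    qed
    ultimately show ?thesis
      using config_lists[OF g(2) \<gamma>] by blast
  qed
  have sup: "support g \<subseteq> \<Union>F"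
  proof
    fix i assume "i \<in> support g"
    then have "hd (g i) \<in> set (g i)"
      by (simp add: support_def)
    then show "i \<in> \<Union>F"
      using lists by simp
  qed
  have "\<Union>F \<subseteq> V"
    using F(1) uses_edge_subset[OF g(2)] by (auto simp: used_edges_def)
  then have "(\<Sum>i\<in>\<Union>F. length (g i)) = (\<Sum>i\<in>V. length (g i))"
    using g(1) sup by (intro sum.mono_neutral_left) (auto simp: support_def)
  then show ?thesis
    using g(2) lists sup by (auto simp: configs_def)
qed

lemma configs_mono:
  assumes "finite V" "U \<subseteq> V"
  shows "configs U k d \<subseteq> configs V k d"
proof
  fix g assume g: "g \<in> configs U k d"
  then have "(\<Sum>i\<in>U. length (g i)) = (\<Sum>i\<in>V. length (g i))"
    using assms by (intro sum.mono_neutral_left) (auto simp: configs_def support_def)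
  with g show "g \<in> configs V k d"
    using assms by (fastforce simp: configs_def)
qed

lemma part_superset:
  assumes "finite V" "\<Union>F \<subseteq> V" "F \<noteq> {}" "k \<ge> 2"
  shows "part k d b w F =
    (\<Sum>g | g \<in> configs V k d \<and> used_edges k g = F. config_coeff k g * config_weight k b w g)"
  unfolding part_def
proof (rule sum.mono_neutral_left)
  show "finite {g \<in> configs V k d. used_edges k g = F}"
    using assms by (simp add: finite_configs)
  show "{g \<in> configs (\<Union>F) k d. used_edges k g = F} \<subseteq> {g \<in> configs V k d. used_edges k g = F}"
    using configs_mono assms by blast
  show "\<forall>g\<in>{g \<in> configs V k d. used_edges k g = F} - {g \<in> configs (\<Union>F) k d. used_edges k g = F}.
      config_coeff k g * config_weight k b w g = 0"
    using config_local[OF assms(1) _ _ _ assms(3,4)] by auto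
qed

section \<open>The trace as a sum over edge sets\<close>

lemma prod_list_loops:
  fixes a b :: real
  shows "(\<Prod>\<gamma>\<leftarrow>xs. if \<gamma> = \<rho> then a else b) = a ^ count_list xs \<rho> * b ^ (length xs - count_list xs \<rho>)"
proof (induction xs)
  case (Cons x xs)
  have "count_list xs \<rho> \<le> length xs"
    by (rule count_le_length)
  with Cons show ?case by (simp add: Suc_diff_le)
qed simp

lemma prod_A_alpha_config:
  assumes G: "k_uniform k G" and k: "k \<ge> 2" and g: "g \<in> configs (verts G) k d"
  shows "(\<Prod>i\<in>verts G. \<Prod>\<gamma>\<leftarrow>g i. A_alpha \<alpha> k G (i # \<gamma>)) =
    (if used_edges k g \<subseteq> hedges G
     then config_weight k ((1 - \<alpha>) / fact (k - 1)) (\<lambda>v. \<alpha> * real (vertex_degree G v)) g else 0)"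
proof -
  let ?b = "(1 - \<alpha>) / fact (k - 1)" and ?w = "\<lambda>v. \<alpha> * real (vertex_degree G v)"
  have fin: "finite (verts G)"
    using G by (simp add: k_uniform_def)
  have loop_iff: "i # \<gamma> = replicate k i \<longleftrightarrow> \<gamma> = replicate (k - 1) i" for i \<gamma>
    using k by (cases k) auto
  \<comment> \<open>A constant list has a singleton as its vertex set, which is no edge; so no entry
    receives contributions from both tensors.\<close>
  have no_loop: "insert i (set (replicate (k - 1) i)) \<notin> hedges G" for i
  proof -
    have "card (insert i (set (replicate (k - 1) i))) = 1"
      using k by simp
    then show ?thesis
      using G k by (auto simp: k_uniform_def simp del: set_replicate)
  qed
  have entry: "A_alpha \<alpha> k G (i # \<gamma>) = (if \<gamma> = replicate (k - 1) i then ?w i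
      else if insert i (set \<gamma>) \<in> hedges G then ?b else 0)" for i \<gamma>
    using loop_iff[of i \<gamma>] no_loop[of i]
    by (auto simp: A_alpha_def degree_tensor_def adjacency_tensor_def)
  show ?thesis
  proof (cases "used_edges k g \<subseteq> hedges G")
    case True
    have "(\<Prod>i\<in>verts G. \<Prod>\<gamma>\<leftarrow>g i. A_alpha \<alpha> k G (i # \<gamma>))
        = (\<Prod>i\<in>verts G. \<Prod>\<gamma>\<leftarrow>g i. if \<gamma> = replicate (k - 1) i then ?w i else ?b)"
    proof (intro prod.cong refl arg_cong[where f = prod_list] map_cong)
      fix i \<gamma> assume "\<gamma> \<in> set (g i)"
      with True show "A_alpha \<alpha> k G (i # \<gamma>) = (if \<gamma> = replicate (k - 1) i then ?w i else ?b)"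
        by (auto simp: entry used_edges_def uses_edge_def)
    qed
    also have "\<dots> = config_weight k ?b ?w g"
      unfolding config_weight_def prod_list_loops loop_count_def using fin g
      by (intro prod.mono_neutral_right) (auto simp: configs_def support_def)
    finally show ?thesis
      using True by simp
  next
    case False
    then obtain i \<gamma> where "\<gamma> \<in> set (g i)" "\<gamma> \<noteq> replicate (k - 1) i" "insert i (set \<gamma>) \<notin> hedges G"
      by (auto simp: used_edges_def uses_edge_def)
    moreover from this g have "i \<in> verts G"
      by (auto dest: config_lists)
    ultimately have "\<exists>i\<in>verts G. (\<Prod>\<gamma>\<leftarrow>g i. A_alpha \<alpha> k G (i # \<gamma>)) = 0"
      by (intro bexI[of _ i]) (force simp: entry prod_list_zero_iff)+
    then show ?thesis
      using fin False by simp
  qed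
qed

text \<open>Configurations are grouped by their used edges. Those that use a non-edge have weight
  zero, and by \<open>part_superset\<close> each group with a nonempty edge set depends only on that
  set and the weights on it.\<close>

theorem tensor_trace_A_alpha:
  fixes G :: "'b hypergraph" and \<alpha> :: real
  assumes G: "k_uniform k G" and k: "k \<ge> 2" and d: "d > 0"
  defines "b \<equiv> (1 - \<alpha>) / fact (k - 1)" and "w \<equiv> \<lambda>v. \<alpha> * real (vertex_degree G v)"
  shows "tensor_trace (verts G) k (A_alpha \<alpha> k G) d = real ((k - 1) ^ (card (verts G) - 1)) *
    (loop_part k d b w (verts G) + (\<Sum>F\<in>Pow (hedges G) - {{}}. part k d b w F))"
proof -
  let ?C = "configs (verts G) k d" and ?E = "hedges G"
  let ?h = "\<lambda>g. config_coeff k g * config_weight k b w g"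
  have fin: "finite (verts G)" and edges: "\<And>e. e \<in> ?E \<Longrightarrow> e \<subseteq> verts G"
    using G by (auto simp: k_uniform_def)
  then have finE: "finite ?E"
    by (meson Pow_iff finite_Pow_iff finite_subset subsetI)
  have finC: "finite ?C"
    using fin by (rule finite_configs)
  have "(\<Sum>g\<in>?C. config_coeff k g * (\<Prod>i\<in>verts G. \<Prod>\<gamma>\<leftarrow>g i. A_alpha \<alpha> k G (i # \<gamma>)))
      = (\<Sum>g\<in>?C. if used_edges k g \<in> Pow ?E then ?h g else 0)"
    using G k by (intro sum.cong) (auto simp: prod_A_alpha_config b_def w_def)
  also have "\<dots> = (\<Sum>g | g \<in> ?C \<and> used_edges k g \<in> Pow ?E. ?h g)"
    using finC by (intro sum.inter_filter[symmetric])
  also have "\<dots> = (\<Sum>F\<in>Pow ?E. \<Sum>g\<in>{g \<in> {g \<in> ?C. used_edges k g \<in> Pow ?E}. used_edges k g = F}. ?h g)"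
    using finC finE by (intro sum.group[symmetric]) auto
  also have "\<dots> = (\<Sum>F\<in>Pow ?E. \<Sum>g | g \<in> ?C \<and> used_edges k g = F. ?h g)"
    by (intro sum.cong) auto
  also have "\<dots> = loop_part k d b w (verts G)
      + (\<Sum>F\<in>Pow ?E - {{}}. \<Sum>g | g \<in> ?C \<and> used_edges k g = F. ?h g)"
    using finE by (subst sum.remove[of _ "{}"]) (auto simp: loop_part_def)
  also have "(\<Sum>F\<in>Pow ?E - {{}}. \<Sum>g | g \<in> ?C \<and> used_edges k g = F. ?h g)
      = (\<Sum>F\<in>Pow ?E - {{}}. part k d b w F)"
  proof (rule sum.cong[OF refl])
    fix F assume "F \<in> Pow ?E - {{}}"
    then have "\<Union>F \<subseteq> verts G" "F \<noteq> {}"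
      using edges by auto
    then show "(\<Sum>g | g \<in> ?C \<and> used_edges k g = F. ?h g) = part k d b w F"
      using part_superset[OF fin _ _ k] by simp
  qed
  finally show ?thesis
    using fin d k by (simp add: tensor_trace_configs)
qed

lemma part_eq_0:
  assumes "\<And>g. \<lbrakk>g \<in> configs (\<Union>F) k d; used_edges k g = F\<rbrakk> \<Longrightarrow> config_coeff k g = 0"
  shows "part k d b w F = 0"
  unfolding part_def using assms by (intro sum.neutral) auto

text \<open>\<open>B\<close> separates \<open>e\<close> from \<open>e'\<close>, whereas the arcs of
  a configuration with nonzero coefficient form a single closed walk.\<close>

lemma part_disconnected:
  assumes "finite (\<Union>F)" and B: "\<And>f. f \<in> F \<Longrightarrow> f \<subseteq> B \<or> f \<inter> B = {}"
    and e: "e \<in> F" "e \<subseteq> B" and e': "e' \<in> F" "e' \<inter> B = {}"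
  shows "part k d b w F = 0"
proof (rule part_eq_0, rule ccontr)
  fix g assume g: "g \<in> configs (\<Union>F) k d" "used_edges k g = F" "config_coeff k g \<noteq> 0"
  have arc: "\<exists>i\<in>f. \<exists>j. (i, j) \<in># arcs g" if "f \<in> F" for f
  proof -
    have "f \<in> used_edges k g"
      using that g(2) by simp
    then obtain i where i: "uses_edge k g i f"
      by (auto simp: used_edges_def)
    then obtain j where "j \<in> f" "j \<noteq> i"
      using uses_edge_neighbour[OF g(1)] by blast
    then show ?thesis
      using uses_edge_arc[OF assms(1) g(1) i] uses_edge_mem[OF i] by blast
  qed
  obtain i j where "i \<in> e" "(i, j) \<in># arcs g"
    using arc e by blast
  moreover obtain i' j' where "i' \<in> e'" "(i', j') \<in># arcs g"
    using arc e' by blast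
  ultimately show False
    using config_edges_connected[OF assms(1) g(1,3), of B i j i' j'] e e' g(2) B by auto
qed

lemma part_cong:
  assumes "\<And>v. v \<in> \<Union>F \<Longrightarrow> w v = w' v"
  shows "part k d b w F = part k d b w' F"
  unfolding part_def
proof (intro sum.cong refl arg_cong2[of _ _ _ _ "(*)"])
  fix g assume "g \<in> {g. g \<in> configs (\<Union>F) k d \<and> used_edges k g = F}"
  then have "support g \<subseteq> \<Union>F"
    by (simp add: configs_def)
  with assms have "w i = w' i" if "i \<in> support g" for i
    using that by blast
  then show "config_weight k b w g = config_weight k b w' g"
    by (simp add: config_weight_def)
qed

section \<open>Relabelling vertices\<close>

definition push :: "('b \<Rightarrow> 'b) \<Rightarrow> ('b \<Rightarrow> 'b list list) \<Rightarrow> 'b \<Rightarrow> 'b list list" where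
  "push \<pi> g j = map (map \<pi>) (g (inv \<pi> j))"

context
  fixes \<pi> :: "'b \<Rightarrow> 'b"
  assumes \<pi>: "bij \<pi>"
begin

lemma push_apply [simp]: "push \<pi> g (\<pi> i) = map (map \<pi>) (g i)"
  using \<pi> by (simp add: push_def bij_is_inj)

lemma push_inv: "push (inv \<pi>) (push \<pi> g) = g" "push \<pi> (push (inv \<pi>) g) = g"
  using \<pi> by (auto simp: push_def fun_eq_iff o_def inv_inv_eq bij_is_inj bij_is_surj surj_f_inv_f)

lemma support_push: "support (push \<pi> g) = \<pi> ` support g"
  using \<pi> by (force simp: support_def push_def image_iff bij_is_inj bij_is_surj surj_f_inv_f)

lemma config_push:
  assumes "g \<in> configs V k d"
  shows "push \<pi> g \<in> configs (\<pi> ` V) k d"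
proof -
  have "(\<Sum>i\<in>\<pi> ` V. length (push \<pi> g i)) = (\<Sum>i\<in>V. length (g i))"
    using \<pi> by (subst sum.reindex) (auto intro: inj_on_subset[OF bij_is_inj])
  moreover have "set (push \<pi> g i) \<subseteq> index_lists (\<pi> ` V) (k - 1)" for i
    using config_lists[OF assms] by (fastforce simp: push_def)
  ultimately show ?thesis
    using assms by (auto simp: configs_def support_push)
qed

lemma image_multiset_sum: "image_mset f (\<Sum>i\<in>A. h i) = (\<Sum>i\<in>A. image_mset f (h i))"
  by (induction A rule: infinite_finite_induct) simp_all

lemma arcs_push: "arcs (push \<pi> g) = image_mset (map_prod \<pi> \<pi>) (arcs g)"
proof -
  have "arcs (push \<pi> g) = (\<Sum>i\<in>support g. image_mset (Pair (\<pi> i)) (mset (concat (map (map \<pi>) (g i)))))"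
    unfolding arcs_def support_push using \<pi>
    by (subst sum.reindex) (auto intro: inj_on_subset[OF bij_is_inj])
  also have "\<dots> = (\<Sum>i\<in>support g. image_mset (map_prod \<pi> \<pi>) (image_mset (Pair i) (mset (concat (g i)))))"
    by (intro sum.cong refl) (simp add: map_concat[symmetric] image_mset.compositionality o_def)
  also have "\<dots> = image_mset (map_prod \<pi> \<pi>) (arcs g)"
    by (simp add: arcs_def image_multiset_sum)
  finally show ?thesis .
qed

lemma mfact_image: "inj f \<Longrightarrow> mfact (image_mset f M) = mfact M"
proof (induction M)
  case (add x M)
  moreover have "count (image_mset f M) (f x) = count M x"
    using add.prems by (induction M) (auto simp: inj_eq)
  ultimately show ?case
    by (simp add: mfact_add_mset)
qed simp

lemma map_closed_walk:
  "w \<in> closed_walks M \<Longrightarrow> map f w \<in> closed_walks (image_mset (map_prod f f) M)"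
  by (auto simp: closed_walks_def rotate1_map zip_map_map map_prod_def simp flip: mset_map)

lemma card_closed_walks_image:
  "card (closed_walks (image_mset (map_prod \<pi> \<pi>) M)) = card (closed_walks M)"
proof -
  have "image_mset (map_prod (inv \<pi>) (inv \<pi>)) (image_mset (map_prod \<pi> \<pi>) M) = M"
    using \<pi> by (simp add: image_mset.compositionality o_def map_prod_def bij_is_inj split_def)
  then have "bij_betw (map \<pi>) (closed_walks M) (closed_walks (image_mset (map_prod \<pi> \<pi>) M))"
    using \<pi> map_closed_walk[of _ M \<pi>] map_closed_walk[of _ "image_mset (map_prod \<pi> \<pi>) M" "inv \<pi>"]
    by (intro bij_betw_byWitness[where f' = "map (inv \<pi>)"])
      (auto simp: o_def bij_is_inj bij_is_surj surj_f_inv_f)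
  then show ?thesis
    by (simp add: bij_betw_same_card)
qed

lemma config_coeff_push: "config_coeff k (push \<pi> g) = config_coeff k g"
proof -
  have "inj (map_prod \<pi> \<pi>)"
    using \<pi> by (simp add: bij_is_inj prod.inj_map)
  moreover have "(\<Prod>i\<in>support (push \<pi> g). fact (length (push \<pi> g i) * (k - 1)))
      = (\<Prod>i\<in>support g. fact (length (g i) * (k - 1)) :: real)"
    unfolding support_push using \<pi> by (subst prod.reindex) (auto intro: inj_on_subset[OF bij_is_inj])
  ultimately show ?thesis
    by (simp add: config_coeff_def arcs_push mfact_image card_closed_walks_image)
qed

lemma loop_count_push: "loop_count k (push \<pi> g) (\<pi> i) = loop_count k g i"
proof -
  have "count_list (map (map \<pi>) xs) (map \<pi> \<rho>) = count_list xs \<rho>" for xs \<rho>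
    using \<pi> by (induction xs) (auto simp: bij_is_inj inj_map_eq_map)
  from this[of "g i" "replicate (k - 1) i"] show ?thesis
    by (simp add: loop_count_def)
qed

lemma config_weight_push:
  assumes "\<And>i. i \<in> support g \<Longrightarrow> w' (\<pi> i) = w i"
  shows "config_weight k b w' (push \<pi> g) = config_weight k b w g"
  unfolding config_weight_def support_push using \<pi> assms
  by (subst prod.reindex) (auto simp: loop_count_push intro!: prod.cong intro: inj_on_subset[OF bij_is_inj])

lemma uses_edge_push: "uses_edge k (push \<pi> g) (\<pi> i) (\<pi> ` e) \<longleftrightarrow> uses_edge k g i e"
proof -
  have "map \<pi> \<gamma> = replicate (k - 1) (\<pi> i) \<longleftrightarrow> \<gamma> = replicate (k - 1) i" for \<gamma>
    using \<pi> by (metis bij_is_inj inj_map_eq_map map_replicate)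
  moreover have "insert (\<pi> i) (\<pi> ` set \<gamma>) = \<pi> ` e \<longleftrightarrow> insert i (set \<gamma>) = e" for \<gamma>
    using \<pi> by (metis bij_is_inj image_insert inj_image_eq_iff)
  ultimately show ?thesis
    by (simp add: uses_edge_def)
qed

lemma used_edges_push: "used_edges k (push \<pi> g) = (`) \<pi> ` used_edges k g"
proof (intro equalityI subsetI)
  fix e assume "e \<in> used_edges k (push \<pi> g)"
  then obtain i where i: "uses_edge k (push \<pi> g) i e"
    by (auto simp: used_edges_def)
  have "i = \<pi> (inv \<pi> i)" "e = \<pi> ` (inv \<pi> ` e)"
    using \<pi> by (auto simp: bij_is_surj surj_f_inv_f image_image)
  with i have "uses_edge k g (inv \<pi> i) (inv \<pi> ` e)"
    using uses_edge_push by metis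
  with \<open>e = _\<close> show "e \<in> (`) \<pi> ` used_edges k g"
    by (auto simp: used_edges_def)
next
  fix e assume "e \<in> (`) \<pi> ` used_edges k g"
  then obtain e' i where "uses_edge k g i e'" "e = \<pi> ` e'"
    by (auto simp: used_edges_def)
  then show "e \<in> used_edges k (push \<pi> g)"
    using uses_edge_push[of k g i e'] by (auto simp: used_edges_def)
qed

end

lemma sum_configs_push:
  fixes \<pi> :: "'b \<Rightarrow> 'b"
  assumes \<pi>: "bij \<pi>" and w: "\<And>v. v \<in> V \<Longrightarrow> w' (\<pi> v) = w v"
  shows "(\<Sum>g | g \<in> configs (\<pi> ` V) k d \<and> used_edges k g = (`) \<pi> ` F. config_coeff k g * config_weight k b w' g)
    = (\<Sum>g | g \<in> configs V k d \<and> used_edges k g = F. config_coeff k g * config_weight k b w g)"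
    (is "sum ?h' ?S' = sum ?h ?S")
proof -
  have \<pi>': "bij (inv \<pi>)"
    using \<pi> by (rule bij_imp_bij_inv)
  have inv_img: "inv \<pi> ` (\<pi> ` V) = V" "(`) (inv \<pi>) ` ((`) \<pi> ` F) = F"
    using \<pi> by (simp_all add: image_image bij_is_inj)
  show ?thesis
  proof (rule sum.reindex_bij_witness[of _ "push \<pi>" "push (inv \<pi>)"])
    fix g assume g: "g \<in> ?S'"
    then show "push \<pi> (push (inv \<pi>) g) = g" and S: "push (inv \<pi>) g \<in> ?S"
      using push_inv[OF \<pi>] config_push[OF \<pi>', of g "\<pi> ` V" k d] used_edges_push[OF \<pi>', of k g] inv_img
      by auto
    have "support (push (inv \<pi>) g) \<subseteq> V"
      using S by (simp add: configs_def)
    then show "?h (push (inv \<pi>) g) = ?h' g"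
      using config_coeff_push[OF \<pi>, of k "push (inv \<pi>) g"]
        config_weight_push[OF \<pi>, of "push (inv \<pi>) g" w' w k b] w push_inv(2)[OF \<pi>, of g]
      by (simp add: subset_iff)
  next
    fix g assume "g \<in> ?S"
    then show "push (inv \<pi>) (push \<pi> g) = g" "push \<pi> g \<in> ?S'"
      using push_inv[OF \<pi>] config_push[OF \<pi>] used_edges_push[OF \<pi>] by auto
  qed
qed

text \<open>\<^const>\<open>push\<close> needs a permutation of the whole type.\<close>

lemma permutation_extending:
  fixes f :: "'b \<Rightarrow> 'b"
  assumes "finite U" "inj_on f U"
  obtains \<pi> where "bij \<pi>" "\<And>u. u \<in> U \<Longrightarrow> \<pi> u = f u"
proof -
  let ?W = "U \<union> f ` U"
  have "card (?W - U) = card (?W - f ` U)"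
    using assms by (subst (1 2) card_Diff_subset) (auto simp: card_image)
  then obtain h where h: "bij_betw h (?W - U) (?W - f ` U)"
    using assms by (metis finite_Diff finite_UnI finite_imageI finite_same_card_bij)
  define \<pi> where "\<pi> = (\<lambda>v. if v \<in> U then f v else if v \<in> ?W then h v else v)"
  have 1: "bij_betw \<pi> U (f ` U)"
    using assms by (auto simp: bij_betw_def \<pi>_def inj_on_def)
  have 2: "bij_betw \<pi> (?W - U) (?W - f ` U)"
    using h by (subst bij_betw_cong[of _ _ h]) (auto simp: \<pi>_def)
  have 3: "bij_betw \<pi> (- ?W) (- ?W)"
    by (auto simp: bij_betw_def \<pi>_def inj_on_def)
  have "bij_betw \<pi> (U \<union> (?W - U) \<union> - ?W) (f ` U \<union> (?W - f ` U) \<union> - ?W)"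
    by (rule bij_betw_combine[OF bij_betw_combine[OF 1 2] 3]) auto
  moreover have "U \<union> (?W - U) \<union> - ?W = UNIV" "f ` U \<union> (?W - f ` U) \<union> - ?W = UNIV"
    by auto
  ultimately have "bij \<pi>" by simp
  then show thesis
    using that by (simp add: \<pi>_def)
qed

text \<open>Injectivity is only given on the vertices of \<open>F\<close>, while relabelling works
  with bijections; so \<open>f\<close> is replaced by a permutation that agrees with it
  there.\<close>

lemma part_image:
  fixes f :: "'b \<Rightarrow> 'b"
  assumes "finite (\<Union>F)" "inj_on f (\<Union>F)" "\<And>v. v \<in> \<Union>F \<Longrightarrow> w' (f v) = w v"
  shows "part k d b w' ((`) f ` F) = part k d b w F"
proof -
  obtain \<pi> where \<pi>: "bij \<pi>" "\<And>u. u \<in> \<Union>F \<Longrightarrow> \<pi> u = f u"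
    using permutation_extending[OF assms(1,2)] by metis
  have "f ` e = \<pi> ` e" if "e \<in> F" for e
    by (intro image_cong refl \<pi>(2)[symmetric] UnionI[OF that])
  then have "(`) f ` F = (`) \<pi> ` F"
    by (rule image_cong[OF refl])
  moreover have "\<Union>((`) \<pi> ` F) = \<pi> ` \<Union>F"
    by auto
  ultimately show ?thesis
    using sum_configs_push[OF \<pi>(1), of "\<Union>F" w' w] assms(3) \<pi>(2) by (simp add: part_def)
qed

lemma loop_part_image:
  fixes \<pi> :: "'b \<Rightarrow> 'b"
  assumes "bij \<pi>" "\<And>v. v \<in> V \<Longrightarrow> w' (\<pi> v) = w v"
  shows "loop_part k d b w' (\<pi> ` V) = loop_part k d b w V"
  using sum_configs_push[where \<pi> = \<pi> and V = V and w' = w' and w = w and F = "{}"] assms by (simp add: loop_part_def)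

section \<open>The number of tensor entries needed by an edge set\<close>

text \<open>If \<open>B\<close> is entered along \<open>e\<close> at \<open>i\<close>, then balance forces an arc out of \<open>B\<close>, which can only
  leave from \<open>i\<close> along an edge in \<open>Q\<close>.\<close>

lemma uses_edge_spread:
  assumes g: "finite V" "g \<in> configs V k d" "config_coeff k g \<noteq> 0"
    and e: "e \<in> used_edges k g" "e \<in> Q" "i \<in> e" "i \<in> B" "e \<inter> B \<subseteq> {i}"
    and Q: "\<And>f. \<lbrakk>f \<in> used_edges k g; f \<inter> B \<noteq> {}; \<not> f \<subseteq> B\<rbrakk> \<Longrightarrow> f \<in> Q \<and> f \<inter> B \<subseteq> {i}"
  shows "\<exists>f\<in>Q. uses_edge k g i f"
proof -
  obtain i' where i': "uses_edge k g i' e"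
    using e by (auto simp: used_edges_def)
  show ?thesis
  proof (cases "i' = i")
    case False
    then have "i' \<notin> B"
      using uses_edge_mem[OF i'] e by blast
    moreover have "(i', i) \<in># arcs g"
      using uses_edge_arc[OF g(1,2) i' e(3) False] .
    moreover obtain w where "w \<in> closed_walks (arcs g)"
      using closed_walks_nonempty[OF g(3)] by auto
    ultimately obtain p q where pq: "(p, q) \<in># arcs g" "p \<in> B" "q \<notin> B"
      using closed_walk_balance e(4) by meson
    then obtain f where f: "uses_edge k g p f" "q \<in> f"
      using arc_edge[OF g(1,2) pq(1)] by auto
    moreover have "p \<in> f"
      using uses_edge_mem[OF f(1)] .
    ultimately have "f \<in> Q \<and> f \<inter> B \<subseteq> {i}"
      using pq by (intro Q) (auto simp: used_edges_def)
    then show ?thesis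
      using f \<open>p \<in> f\<close> pq by blast
  qed (use i' e in blast)
qed

text \<open>Double counting of the pairs of a class \<open>c\<close> and a vertex \<open>i\<close>
  in \<open>E c\<close>. A list chosen at \<open>i\<close> determines its edge and, as the sets
  \<open>Q c\<close> are disjoint, its class; so different classes need different lists at
  \<open>i\<close>.\<close>

lemma config_cost:
  assumes g: "finite V" "g \<in> configs V k d"
    and C: "finite C" "\<And>c c'. \<lbrakk>c \<in> C; c' \<in> C; c \<noteq> c'\<rbrakk> \<Longrightarrow> Q c \<inter> Q c' = {}"
    and E: "\<And>c. c \<in> C \<Longrightarrow> card (E c) = m"
    and use: "\<And>c i. \<lbrakk>c \<in> C; i \<in> E c\<rbrakk> \<Longrightarrow> \<exists>e\<in>Q c. uses_edge k g i e"
  shows "m * card C \<le> d"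
proof -
  have EV: "E c \<subseteq> V" if "c \<in> C" for c
    using use[OF that] uses_edge_subset[OF g(2)] uses_edge_mem[of k g] by blast
  have "m * card C = (\<Sum>i\<in>V. card {c \<in> C. i \<in> E c})"
  proof (rule sum_multicount[symmetric])
    show "\<forall>c\<in>C. card {i \<in> V. i \<in> E c} = m"
    proof
      fix c assume "c \<in> C"
      moreover from this have "{i \<in> V. i \<in> E c} = E c"
        using EV by blast
      ultimately show "card {i \<in> V. i \<in> E c} = m"
        using E by simp
    qed
  qed (use g C in auto)
  also have "\<dots> \<le> (\<Sum>i\<in>V. length (g i))"
  proof (rule sum_mono)
    fix i
    let ?C = "{c \<in> C. i \<in> E c}"
    have "\<forall>c\<in>?C. \<exists>\<gamma>. \<gamma> \<in> set (g i) \<and> insert i (set \<gamma>) \<in> Q c"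
      using use by (fastforce simp: uses_edge_def)
    then obtain h where h: "\<forall>c\<in>?C. h c \<in> set (g i) \<and> insert i (set (h c)) \<in> Q c"
      by metis
    have "inj_on h ?C"
    proof (rule inj_onI, rule ccontr)
      fix c c' assume c: "c \<in> ?C" "c' \<in> ?C" "h c = h c'" "c \<noteq> c'"
      with h have "insert i (set (h c)) \<in> Q c \<inter> Q c'"
        by auto
      with C(2)[of c c'] c show False by auto
    qed
    then have "card ?C = card (h ` ?C)"
      by (simp add: card_image)
    also have "\<dots> \<le> card (set (g i))"
      using h by (intro card_mono) auto
    also have "\<dots> \<le> length (g i)"
      by (rule card_length)
    finally show "card ?C \<le> length (g i)" .
  qed
  also have "\<dots> = d"
    using g by (simp add: configs_def)
  finally show ?thesis .
qed

section \<open>Mixed differences in two loop weights\<close>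

text \<open>Each loop at \<open>p\<close> contributes one factor \<open>s\<close> and each loop at
  \<open>z\<close> one factor \<open>t\<close>; what remains is the weight with both values set to
  1.\<close>

lemma config_weight_upd:
  assumes "finite (support g)" "p \<noteq> z"
  shows "config_weight k b (W(p := s, z := t)) g =
    config_weight k b (W(p := 1, z := 1)) g * (s ^ loop_count k g p * t ^ loop_count k g z)"
proof -
  let ?l = "loop_count k g"
  have zero: "?l i = 0" if "i \<notin> support g" for i
    using that by (simp add: support_def loop_count_def)
  have delta: "(\<Prod>i\<in>support g. if i = v then c ^ ?l i else 1) = c ^ ?l v" for c :: real and v
    using assms zero[of v] by (simp add: prod.delta)
  have "config_weight k b (W(p := s, z := t)) g = (\<Prod>i\<in>support g.
      (W(p := 1, z := 1)) i ^ ?l i * b ^ (length (g i) - ?l i) *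
      ((if i = p then s ^ ?l i else 1) * (if i = z then t ^ ?l i else 1)))"
    unfolding config_weight_def using assms by (intro prod.cong) auto
  then show ?thesis
    unfolding config_weight_def by (simp only: prod.distrib delta)
qed

text \<open>Each configuration contributes a multiple of a power of \<open>s\<close> times a power
  of \<open>t\<close>, and the mixed difference of such a product is the product of the two
  differences.\<close>

lemma part_mixed_difference:
  assumes fin: "finite (\<Union>F)" and "p \<noteq> z"
  shows "part k d b (W(p := s', z := t')) F + part k d b (W(p := s, z := t)) F
      - (part k d b (W(p := s, z := t')) F + part k d b (W(p := s', z := t)) F) =
    (\<Sum>g | g \<in> configs (\<Union>F) k d \<and> used_edges k g = F.
       config_coeff k g * config_weight k b (W(p := 1, z := 1)) g *
       ((s' ^ loop_count k g p - s ^ loop_count k g p) * (t' ^ loop_count k g z - t ^ loop_count k g z)))"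
  unfolding part_def sum.distrib[symmetric] sum_subtractf[symmetric]
proof (rule sum.cong[OF refl])
  fix g assume "g \<in> {g. g \<in> configs (\<Union>F) k d \<and> used_edges k g = F}"
  then have "finite (support g)"
    using config_finite_support[OF fin] by auto
  note upd = config_weight_upd[OF this \<open>p \<noteq> z\<close>, of k b W]
  show "config_coeff k g * config_weight k b (W(p := s', z := t')) g +
      config_coeff k g * config_weight k b (W(p := s, z := t)) g -
      (config_coeff k g * config_weight k b (W(p := s, z := t')) g +
       config_coeff k g * config_weight k b (W(p := s', z := t)) g) =
      config_coeff k g * config_weight k b (W(p := 1, z := 1)) g *
      ((s' ^ loop_count k g p - s ^ loop_count k g p) * (t' ^ loop_count k g z - t ^ loop_count k g z))"
    unfolding upd[of s t] upd[of s t'] upd[of s' t] upd[of s' t'] by (simp add: algebra_simps)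
qed

lemma config_weight_pos:
  assumes "\<And>i. i \<in> support g \<Longrightarrow> w i > 0" "b > 0"
  shows "config_weight k b w g > 0"
  unfolding config_weight_def using assms by (intro prod_pos) auto

text \<open>For \<open>s < s'\<close> and \<open>t < t'\<close> all terms of
  \<open>part_mixed_difference\<close> are nonnegative. Strictness needs one configuration with a
  loop at each of the two vertices.\<close>

lemma
  fixes s s' t t' b :: real
  assumes fin: "finite (\<Union>F)" and "p \<noteq> z" and pos: "\<And>v. v \<in> \<Union>F \<Longrightarrow> W v > 0" "b > 0"
    and st: "0 < s" "s < s'" "0 < t" "t < t'"
  shows part_mixed_difference_nonneg:
      "part k d b (W(p := s, z := t')) F + part k d b (W(p := s', z := t)) F
        \<le> part k d b (W(p := s', z := t')) F + part k d b (W(p := s, z := t)) F"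
    and part_mixed_difference_pos:
      "\<lbrakk>g \<in> configs (\<Union>F) k d; used_edges k g = F; config_coeff k g \<noteq> 0; loop_count k g p > 0;
        loop_count k g z > 0\<rbrakk> \<Longrightarrow>
       part k d b (W(p := s, z := t')) F + part k d b (W(p := s', z := t)) F
        < part k d b (W(p := s', z := t')) F + part k d b (W(p := s, z := t)) F"
proof -
  let ?S = "{g. g \<in> configs (\<Union>F) k d \<and> used_edges k g = F}"
  let ?t = "\<lambda>g. config_coeff k g * config_weight k b (W(p := 1, z := 1)) g *
       ((s' ^ loop_count k g p - s ^ loop_count k g p) * (t' ^ loop_count k g z - t ^ loop_count k g z))"
  have finS: "finite ?S"
    using finite_configs[OF fin] by simp
  have weight: "config_weight k b (W(p := 1, z := 1)) g > 0" if "g \<in> ?S" for g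
  proof (intro config_weight_pos pos(2))
    fix i assume "i \<in> support g"
    moreover have "support g \<subseteq> \<Union>F"
      using that by (simp add: configs_def)
    ultimately show "(W(p := 1, z := 1)) i > 0"
      using pos(1)[of i] by auto
  qed
  have nonneg: "?t g \<ge> 0" if "g \<in> ?S" for g
    using st weight[OF that] config_coeff_nonneg[of k g]
    by (intro mult_nonneg_nonneg) (auto intro!: power_mono)
  then have "sum ?t ?S \<ge> 0"
    by (intro sum_nonneg)
  then show "part k d b (W(p := s, z := t')) F + part k d b (W(p := s', z := t)) F
      \<le> part k d b (W(p := s', z := t')) F + part k d b (W(p := s, z := t)) F"
    using part_mixed_difference[OF fin \<open>p \<noteq> z\<close>, of k d b W s' t' s t] by linarith
  assume g: "g \<in> configs (\<Union>F) k d" "used_edges k g = F" "config_coeff k g \<noteq> 0"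
    "loop_count k g p > 0" "loop_count k g z > 0"
  have "config_coeff k g > 0"
    using config_coeff_nonneg[of k g] g(3) by linarith
  then have "?t g > 0"
    using st g weight[of g] by (intro mult_pos_pos) (auto intro!: power_strict_mono)
  then have "sum ?t ?S > 0"
    using g finS nonneg by (intro sum_pos2[of ?S g]) auto
  then show "part k d b (W(p := s, z := t')) F + part k d b (W(p := s', z := t)) F
      < part k d b (W(p := s', z := t')) F + part k d b (W(p := s, z := t)) F"
    using part_mixed_difference[OF fin \<open>p \<noteq> z\<close>, of k d b W s' t' s t] by linarith
qed

section \<open>Eulerian configurations\<close>

text \<open>The visited vertices \<open>S\<close> are recorded because two closed walks can be
  merged at a vertex that they share.\<close>

definition spanning_walk :: "('b \<times> 'b) multiset \<Rightarrow> 'b set \<Rightarrow> bool" where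
  "spanning_walk M S \<longleftrightarrow> (\<exists>w\<in>closed_walks M. set w = S)"

lemma closed_walk_append:
  assumes "xs \<noteq> []" "ys \<noteq> []"
  shows "mset (zip (xs @ ys) (rotate1 (xs @ ys)))
    = mset (zip xs (tl xs @ [hd ys])) + mset (zip ys (tl ys @ [hd xs]))"
proof -
  have "rotate1 (xs @ ys) = (tl xs @ [hd ys]) @ (tl ys @ [hd xs])"
    using assms by (cases xs; cases ys) auto
  then show ?thesis
    using assms by (simp only: mset_append[symmetric]) (subst zip_append, auto)
qed

text \<open>Rotating the list moves the start to \<open>v\<close> without changing the multiset of
  arcs.\<close>

lemma spanning_walk_hd:
  assumes "spanning_walk M S" "v \<in> S"
  shows "\<exists>w. w \<noteq> [] \<and> hd w = v \<and> set w = S \<and> mset (zip w (tl w @ [v])) = M"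
proof -
  obtain w where w: "mset (zip w (rotate1 w)) = M" "set w = S"
    using assms by (auto simp: spanning_walk_def closed_walks_def)
  then obtain xs ys where split: "w = xs @ v # ys"
    using assms(2) split_list by metis
  have "mset (zip ((v # ys) @ xs) (rotate1 ((v # ys) @ xs))) = M"
    using w(1) closed_walk_append[of xs "v # ys"] closed_walk_append[of "v # ys" xs]
    by (cases "xs = []") (simp_all only: split add.commute append_Nil append_Nil2 list.distinct simp_thms)
  then show ?thesis
    using w split by (intro exI[of _ "(v # ys) @ xs"]) (auto simp: zip_rotate1)
qed

lemma spanning_walk_Un:
  assumes "spanning_walk M S" "spanning_walk M' S'" "S \<inter> S' \<noteq> {}"
  shows "spanning_walk (M + M') (S \<union> S')"
proof -
  obtain v where "v \<in> S" "v \<in> S'"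
    using assms by auto
  then obtain w w' where "w \<noteq> []" "hd w = v" "set w = S" "mset (zip w (tl w @ [v])) = M"
    and "w' \<noteq> []" "hd w' = v" "set w' = S'" "mset (zip w' (tl w' @ [v])) = M'"
    using spanning_walk_hd assms by meson
  then show ?thesis
    using closed_walk_append[of w w']
    by (auto simp: spanning_walk_def closed_walks_def intro!: bexI[of _ "w @ w'"])
qed

lemma spanning_walk_loops:
  assumes "n > 0"
  shows "spanning_walk (replicate_mset n (p, p)) {p}"
proof -
  have "rotate1 (replicate n p) = replicate n p"
    by (rule replicate_eqI) auto
  then show ?thesis
    using assms unfolding spanning_walk_def closed_walks_def
    by (intro bexI[of _ "replicate n p"]) (auto simp: zip_replicate)
qed

lemma mset_set_insert_pair:
  "\<lbrakk>finite X; b \<notin> X; a \<notin> X; a \<noteq> b\<rbrakk> \<Longrightarrow> mset_set (insert a (insert b X)) = {#a, b#} + mset_set X"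
  by simp

lemma spanning_walk_star:
  assumes "finite A" "A \<noteq> {}" "v \<notin> A"
  shows "spanning_walk (mset_set ({v} \<times> A \<union> A \<times> {v})) (insert v A)"
  using assms
proof (induction A rule: finite_ne_induct)
  case (singleton u)
  then show ?case
    unfolding spanning_walk_def closed_walks_def by (intro bexI[of _ "[v, u]"]) auto
next
  case (insert u A)
  have "spanning_walk {#(v, u), (u, v)#} {v, u}"
    unfolding spanning_walk_def closed_walks_def by (intro bexI[of _ "[v, u]"]) auto
  moreover have "spanning_walk (mset_set ({v} \<times> A \<union> A \<times> {v})) (insert v A)"
    using insert.IH insert.prems by blast
  ultimately have "spanning_walk ({#(v, u), (u, v)#} + mset_set ({v} \<times> A \<union> A \<times> {v}))
      ({v, u} \<union> insert v A)"
    by (intro spanning_walk_Un) auto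
  moreover have "mset_set ({v} \<times> insert u A \<union> insert u A \<times> {v})
      = {#(v, u), (u, v)#} + mset_set ({v} \<times> A \<union> A \<times> {v})"
  proof -
    have eq: "{v} \<times> insert u A \<union> insert u A \<times> {v} = insert (v, u) (insert (u, v) ({v} \<times> A \<union> A \<times> {v}))"
      by auto
    show ?thesis
      unfolding eq using insert.hyps insert.prems by (intro mset_set_insert_pair) auto
  qed
  moreover have "{v, u} \<union> insert v A = insert v (insert u A)"
    by auto
  ultimately show ?case
    by (simp only:)
qed

text \<open>A new vertex \<open>v\<close> adds the arcs between \<open>v\<close> and
  \<open>A\<close>, which form a closed walk going out and back from \<open>v\<close>. If
  \<open>A\<close> is a single vertex, that star is already everything.\<close>

lemma spanning_walk_complete:
  assumes "finite A" "card A \<ge> 2"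
  shows "spanning_walk (mset_set {(i, j). i \<in> A \<and> j \<in> A \<and> i \<noteq> j}) A"
  using assms
proof (induction A rule: finite_induct)
  case (insert v A)
  let ?K = "\<lambda>A. {(i, j). i \<in> A \<and> j \<in> A \<and> i \<noteq> j}"
  have finK: "finite (?K A)"
    by (rule finite_subset[of _ "A \<times> A"]) (use insert.hyps in auto)
  have "A \<noteq> {}"
    using insert.prems by auto
  note star = spanning_walk_star[OF insert.hyps(1) this insert.hyps(2)]
  have K: "?K (insert v A) = ?K A \<union> ({v} \<times> A \<union> A \<times> {v})"
    using insert.hyps by auto
  show ?case
  proof (cases "card A \<ge> 2")
    case True
    have "mset_set (?K (insert v A)) = mset_set (?K A) + mset_set ({v} \<times> A \<union> A \<times> {v})"
      unfolding K using insert.hyps finK by (intro mset_set_Union) auto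
    moreover have "spanning_walk (mset_set (?K A) + mset_set ({v} \<times> A \<union> A \<times> {v})) (A \<union> insert v A)"
      using True insert.IH star \<open>A \<noteq> {}\<close> by (intro spanning_walk_Un) auto
    ultimately show ?thesis
      by (simp add: Un_absorb1 subset_insertI)
  next
    case False
    then have "card A = 1"
      using insert by simp
    then have "?K A = {}"
      by (auto simp: card_1_singleton_iff)
    then have "?K (insert v A) = {v} \<times> A \<union> A \<times> {v}"
      using K by (simp only: Un_empty_left)
    with star show ?thesis
      by (simp only:)
  qed
qed simp

text \<open>A witness for a nonzero coefficient, in a form that is preserved when configurations
  with a common vertex are combined.\<close>

definition eulerian_config :: "nat \<Rightarrow> nat \<Rightarrow> 'b set set \<Rightarrow> 'b set \<Rightarrow> ('b \<Rightarrow> 'b list list) \<Rightarrow> bool" where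
  "eulerian_config k d F S g \<longleftrightarrow> finite S \<and> g \<in> configs S k d \<and> used_edges k g = F \<and> spanning_walk (arcs g) S"

lemma eulerian_config_coeff: "eulerian_config k d F S g \<Longrightarrow> config_coeff k g \<noteq> 0"
  using mfact_pos[of "arcs g"] config_finite_support[of S g k d]
  by (auto simp: eulerian_config_def spanning_walk_def config_coeff_def)

lemma eulerian_config_append:
  assumes g: "eulerian_config k d F S g" and h: "eulerian_config k d' F' S' h" and "S \<inter> S' \<noteq> {}"
  shows "eulerian_config k (d + d') (F \<union> F') (S \<union> S') (\<lambda>i. g i @ h i)"
proof -
  have fin: "finite (S \<union> S')"
    using g h by (auto simp: eulerian_config_def)
  have gV: "g \<in> configs (S \<union> S') k d" and hV: "h \<in> configs (S \<union> S') k d'"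
    using g h configs_mono[OF fin] by (auto simp: eulerian_config_def)
  then have sup: "support g \<subseteq> S \<union> S'" "support h \<subseteq> S \<union> S'"
    by (auto simp: configs_def)
  moreover have sup': "support (\<lambda>i. g i @ h i) = support g \<union> support h"
    by (auto simp: support_def)
  ultimately have "arcs (\<lambda>i. g i @ h i) = arcs g + arcs h"
    using fin by (simp add: arcs_superset[of "S \<union> S'"] sum.distrib)
  moreover have "used_edges k (\<lambda>i. g i @ h i) = used_edges k g \<union> used_edges k h"
    by (auto simp: used_edges_def uses_edge_def)
  moreover have "(\<lambda>i. g i @ h i) \<in> configs (S \<union> S') k (d + d')"
    using gV hV sup' by (simp add: configs_def sum.distrib)
  ultimately show ?thesis
    using g h assms(3) fin by (simp add: eulerian_config_def spanning_walk_Un)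
qed

lemma eulerian_config_loop:
  assumes "k \<ge> 2"
  shows "eulerian_config k 1 {} {p} (\<lambda>i. if i = p then [replicate (k - 1) p] else [])"
proof -
  define g where "g = (\<lambda>i. if i = p then [replicate (k - 1) p] else [])"
  have sup: "support g = {p}"
    by (auto simp: support_def g_def)
  have "set (g i) \<subseteq> index_lists {p} (k - 1)" for i
    by (cases "i = p") (auto simp: g_def)
  moreover have "length (g p) = 1"
    by (simp add: g_def)
  ultimately have "g \<in> configs {p} k 1"
    unfolding configs_def mem_Collect_eq sup by simp
  moreover have "used_edges k g = {}"
    by (simp add: used_edges_def uses_edge_def g_def)
  moreover have "arcs g = replicate_mset (k - 1) (p, p)"
    unfolding arcs_def sup by (simp add: g_def)
  ultimately show ?thesis
    unfolding eulerian_config_def g_def using assms spanning_walk_loops[of "k - 1" p] by simp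
qed

lemma sum_mset_set_disjoint:
  assumes "finite A" "\<And>i. i \<in> A \<Longrightarrow> finite (B i)" "\<And>i j. \<lbrakk>i \<in> A; j \<in> A; i \<noteq> j\<rbrakk> \<Longrightarrow> B i \<inter> B j = {}"
  shows "(\<Sum>i\<in>A. mset_set (B i)) = mset_set (\<Union>i\<in>A. B i)"
  using assms
proof (induction A rule: finite_induct)
  case (insert i A)
  have "B i \<inter> (\<Union>j\<in>A. B j) = {}"
    using insert.hyps(2) insert.prems(2)[of i] by blast
  with insert show ?case
    by (simp add: mset_set_Union)
qed simp

text \<open>Each vertex of \<open>e\<close> chooses the entry that lists the other vertices once.
  The arcs then form the complete digraph on \<open>e\<close>, which has a closed walk through all
  of them.\<close>

lemma eulerian_config_edge:
  assumes e: "finite e" "card e = k" and k: "k \<ge> 3"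
  shows "\<exists>g. eulerian_config k k {e} e g"
proof -
  have "\<exists>xs. set xs = e - {i} \<and> distinct xs" for i
    using e by (intro finite_distinct_list) auto
  then obtain h where h: "set (h i) = e - {i}" "distinct (h i)" for i
    by metis
  have len: "length (h i) = k - 1" if "i \<in> e" for i
    using h(1)[of i] distinct_card[OF h(2)[of i]] e that by simp
  have nonloop: "h i \<noteq> replicate (k - 1) i" for i
  proof
    assume "h i = replicate (k - 1) i"
    then have "i \<in> set (h i)"
      using k by simp
    then show False
      using h(1) by simp
  qed
  define g where "g = (\<lambda>i. if i \<in> e then [h i] else [])"
  have sup: "support g = e"
    by (auto simp: g_def support_def)
  have "g \<in> configs e k k"
    using e h len by (auto simp: configs_def sup) (auto simp: g_def)
  moreover have "used_edges k g = {e}"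
  proof -
    have "e \<noteq> {}"
      using e k by auto
    then show ?thesis
      using h nonloop by (auto simp: used_edges_def uses_edge_def g_def insert_absorb)
  qed
  moreover have "arcs g = mset_set {(i, j). i \<in> e \<and> j \<in> e \<and> i \<noteq> j}"
  proof -
    have "arcs g = (\<Sum>i\<in>e. mset_set (Pair i ` (e - {i})))"
      unfolding arcs_def sup
    proof (rule sum.cong[OF refl])
      fix i assume "i \<in> e"
      then have "image_mset (Pair i) (mset (concat (g i))) = image_mset (Pair i) (mset_set (e - {i}))"
        using h[of i] mset_set_set[of "h i"] by (simp add: g_def)
      then show "image_mset (Pair i) (mset (concat (g i))) = mset_set (Pair i ` (e - {i}))"
        by (simp add: image_mset_mset_set inj_on_def)
    qed
    also have "\<dots> = mset_set (\<Union>i\<in>e. Pair i ` (e - {i}))"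
      using e by (intro sum_mset_set_disjoint) auto
    also have "(\<Union>i\<in>e. Pair i ` (e - {i})) = {(i, j). i \<in> e \<and> j \<in> e \<and> i \<noteq> j}"
      by auto
    finally show ?thesis .
  qed
  ultimately show ?thesis
    using spanning_walk_complete[of e] e k by (auto simp: eulerian_config_def)
qed

lemma eulerian_config_chain:
  assumes k: "k \<ge> 3" and "n > 0" and e: "\<And>j. \<lbrakk>1 \<le> j; j \<le> n\<rbrakk> \<Longrightarrow> finite (e j) \<and> card (e j) = k"
    and chain: "\<And>j. \<lbrakk>1 \<le> j; j < n\<rbrakk> \<Longrightarrow> e j \<inter> e (Suc j) \<noteq> {}"
  shows "\<exists>g. eulerian_config k (n * k) (e ` {1..n}) (\<Union>(e ` {1..n})) g"
  using \<open>n > 0\<close> e chain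
proof (induction n rule: nat_induct_non_zero)
  case 1
  then show ?case
    using eulerian_config_edge[of "e 1" k] k by simp
next
  case (Suc n)
  obtain g where g: "eulerian_config k (n * k) (e ` {1..n}) (\<Union>(e ` {1..n})) g"
    using Suc by auto
  obtain h where h: "eulerian_config k k {e (Suc n)} (e (Suc n)) h"
    using eulerian_config_edge[of "e (Suc n)" k] Suc.prems(1)[of "Suc n"] k by auto
  have "\<Union>(e ` {1..n}) \<inter> e (Suc n) \<noteq> {}"
    using Suc.prems(2)[of n] Suc.hyps by force
  from eulerian_config_append[OF g h this]
  have "\<exists>g. eulerian_config k (n * k + k) (e ` {1..n} \<union> {e (Suc n)}) (\<Union>(e ` {1..n}) \<union> e (Suc n)) g"
    by blast
  moreover have "{1..Suc n} = insert (Suc n) {1..n}"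
    by auto
  ultimately show ?case
    by (simp add: add.commute Un_commute insert_commute)
qed

section \<open>Coalescences\<close>

lemma part_shift:
  fixes f :: "'b \<Rightarrow> 'b"
  assumes "finite (\<Union>F)" "inj f" "\<And>v. v \<in> \<Union>F \<Longrightarrow> w' (f v) = w v" "F' = (`) f ` F"
  shows "part k d b w' F' = part k d b w F"
  unfolding assms(4)
proof (rule part_image)
  show "inj_on f (\<Union>F)"
    using assms(2) by (rule inj_on_subset) simp
qed (use assms in auto)

lemma vertex_degree_image:
  assumes "inj f"
  shows "card {e \<in> (`) f ` E. f v \<in> e} = card {e \<in> E. v \<in> e}"
proof -
  have "{e \<in> (`) f ` E. f v \<in> e} = (`) f ` {e \<in> E. f v \<in> f ` e}"
    by blast
  then have "{e \<in> (`) f ` E. f v \<in> e} = (`) f ` {e \<in> E. v \<in> e}"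
    by (simp only: inj_image_mem_iff[OF assms])
  moreover have "inj_on ((`) f) {e \<in> E. v \<in> e}"
    using assms by (auto intro!: inj_onI simp: inj_image_eq_iff)
  ultimately show ?thesis
    by (simp add: card_image)
qed

lemma finite_hedges: "k_uniform k G \<Longrightarrow> finite (hedges G)"
  unfolding k_uniform_def by (meson PowI finite_Pow_iff finite_subset subsetI)

lemma tensor_trace_isomorphic:
  fixes \<pi> :: "'b \<Rightarrow> 'b" and G G' :: "'b hypergraph"
  assumes G: "k_uniform k G" "k_uniform k G'" and k: "k \<ge> 2" and \<pi>: "bij \<pi>"
    and V: "verts G' = \<pi> ` verts G" and E: "hedges G' = (`) \<pi> ` hedges G"
  shows "tensor_trace (verts G') k (A_alpha \<alpha> k G') d = tensor_trace (verts G) k (A_alpha \<alpha> k G) d"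
proof (cases "d = 0")
  case True
  then show ?thesis
    using \<pi> by (simp add: tensor_trace_def V card_image inj_on_subset[OF bij_is_inj])
next
  case False
  let ?w = "\<lambda>v. \<alpha> * real (vertex_degree G v)" and ?w' = "\<lambda>v. \<alpha> * real (vertex_degree G' v)"
  let ?b = "(1 - \<alpha>) / fact (k - 1)"
  have inj: "inj \<pi>"
    using \<pi> by (rule bij_is_inj)
  have w: "?w' (\<pi> v) = ?w v" for v
    using vertex_degree_image[OF inj, of "hedges G" v] by (simp add: vertex_degree_def E)
  have "(\<Sum>F\<in>Pow (hedges G') - {{}}. part k d ?b ?w' F) = (\<Sum>F\<in>Pow (hedges G) - {{}}. part k d ?b ?w F)"
  proof (rule sum.reindex_bij_witness[of _ "(`) ((`) \<pi>)" "(`) ((`) (inv \<pi>))"])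
    fix F assume F: "F \<in> Pow (hedges G') - {{}}"
    show eq: "(`) \<pi> ` (`) (inv \<pi>) ` F = F"
      using \<pi> by (simp add: image_image bij_is_surj surj_f_inv_f)
    show "(`) (inv \<pi>) ` F \<in> Pow (hedges G) - {{}}"
      using F inj by (auto simp: E image_image)
    then have "e \<subseteq> verts G" if "e \<in> (`) (inv \<pi>) ` F" for e
      using that G(1) unfolding k_uniform_def by blast
    then have "\<Union>((`) (inv \<pi>) ` F) \<subseteq> verts G"
      by (rule Union_least)
    then have "finite (\<Union>((`) (inv \<pi>) ` F))"
      by (rule finite_subset) (use G(1) in \<open>simp add: k_uniform_def\<close>)
    then show "part k d ?b ?w ((`) (inv \<pi>) ` F) = part k d ?b ?w' F"
      by (intro part_shift[where f = \<pi>, symmetric] inj w eq[symmetric])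
  next
    fix F assume F: "F \<in> Pow (hedges G) - {{}}"
    show "(`) (inv \<pi>) ` (`) \<pi> ` F = F"
      using inj by (simp add: image_image)
    show "(`) \<pi> ` F \<in> Pow (hedges G') - {{}}"
      using F by (auto simp: E)
  qed
  moreover have "loop_part k d ?b ?w' (verts G') = loop_part k d ?b ?w (verts G)"
    unfolding V by (intro loop_part_image \<pi> w)
  ultimately show ?thesis
    using tensor_trace_A_alpha[OF G(1) k] tensor_trace_A_alpha[OF G(2) k] False inj
    by (simp add: V card_image inj_on_subset)
qed

lemma verts_coalescence:
  assumes "x \<in> verts G" "y \<in> verts H"
  shows "verts (coalescence G x H y) = Inl ` verts G \<union> Inr ` (verts H - {y})"
proof -
  have "glue x y ` verts H = glue x y ` insert y (verts H - {y})"
    using assms by (simp add: insert_absorb)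
  also have "\<dots> = insert (Inl x) (Inr ` (verts H - {y}))"
    unfolding image_insert by (intro arg_cong2[of _ _ _ _ insert] image_cong) (auto simp: glue_def)
  finally show ?thesis
    using assms by (simp add: coalescence_def insert_absorb)
qed

lemma inj_glue: "inj (glue x y)"
  by (auto simp: glue_def inj_def)

lemma k_uniform_coalescence:
  assumes "k_uniform k G" "k_uniform k H" "x \<in> verts G"
  shows "k_uniform k (coalescence G x H y)"
proof -
  have "glue x y ` e \<subseteq> Inl ` verts G \<union> glue x y ` verts H \<and> card (glue x y ` e) = k" if "e \<in> hedges H" for e
    using that assms(2) by (auto simp: k_uniform_def card_image[OF inj_on_subset[OF inj_glue subset_UNIV]])
  moreover have "Inl ` e \<subseteq> Inl ` verts G \<union> glue x y ` verts H \<and> card (Inl ` e) = k" if "e \<in> hedges G" for e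
    using that assms(1) by (auto simp: k_uniform_def card_image)
  ultimately have "\<forall>e\<in>hedges (coalescence G x H y). e \<subseteq> verts (coalescence G x H y) \<and> card e = k"
    unfolding coalescence_def hypergraph.simps by blast
  moreover have "finite (verts (coalescence G x H y))"
    using assms by (simp add: k_uniform_def coalescence_def)
  ultimately show ?thesis
    by (simp add: k_uniform_def)
qed

text \<open>A vertex of \<open>e'\<close> other than \<open>y\<close> is sent to the second
  summand.\<close>

lemma path_edge_neq_glued_edge:
  assumes "\<not> e' \<subseteq> {y}"
  shows "Inl ` e \<noteq> glue x y ` e'"
proof -
  obtain u where "u \<in> e'" "u \<noteq> y"
    using assms by auto
  then have "Inr u \<in> glue x y ` e'"
    by (force simp: glue_def)
  then show ?thesis by auto
qed

lemma vertex_degree_coalescence: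
  assumes fin: "finite (hedges G)" "finite (hedges H)" and H: "\<And>e. e \<in> hedges H \<Longrightarrow> \<not> e \<subseteq> {y}"
  shows "vertex_degree (coalescence G x H y) (Inl v)
      = vertex_degree G v + (if v = x then vertex_degree H y else 0)"
    and "u \<noteq> y \<Longrightarrow> vertex_degree (coalescence G x H y) (Inr u) = vertex_degree H u"
proof -
  have split: "{e \<in> hedges (coalescence G x H y). a \<in> e} =
      {e \<in> (`) Inl ` hedges G. a \<in> e} \<union> {e \<in> (`) (glue x y) ` hedges H. a \<in> e}" for a
    by (auto simp: coalescence_def)
  have disj: "{e \<in> (`) Inl ` hedges G. a \<in> e} \<inter> {e \<in> (`) (glue x y) ` hedges H. a \<in> e} = {}" for a
  proof -
    have "Inl ` e \<noteq> glue x y ` e'" if "e' \<in> hedges H" for e e'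
      using H[OF that] by (rule path_edge_neq_glued_edge)
    then show ?thesis
      by blast
  qed
  have card: "vertex_degree (coalescence G x H y) a =
      card {e \<in> (`) Inl ` hedges G. a \<in> e} + card {e \<in> (`) (glue x y) ` hedges H. a \<in> e}" for a
    unfolding vertex_degree_def split using fin disj by (intro card_Un_disjoint) auto
  have "card {e \<in> (`) (glue x y) ` hedges H. Inl v \<in> e} = (if v = x then vertex_degree H y else 0)"
  proof (cases "v = x")
    case True
    then have "Inl v = glue x y y"
      by (simp add: glue_def)
    then show ?thesis
      using True vertex_degree_image[OF inj_glue, of x y "hedges H" y] by (simp add: vertex_degree_def)
  next
    case False
    then have "{e \<in> (`) (glue x y) ` hedges H. Inl v \<in> e} = {}"
      by (auto simp: glue_def split: if_splits)
    then show ?thesis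
      using False by (simp only: card.empty if_False)
  qed
  then show "vertex_degree (coalescence G x H y) (Inl v)
      = vertex_degree G v + (if v = x then vertex_degree H y else 0)"
    using vertex_degree_image[of Inl "hedges G" v] vertex_degree_def[of G v] unfolding card by simp
  assume "u \<noteq> y"
  then have "Inr u = glue x y u"
    by (simp add: glue_def)
  moreover have "card {e \<in> (`) Inl ` hedges G. Inr u \<in> e} = 0"
    by (subst card_eq_0_iff) auto
  ultimately show "vertex_degree (coalescence G x H y) (Inr u) = vertex_degree H u"
    using vertex_degree_image[OF inj_glue, of x y "hedges H" u] vertex_degree_def[of H u]
    unfolding card by simp
qed

text \<open>The transposition of \<open>x\<close> and \<open>x'\<close> fixes every edge of
  \<open>G\<close> and carries gluing at \<open>x\<close> to gluing at \<open>x'\<close>, so the two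
  coalescences are isomorphic. This makes the choice of a cored vertex on a given edge
  immaterial.\<close>

lemma tensor_trace_coalescence_twin:
  assumes "k_uniform k G" "k_uniform k H" "k \<ge> 2"
    and x: "x \<in> verts G" "x' \<in> verts G" and twin: "\<And>e. e \<in> hedges G \<Longrightarrow> x \<in> e \<longleftrightarrow> x' \<in> e"
  shows "tensor_trace (verts (coalescence G x' H y)) k (A_alpha \<alpha> k (coalescence G x' H y)) d
    = tensor_trace (verts (coalescence G x H y)) k (A_alpha \<alpha> k (coalescence G x H y)) d"
proof -
  let ?\<tau> = "transpose x x'"
  let ?\<pi> = "map_sum ?\<tau> (id :: 'b \<Rightarrow> 'b)"
  have bij: "bij ?\<pi>"
    by (rule o_bij[of ?\<pi>]) (simp_all add: map_sum.comp map_sum.id flip: id_def)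
  have img: "?\<tau> ` e = e" if "x \<in> e \<longleftrightarrow> x' \<in> e" for e
    using that by (rule transpose_image_eq)
  have glue: "?\<pi> ` (glue x y ` e) = glue x' y ` e" for e
  proof -
    have "?\<pi> (glue x y v) = glue x' y v" for v
      by (simp add: glue_def)
    then show ?thesis
      by (simp add: image_image)
  qed
  have Inl: "?\<pi> ` (Inl ` e) = Inl ` (?\<tau> ` e)" for e
    by (simp add: image_image)
  show ?thesis
  proof (rule tensor_trace_isomorphic[OF _ _ assms(3) bij])
    have "?\<tau> ` verts G = verts G"
      using x by (intro img) auto
    then show "verts (coalescence G x' H y) = ?\<pi> ` verts (coalescence G x H y)"
      by (simp add: coalescence_def image_Un Inl glue)
    have "(`) ?\<pi> ` (`) Inl ` hedges G = (`) Inl ` hedges G"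
      unfolding image_image[of "(`) ?\<pi>"] Inl using img twin by (intro image_cong) auto
    moreover have "(`) ?\<pi> ` (`) (glue x y) ` hedges H = (`) (glue x' y) ` hedges H"
      unfolding image_image[of "(`) ?\<pi>"] glue ..
    ultimately show "hedges (coalescence G x' H y) = (`) ?\<pi> ` hedges (coalescence G x H y)"
      by (simp add: coalescence_def image_Un)
  qed (rule k_uniform_coalescence[OF assms(1,2)], rule x)+
qed

section \<open>Hyperpaths\<close>

lemma Joint_in_hyperpath_edge [simp]: "Joint i \<in> hyperpath_edge k j \<longleftrightarrow> i = j - 1 \<or> i = j"
  and Inserted_in_hyperpath_edge [simp]: "Inserted a i \<in> hyperpath_edge k j \<longleftrightarrow> a = j \<and> 1 \<le> i \<and> i \<le> k - 2"
  unfolding hyperpath_edge_def by auto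

lemma finite_hyperpath_edge [simp]: "finite (hyperpath_edge k j)"
  by (simp add: hyperpath_edge_def)

lemma card_hyperpath_edge:
  assumes "j \<ge> 1" "k \<ge> 2"
  shows "card (hyperpath_edge k j) = k"
proof -
  have "card (hyperpath_edge k j) = card {Joint (j - 1), Joint j} + card (Inserted j ` {1..k - 2})"
    unfolding hyperpath_edge_def by (intro card_Un_disjoint) auto
  also have "\<dots> = k"
    using assms by (simp add: card_image inj_on_def)
  finally show ?thesis .
qed

lemma hyperpath_edge_inject:
  assumes "hyperpath_edge k i = hyperpath_edge k j" "i \<ge> 1" "j \<ge> 1"
  shows "i = j"
proof -
  have "Joint i \<in> hyperpath_edge k j" "Joint j \<in> hyperpath_edge k i"
    using assms(1) Joint_in_hyperpath_edge by metis+
  with assms(2,3) show ?thesis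
    by auto
qed

lemma k_uniform_hyperpath:
  assumes "k \<ge> 2"
  shows "k_uniform k (hyperpath k r)"
proof -
  have "{Inserted j i | j i. j \<in> {1..r} \<and> i \<in> {1..k - 2}} = case_prod Inserted ` ({1..r} \<times> {1..k - 2})"
    by auto
  then have "finite {Inserted j i | j i. j \<in> {1..r} \<and> i \<in> {1..k - 2}}"
    by simp
  then have "finite (verts (hyperpath k r))"
    by (simp add: hyperpath_def)
  moreover have "hyperpath_edge k j \<subseteq> verts (hyperpath k r)" if "j \<in> {1..r}" for j
  proof
    fix v assume "v \<in> hyperpath_edge k j"
    then show "v \<in> verts (hyperpath k r)"
      using that by (cases v) (auto simp: hyperpath_def)
  qed
  moreover have "hedges (hyperpath k r) = hyperpath_edge k ` {1..r}"
    by (simp add: hyperpath_def)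
  ultimately show ?thesis
    using assms by (auto simp: k_uniform_def card_hyperpath_edge)
qed

lemma vertex_degree_hyperpath: "vertex_degree (hyperpath k r) v = card {j \<in> {1..r}. v \<in> hyperpath_edge k j}"
proof -
  have "{e \<in> hedges (hyperpath k r). v \<in> e} = hyperpath_edge k ` {j \<in> {1..r}. v \<in> hyperpath_edge k j}"
    by (auto simp: hyperpath_def)
  moreover have "inj_on (hyperpath_edge k) {j \<in> {1..r}. v \<in> hyperpath_edge k j}"
    by (auto intro!: inj_onI dest: hyperpath_edge_inject)
  ultimately show ?thesis
    by (simp add: vertex_degree_def card_image)
qed

lemma vertex_degree_Joint:
  assumes "i \<le> r" "r \<ge> 1"
  shows "vertex_degree (hyperpath k r) (Joint i) = (if i = 0 \<or> i = r then 1 else 2)"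
proof -
  have "{j \<in> {1..r}. Joint i \<in> hyperpath_edge k j} = (if i = 0 then {1} else if i = r then {r} else {i, Suc i})"
    using assms by auto
  then show ?thesis
    by (simp add: vertex_degree_hyperpath)
qed

lemma vertex_degree_Inserted:
  assumes "1 \<le> j" "j \<le> r" "1 \<le> i" "i \<le> k - 2"
  shows "vertex_degree (hyperpath k r) (Inserted j i) = 1"
proof -
  have "{m \<in> {1..r}. Inserted j i \<in> hyperpath_edge k m} = {j}"
    using assms by auto
  then show ?thesis
    by (simp add: vertex_degree_hyperpath)
qed

text \<open>A cored vertex of the \<open>l\<close>-th edge lies on no other edge, and neither does
  \<open>Inserted l 1\<close>, which exists because \<open>k \<ge> 3\<close>. End joints are cored
  too and are covered.\<close>

lemma cored_hyperpath_twins: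
  assumes "cored_vertex (hyperpath k r) x" "x \<in> hyperpath_edge k l" "1 \<le> l" "l \<le> r" "k \<ge> 3"
    and e: "e \<in> hedges (hyperpath k r)"
  shows "x \<in> e \<longleftrightarrow> Inserted l 1 \<in> e"
proof -
  obtain j where j: "e = hyperpath_edge k j" "1 \<le> j" "j \<le> r"
    using e by (auto simp: hyperpath_def)
  obtain c where "{j \<in> {1..r}. x \<in> hyperpath_edge k j} = {c}"
    using assms(1) by (auto simp: cored_vertex_def vertex_degree_hyperpath card_1_singleton_iff)
  moreover have "l \<in> {j \<in> {1..r}. x \<in> hyperpath_edge k j}"
    using assms by auto
  ultimately have "{j \<in> {1..r}. x \<in> hyperpath_edge k j} = {l}"
    by auto
  then have "x \<in> hyperpath_edge k j \<longleftrightarrow> j = l"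
    using j by auto
  then show ?thesis
    using j assms by auto
qed

text \<open>Only the path moves. The vertices of the second summand stay, so a translate of a glued
  path carries the same copy of the other hypergraph.\<close>

definition shift :: "nat \<Rightarrow> path_vertex + 'a \<Rightarrow> path_vertex + 'a" where
  "shift s = map_sum (case_path_vertex (\<lambda>j. Joint (j + s)) (\<lambda>j. Inserted (j + s))) id"

lemma shift_simps [simp]:
  "shift s (Inl (Joint j)) = Inl (Joint (j + s))"
  "shift s (Inl (Inserted j i)) = Inl (Inserted (j + s) i)"
  "shift s (Inr u) = Inr u"
  by (simp_all add: shift_def)

lemma inj_shift: "inj (shift s)"
proof (rule injI)
  fix u v :: "path_vertex + 'a"
  assume "shift s u = shift s v"
  then show "u = v"
    by (cases u rule: sum.exhaust; cases v rule: sum.exhaust)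
      (auto simp: shift_def split: path_vertex.splits)
qed

lemma shift_hyperpath_edge:
  assumes "j \<ge> 1"
  shows "shift s ` (Inl ` hyperpath_edge k j) = Inl ` hyperpath_edge k (s + j)"
proof -
  have "j + s - 1 = j - 1 + s"
    using assms by simp
  then show ?thesis
    by (simp add: hyperpath_edge_def image_Un image_image ac_simps)
qed

lemma shift_glue: "shift s ` (glue (Inserted p i) y ` e) = glue (Inserted (p + s) i) y ` e"
proof -
  have "shift s (glue (Inserted p i) y v) = glue (Inserted (p + s) i) y v" for v
    by (simp add: glue_def)
  then show ?thesis
    by (simp add: image_image)
qed

text \<open>The values of \<open>f\<close> from \<open>c + 2\<close> to \<open>c + m\<close> cancel
  those of \<open>h\<close> from \<open>c + 1\<close> to \<open>c + m - 1\<close>. It is applied to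
  intervals of \<open>m\<close> path edges, with \<open>f\<close> and \<open>h\<close> for the glue
  positions \<open>l\<close> and \<open>l - 1\<close>.\<close>

lemma sum_shifted_difference:
  fixes f h :: "nat \<Rightarrow> real"
  assumes "m > 0" "\<And>a. \<lbrakk>c < a; a < c + m\<rbrakk> \<Longrightarrow> f (Suc a) = h a"
  shows "(\<Sum>a=c..c + m. f a) - (\<Sum>a=c..c + m. h a) = f c + f (Suc c) - h c - h (c + m)"
  using assms
proof (induction m rule: nat_induct_non_zero)
  case 1
  have "{c..Suc c} = {c, Suc c}"
    by auto
  then show ?case by simp
next
  case (Suc m)
  moreover have "f (Suc (c + m)) = h (c + m)"
    using Suc.hyps Suc.prems[of "c + m"] by simp
  ultimately show ?case by simp
qed

section \<open>Coalescences of a hyperpath\<close>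

locale path_coalescence =
  fixes k r :: nat and H0 :: "'a hypergraph" and v0 :: 'a and \<alpha> :: real
  assumes k: "k \<ge> 3" and r: "r \<ge> 1" and H0: "k_uniform k H0" and v0: "v0 \<in> verts H0"
    and degree_v0: "vertex_degree H0 v0 \<ge> 1" and \<alpha>: "0 < \<alpha>" "\<alpha> < 1"
begin

text \<open>Since cored vertices on one edge are twins, gluing at its first inserted vertex
  suffices, and a coalescence is given by the position \<open>p\<close> alone.\<close>

abbreviation glued :: "nat \<Rightarrow> (path_vertex + 'a) hypergraph" where
  "glued p \<equiv> coalescence (hyperpath k r) (Inserted p 1) H0 v0"

text \<open>Edge sets are addressed by path indices and edges of \<open>H0\<close>, so that the sums
  for two positions \<open>p\<close> can be matched term by term.\<close>

definition edge_set :: "nat \<Rightarrow> nat set \<Rightarrow> 'a set set \<Rightarrow> (path_vertex + 'a) set set" where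
  "edge_set p I F0 = (\<lambda>j. Inl ` hyperpath_edge k j) ` I \<union> (`) (glue (Inserted p 1) v0) ` F0"

definition weight :: "nat \<Rightarrow> path_vertex + 'a \<Rightarrow> real" where
  "weight p v = \<alpha> * real (vertex_degree (glued p) v)"

definition entry :: real where
  "entry = (1 - \<alpha>) / fact (k - 1)"

definition contrib :: "nat \<Rightarrow> nat \<Rightarrow> nat set \<Rightarrow> 'a set set \<Rightarrow> real" where
  "contrib d p I F0 = part k d entry (weight p) (edge_set p I F0)"

lemma H0_edge: "e \<in> hedges H0 \<Longrightarrow> e \<subseteq> verts H0 \<and> finite e \<and> card e = k"
  using H0 k unfolding k_uniform_def by (metis card_eq_0_iff not_numeral_le_zero)

lemma H0_edge_not_singleton: "e \<in> hedges H0 \<Longrightarrow> \<not> e \<subseteq> {v0}"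
  using H0_edge[of e] k card_mono[of "{v0}" e] by auto

lemma glued_vert: "p \<in> {1..r} \<Longrightarrow> Inserted p 1 \<in> verts (hyperpath k r)"
  using k by (auto simp: hyperpath_def)

lemma k_uniform_path: "k_uniform k (hyperpath k r)"
  using k by (intro k_uniform_hyperpath) simp

lemma k_uniform_glued: "p \<in> {1..r} \<Longrightarrow> k_uniform k (glued p)"
  by (intro k_uniform_coalescence k_uniform_path H0 glued_vert)

lemma verts_glued:
  "p \<in> {1..r} \<Longrightarrow> verts (glued p) = Inl ` verts (hyperpath k r) \<union> Inr ` (verts H0 - {v0})"
  by (intro verts_coalescence glued_vert v0)

lemma hedges_glued: "hedges (glued p) = edge_set p {1..r} (hedges H0)"
  by (simp add: coalescence_def edge_set_def hyperpath_def image_image)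

lemma
  shows weight_Joint: "j \<le> r \<Longrightarrow> weight p (Inl (Joint j)) = \<alpha> * (if j = 0 \<or> j = r then 1 else 2)"
    and weight_Inserted: "\<lbrakk>1 \<le> j; j \<le> r; 1 \<le> i; i \<le> k - 2\<rbrakk> \<Longrightarrow>
      weight p (Inl (Inserted j i)) =
        \<alpha> * (if j = p \<and> i = 1 then 1 + real (vertex_degree H0 v0) else 1)"
    and weight_Inr: "u \<noteq> v0 \<Longrightarrow> weight p (Inr u) = \<alpha> * real (vertex_degree H0 u)"
proof -
  have deg: "vertex_degree (glued p) (Inl v)
      = vertex_degree (hyperpath k r) v + (if v = Inserted p 1 then vertex_degree H0 v0 else 0)" for v
    by (intro vertex_degree_coalescence finite_hedges[OF k_uniform_path] finite_hedges[OF H0]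
        H0_edge_not_singleton)
  show "j \<le> r \<Longrightarrow> weight p (Inl (Joint j)) = \<alpha> * (if j = 0 \<or> j = r then 1 else 2)"
    using r unfolding weight_def deg by (simp add: vertex_degree_Joint)
  show "\<lbrakk>1 \<le> j; j \<le> r; 1 \<le> i; i \<le> k - 2\<rbrakk> \<Longrightarrow> weight p (Inl (Inserted j i)) =
        \<alpha> * (if j = p \<and> i = 1 then 1 + real (vertex_degree H0 v0) else 1)"
    unfolding weight_def deg by (simp add: vertex_degree_Inserted)
  show "u \<noteq> v0 \<Longrightarrow> weight p (Inr u) = \<alpha> * real (vertex_degree H0 u)"
    unfolding weight_def
    by (subst vertex_degree_coalescence)
      (use finite_hedges[OF k_uniform_path] finite_hedges[OF H0] H0_edge_not_singleton in auto)
qed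

text \<open>Sets with edges of \<open>H0\<close> are separated from sets of path edges only, since
  the former translate together with the glue position and the latter need the interval
  argument.\<close>

lemma sum_edge_sets:
  "(\<Sum>F\<in>Pow (hedges (glued p)) - {{}}. part k d entry (weight p) F) =
   (\<Sum>F0\<in>Pow (hedges H0) - {{}}. \<Sum>I\<in>Pow {1..r}. contrib d p I F0)
     + (\<Sum>I\<in>Pow {1..r} - {{}}. contrib d p I {})"
proof -
  let ?a = "\<lambda>j. Inl ` hyperpath_edge k j :: (path_vertex + 'a) set" and ?b = "(`) (glue (Inserted p 1) v0)"
  let ?X = "Pow {1..r} \<times> (Pow (hedges H0) - {{}})" and ?Y = "(Pow {1..r} - {{}}) \<times> {{}}"
  have fin: "finite (hedges H0)"
    by (rule finite_hedges[OF H0])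
  have a_inj: "i = j" if "?a i = ?a j" "i \<in> {1..r}" "j \<in> {1..r}" for i j
    using that hyperpath_edge_inject[of k i j] by (auto simp: inj_image_eq_iff)
  have b_inj: "e = e'" if "?b e = ?b e'" for e e'
    using that by (simp add: inj_image_eq_iff[OF inj_glue])
  have ab: "?a j \<noteq> ?b e" if "e \<in> hedges H0" for j e
    by (intro path_edge_neq_glued_edge H0_edge_not_singleton that)
  let ?w = "\<lambda>F. ({j \<in> {1..r}. ?a j \<in> F}, {e \<in> hedges H0. ?b e \<in> F})"
  have "(\<Sum>F\<in>Pow (hedges (glued p)) - {{}}. part k d entry (weight p) F) =
      (\<Sum>(I, F0)\<in>?X \<union> ?Y. contrib d p I F0)"
  proof (rule sum.reindex_bij_witness[of _ "\<lambda>(I, F0). edge_set p I F0" ?w])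
    fix F assume F: "F \<in> Pow (hedges (glued p)) - {{}}"
    show eq: "(case ?w F of (I, F0) \<Rightarrow> edge_set p I F0) = F"
      using F unfolding hedges_glued edge_set_def by auto
    show "?w F \<in> ?X \<union> ?Y"
    proof (rule ccontr)
      assume "?w F \<notin> ?X \<union> ?Y"
      then have "{j \<in> {1..r}. ?a j \<in> F} = {}" "{e \<in> hedges H0. ?b e \<in> F} = {}"
        by auto
      then have "F = {}"
        using eq by (simp only: edge_set_def prod.case image_empty Un_empty_left)
      with F show False by simp
    qed
    show "(case ?w F of (I, F0) \<Rightarrow> contrib d p I F0) = part k d entry (weight p) F"
      using eq by (simp add: contrib_def)
  next
    fix P assume P: "P \<in> ?X \<union> ?Y"
    obtain I F0 where IF: "P = (I, F0)" "I \<subseteq> {1..r}" "F0 \<subseteq> hedges H0" "I \<noteq> {} \<or> F0 \<noteq> {}"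
      using P by auto
    have "{j \<in> {1..r}. ?a j \<in> edge_set p I F0} = I"
    proof (intro equalityI subsetI)
      fix j assume "j \<in> {j \<in> {1..r}. ?a j \<in> edge_set p I F0}"
      then show "j \<in> I"
        using IF a_inj[of j] ab[of _ j] unfolding edge_set_def by blast
    qed (use IF in \<open>auto simp: edge_set_def\<close>)
    moreover have "{e \<in> hedges H0. ?b e \<in> edge_set p I F0} = F0"
    proof (intro equalityI subsetI)
      fix e assume "e \<in> {e \<in> hedges H0. ?b e \<in> edge_set p I F0}"
      then have "e \<in> hedges H0" and "?b e \<in> ?a ` I \<union> ?b ` F0"
        by (simp_all only: mem_Collect_eq edge_set_def)
      then have "?b e \<in> ?b ` F0"
        using ab[of e] by (metis UnE imageE)
      then obtain e' where "e' \<in> F0" "?b e = ?b e'"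
        by (rule imageE)
      then show "e \<in> F0"
        using b_inj[of e e'] by simp
    qed (use IF in \<open>auto simp: edge_set_def\<close>)
    ultimately show "?w (case P of (I, F0) \<Rightarrow> edge_set p I F0) = P"
      by (simp add: IF)
    show "(case P of (I, F0) \<Rightarrow> edge_set p I F0) \<in> Pow (hedges (glued p)) - {{}}"
      using IF unfolding hedges_glued edge_set_def by auto
  qed
  also have "\<dots> = (\<Sum>(I, F0)\<in>?X. contrib d p I F0) + (\<Sum>(I, F0)\<in>?Y. contrib d p I F0)"
    using fin by (intro sum.union_disjoint) auto
  also have "(\<Sum>(I, F0)\<in>?X. contrib d p I F0) = (\<Sum>F0\<in>Pow (hedges H0) - {{}}. \<Sum>I\<in>Pow {1..r}. contrib d p I F0)"
    by (subst sum.swap) (simp add: sum.cartesian_product)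
  also have "(\<Sum>(I, F0)\<in>?Y. contrib d p I F0) = (\<Sum>I\<in>Pow {1..r} - {{}}. contrib d p I {})"
    by (subst sum.cartesian_product[symmetric]) simp
  finally show ?thesis .
qed

text \<open>The copy of \<open>H0\<close> hangs on the glued vertex and is carried along by the side of a cut that
  contains it.\<close>

definition lift :: "nat \<Rightarrow> path_vertex set \<Rightarrow> (path_vertex + 'a) set" where
  "lift p B = Inl ` B \<union> (if Inserted p 1 \<in> B then range Inr else {})"

lemma glued_edge_subset: "glue (Inserted p 1) v0 ` e \<subseteq> insert (Inl (Inserted p 1)) (range Inr)"
  by (auto simp: glue_def)

lemma edge_set_lift:
  assumes "f \<in> edge_set p I F0" "\<And>j. j \<in> I \<Longrightarrow> hyperpath_edge k j \<subseteq> B \<or> hyperpath_edge k j \<inter> B = {}"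
  shows "f \<subseteq> lift p B \<or> f \<inter> lift p B = {}"
proof -
  consider j where "j \<in> I" "f = Inl ` hyperpath_edge k j" | e where "f = glue (Inserted p 1) v0 ` e"
    using assms(1) by (auto simp: edge_set_def)
  then show ?thesis
  proof cases
    case 1
    then show ?thesis
      using assms(2)[of j] by (auto simp: lift_def)
  next
    case 2
    then show ?thesis
      using glued_edge_subset[of p e] by (auto simp: lift_def)
  qed
qed

section \<open>Edge sets whose contribution vanishes\<close>

lemma finite_Union_edge_set: "\<lbrakk>I \<subseteq> {1..r}; F0 \<subseteq> hedges H0\<rbrakk> \<Longrightarrow> finite (\<Union>(edge_set p I F0))"
  using finite_hedges[OF H0] H0_edge unfolding edge_set_def
  by (intro finite_Union) (auto intro: finite_subset)

text \<open>The missing edge with index \<open>j\<close> cuts the path, and \<open>?B\<close> is the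
  part to its right.\<close>

lemma contrib_gap:
  assumes "I \<subseteq> {1..r}" "F0 \<subseteq> hedges H0" and "i \<in> I" "j \<notin> I" "m \<in> I" "i < j" "j < m"
  shows "contrib d p I F0 = 0"
proof -
  let ?B = "{v. case v of Joint a \<Rightarrow> a \<ge> j | Inserted a _ \<Rightarrow> a > j}"
  have edge: "hyperpath_edge k a \<subseteq> ?B" if "a > j" for a
    using that by (auto simp: hyperpath_edge_def)
  have edge': "hyperpath_edge k a \<inter> ?B = {}" if "a < j" for a
    using that by (auto simp: hyperpath_edge_def)
  show ?thesis
    unfolding contrib_def
  proof (rule part_disconnected[where B = "lift p ?B"])
    show "f \<subseteq> lift p ?B \<or> f \<inter> lift p ?B = {}" if "f \<in> edge_set p I F0" for f
    proof (rule edge_set_lift[OF that])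
      fix a assume "a \<in> I"
      then have "a > j \<or> a < j"
        using assms by (metis linorder_neqE_nat)
      then show "hyperpath_edge k a \<subseteq> ?B \<or> hyperpath_edge k a \<inter> ?B = {}"
        using edge edge' by blast
    qed
    show "Inl ` hyperpath_edge k m \<subseteq> lift p ?B"
      using edge[OF \<open>j < m\<close>] by (auto simp: lift_def)
    show "Inl ` hyperpath_edge k i \<inter> lift p ?B = {}"
      using edge'[OF \<open>i < j\<close>] by (auto simp: lift_def)
  qed (use assms finite_Union_edge_set in \<open>auto simp: edge_set_def\<close>)
qed

text \<open>Without the edge of index \<open>p\<close>, the copy of \<open>H0\<close> together with
  the glued vertex is disjoint from all path edges in the set.\<close>

lemma contrib_unglued:
  assumes "I \<subseteq> {1..r}" "F0 \<subseteq> hedges H0" and "j \<in> I" "e \<in> F0" "p \<notin> I"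
  shows "contrib d p I F0 = 0"
  unfolding contrib_def
proof (rule part_disconnected[where B = "insert (Inl (Inserted p 1)) (range Inr)"])
  have path: "Inl ` hyperpath_edge k a \<inter> insert (Inl (Inserted p 1)) (range Inr) = {}" if "a \<in> I" for a
    using that assms by auto
  then show "f \<subseteq> insert (Inl (Inserted p 1)) (range Inr) \<or> f \<inter> insert (Inl (Inserted p 1)) (range Inr) = {}"
    if f: "f \<in> edge_set p I F0" for f
  proof -
    consider a where "a \<in> I" "f = Inl ` hyperpath_edge k a" | e where "f = glue (Inserted p 1) v0 ` e"
      using f by (auto simp: edge_set_def)
    then show ?thesis
      by cases (simp_all only: path glued_edge_subset simp_thms)
  qed
  show "Inl ` hyperpath_edge k j \<inter> insert (Inl (Inserted p 1)) (range Inr) = {}"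
    using path assms by blast
  show "glue (Inserted p 1) v0 ` e \<in> edge_set p I F0" "Inl ` hyperpath_edge k j \<in> edge_set p I F0"
    using assms by (simp_all add: edge_set_def)
qed (intro finite_Union_edge_set glued_edge_subset assms)+

text \<open>A path edge is a bridge: removing it separates each of its vertices from the others.
  \<open>B\<close> is the right or left part of the path for the two joints, and the vertex alone if
  it is inserted.\<close>

lemma hyperpath_bridge:
  assumes "v \<in> hyperpath_edge k j" "j \<ge> 1"
  shows "\<exists>B. hyperpath_edge k j \<inter> B = {v} \<and>
    (\<forall>m\<ge>1. m \<noteq> j \<longrightarrow> hyperpath_edge k m \<subseteq> B \<or> hyperpath_edge k m \<inter> B = {})"
proof -
  consider "v = Joint j" | "v = Joint (j - 1)" | i where "v = Inserted j i"
    using assms by (cases v) auto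
  then show ?thesis
  proof cases
    case 1
    then show ?thesis
      using assms(2)
      by (intro exI[of _ "{v. case v of Joint a \<Rightarrow> a \<ge> j | Inserted a _ \<Rightarrow> a > j}"])
        (fastforce simp: hyperpath_edge_def)
  next
    case 2
    then show ?thesis
      using assms(2)
      by (intro exI[of _ "{v. case v of Joint a \<Rightarrow> a < j | Inserted a _ \<Rightarrow> a < j}"])
        (fastforce simp: hyperpath_edge_def)
  next
    case 3
    then show ?thesis
      using assms(1) by (intro exI[of _ "{v}"]) (auto simp: hyperpath_edge_def)
  qed
qed

text \<open>Path edges are bridges, so each must be used from all its \<open>k\<close> vertices.
  Edges of \<open>H0\<close> need not be bridges and are therefore counted as one class: at every
  vertex of a single edge \<open>e0\<close> some edge of \<open>H0\<close> must be used, which costs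
  \<open>k\<close> entries once more.\<close>

lemma contrib_cost:
  assumes I: "I \<subseteq> {1..r}" and F0: "F0 \<subseteq> hedges H0"
    and d: "d < k * (card I + (if F0 = {} then 0 else 1))"
  shows "contrib d p I F0 = 0"
  unfolding contrib_def
proof (rule part_eq_0, rule ccontr)
  fix g
  assume g: "g \<in> configs (\<Union>(edge_set p I F0)) k d" "used_edges k g = edge_set p I F0"
    "config_coeff k g \<noteq> 0"
  note fin = finite_Union_edge_set[OF I F0, of p]
  note spread = uses_edge_spread[OF fin g(1) g(3)]
  obtain e0 where e0: "F0 \<noteq> {} \<Longrightarrow> e0 \<in> F0"
    by blast
  let ?x = "Inserted p 1"
  \<comment> \<open>Path indices start at 1, so 0 is free to name the class of all edges of
    \<open>H0\<close>.\<close>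
  let ?C = "I \<union> (if F0 = {} then {} else {0})"
  let ?Q = "\<lambda>c. if c = 0 then (`) (glue ?x v0) ` F0 else {Inl ` hyperpath_edge k c}"
  let ?E = "\<lambda>c. if c = 0 then glue ?x v0 ` e0 else Inl ` hyperpath_edge k c"
  have "k * card ?C \<le> d"
  proof (rule config_cost[OF fin g(1), of _ ?Q ?E])
    show "finite ?C"
      using I finite_subset by auto
    show "?Q c \<inter> ?Q c' = {}" if "c \<in> ?C" "c' \<in> ?C" "c \<noteq> c'" for c c'
    proof -
      have "Inl ` hyperpath_edge k a \<noteq> glue ?x v0 ` e" if "e \<in> F0" for a e
        using that F0 by (intro path_edge_neq_glued_edge H0_edge_not_singleton) auto
      moreover have "Inl ` hyperpath_edge k c \<noteq> (Inl ` hyperpath_edge k c' :: (path_vertex + 'a) set)"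
        if "c \<noteq> 0" "c' \<noteq> 0"
        using that \<open>c \<noteq> c'\<close> hyperpath_edge_inject[of k c c'] by (auto simp: inj_image_eq_iff)
      ultimately show ?thesis
        using \<open>c \<noteq> c'\<close> by (cases "c = 0"; cases "c' = 0") (fastforce+)
    qed
    show "card (?E c) = k" if "c \<in> ?C" for c
    proof (cases "c = 0")
      case True
      then have "e0 \<in> hedges H0"
        using that I e0 F0 by (auto split: if_splits)
      then show ?thesis
        using True H0_edge by (simp add: card_image[OF inj_on_subset[OF inj_glue subset_UNIV]])
    next
      case False
      then show ?thesis
        using k by (simp add: card_image card_hyperpath_edge)
    qed
    show "\<exists>e\<in>?Q c. uses_edge k g i e" if c: "c \<in> ?C" and i: "i \<in> ?E c" for c i
    proof (cases "c = 0")
      case False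
      then have cI: "c \<in> I" "c \<ge> 1"
        using c by (auto split: if_splits)
      from False i obtain v where v: "i = Inl v" "v \<in> hyperpath_edge k c"
        by auto
      obtain B where B: "hyperpath_edge k c \<inter> B = {v}"
        and other: "\<And>m. \<lbrakk>m \<ge> 1; m \<noteq> c\<rbrakk> \<Longrightarrow> hyperpath_edge k m \<subseteq> B \<or> hyperpath_edge k m \<inter> B = {}"
        using hyperpath_bridge[OF v(2) cI(2)] by auto
      have meet: "Inl ` hyperpath_edge k c \<inter> lift p B \<subseteq> {i}"
        using B v by (auto simp: lift_def)
      show ?thesis
      proof (rule spread[where e = "Inl ` hyperpath_edge k c" and B = "lift p B"])
        show "Inl ` hyperpath_edge k c \<in> used_edges k g"
          using cI by (auto simp: g(2) edge_set_def)
        show "i \<in> lift p B"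
          using B v by (auto simp: lift_def)
        fix f assume f: "f \<in> used_edges k g" "f \<inter> lift p B \<noteq> {}" "\<not> f \<subseteq> lift p B"
        have "f = Inl ` hyperpath_edge k c"
        proof (rule ccontr)
          assume "f \<noteq> Inl ` hyperpath_edge k c"
          then have "f \<in> edge_set p (I - {c}) F0"
            using f(1) unfolding g(2) edge_set_def by blast
          moreover have "hyperpath_edge k j \<subseteq> B \<or> hyperpath_edge k j \<inter> B = {}" if "j \<in> I - {c}" for j
            using that I by (intro other) auto
          ultimately show False
            using edge_set_lift f by metis
        qed
        then show "f \<in> ?Q c \<and> f \<inter> lift p B \<subseteq> {i}"
          using False meet by simp
      qed (use False i meet in auto)
    next
      case True
      then have "e0 \<in> F0"
        using c I e0 by (auto split: if_splits)
      then have used: "glue ?x v0 ` e0 \<in> used_edges k g"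
        unfolding g(2) edge_set_def by blast
      have ie0: "i \<in> glue ?x v0 ` e0"
        using i True by simp
      have path: "Inl ` hyperpath_edge k j \<subseteq> range Inl" for j
        by auto
      show ?thesis
      proof (cases i)
        \<comment> \<open>At the glued vertex the cut is the whole path, which edges of
          \<open>F0\<close> meet only there; at any other vertex of \<open>e0\<close> the vertex
          alone serves as the cut.\<close>
        case (Inl v)
        then have v: "i = Inl ?x"
          using ie0 by (auto simp: glue_def split: if_splits)
        have glue_Inl: "glue ?x v0 ` e \<inter> range Inl \<subseteq> {i}" for e
          by (auto simp: v glue_def)
        show ?thesis
        proof (rule spread[where e = "glue ?x v0 ` e0" and B = "range Inl"])
          fix f assume f: "f \<in> used_edges k g" "\<not> f \<subseteq> range Inl"
          then have "f \<in> (`) (glue ?x v0) ` F0"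
            unfolding g(2) edge_set_def by blast
          then show "f \<in> ?Q c \<and> f \<inter> range Inl \<subseteq> {i}"
            using True glue_Inl by auto
        qed (use used ie0 True v glue_Inl \<open>e0 \<in> F0\<close> in auto)
      next
        case (Inr u)
        show ?thesis
        proof (rule spread[where e = "glue ?x v0 ` e0" and B = "{i}"])
          fix f assume f: "f \<in> used_edges k g" "f \<inter> {i} \<noteq> {}"
          then have "f \<in> (`) (glue ?x v0) ` F0"
            unfolding g(2) edge_set_def Inr by blast
          then show "f \<in> ?Q c \<and> f \<inter> {i} \<subseteq> {i}"
            using True by auto
        qed (use used ie0 True \<open>e0 \<in> F0\<close> in auto)
      qed
    qed
  qed
  moreover have "card ?C = card I + (if F0 = {} then 0 else 1)"
  proof -
    have "finite I" "0 \<notin> I"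
      using I finite_subset by auto
    then show ?thesis by simp
  qed
  ultimately show False
    using d by simp
qed

lemma contrib_convex:
  assumes "contrib d p I F0 \<noteq> 0" "I \<subseteq> {1..r}" "F0 \<subseteq> hedges H0" "i \<in> I" "m \<in> I" "i \<le> j" "j \<le> m"
  shows "j \<in> I"
proof (rule ccontr)
  assume "j \<notin> I"
  then have "i < j" "j < m"
    using assms by (metis le_neq_implies_less)+
  then show False
    using contrib_gap[OF assms(2,3,4) \<open>j \<notin> I\<close> assms(5)] assms(1) by blast
qed

text \<open>Since \<open>k \<ge> 3\<close>, the bound \<open>k * (l - 1) + 2\<close> is below
  \<open>k * l\<close>, so the cost leaves room for fewer than \<open>l\<close> classes.\<close>

lemma contrib_card:
  assumes "contrib d p I F0 \<noteq> 0" "I \<subseteq> {1..r}" "F0 \<subseteq> hedges H0" "d \<le> k * (l - 1) + 2" "l \<ge> 1"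
  shows "card I + (if F0 = {} then 0 else 1) < l"
proof -
  have "k * (card I + (if F0 = {} then 0 else 1)) \<le> k * (l - 1) + 2"
    using contrib_cost[OF assms(2,3)] assms(1,4) by (meson le_trans not_less)
  also have "\<dots> < k * (l - 1) + k"
    using k by simp
  also have "\<dots> = k * l"
    using assms(5) by (cases l) simp_all
  finally show ?thesis
    by (simp only: mult_less_cancel1)
qed

section \<open>Translation along the path\<close>

lemma edge_set_shift:
  assumes "I \<subseteq> {1..r}" "F0 = {} \<or> p' = p + s"
  shows "edge_set p' ((+) s ` I) F0 = (`) (shift s) ` edge_set p I F0"
proof -
  have "(\<lambda>j. Inl ` hyperpath_edge k j) ` (+) s ` I =
      (`) (shift s) ` (\<lambda>j. Inl ` hyperpath_edge k j :: (path_vertex + 'a) set) ` I"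
    unfolding image_image[of _ "(+) s"] image_image[of "(`) (shift s)"]
    by (intro image_cong refl shift_hyperpath_edge[symmetric]) (use assms in auto)
  moreover have "(`) (glue (Inserted p' 1) v0) ` F0 = (`) (shift s) ` (`) (glue (Inserted p 1) v0) ` F0"
    unfolding image_image[of "(`) (shift s)"] shift_glue using assms(2) by auto
  ultimately show ?thesis
    by (simp only: edge_set_def image_Un)
qed

lemma part_edge_set_shift:
  assumes "I \<subseteq> {1..r}" "F0 \<subseteq> hedges H0" "F0 = {} \<or> p' = p + s"
    and "\<And>v. v \<in> \<Union>(edge_set p I F0) \<Longrightarrow> w' (shift s v) = w v"
  shows "part k d b w' (edge_set p' ((+) s ` I) F0) = part k d b w (edge_set p I F0)"
proof (rule part_shift[where f = "shift s"])
  show "finite (\<Union>(edge_set p I F0))"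
    by (rule finite_Union_edge_set[OF assms(1,2)])
  show "edge_set p' ((+) s ` I) F0 = (`) (shift s) ` edge_set p I F0"
    by (rule edge_set_shift[OF assms(1,3)])
qed (rule inj_shift, rule assms(4))

lemma edge_set_vertex_cases:
  assumes "v \<in> \<Union>(edge_set p I F0)" "I \<subseteq> {1..r}"
  obtains (joint) j m where "v = Inl (Joint m)" "j \<in> I" "m = j \<or> m = j - 1"
    | (inserted) j i where "v = Inl (Inserted j i)" "j \<in> I" "1 \<le> i" "i \<le> k - 2"
    | (coalesced) "v = Inl (Inserted p 1)" "F0 \<noteq> {}"
    | (other) u where "v = Inr u" "u \<noteq> v0" "F0 \<noteq> {}"
proof -
  obtain f where f: "v \<in> f" "f \<in> edge_set p I F0"
    using assms by auto
  consider j where "j \<in> I" "f = Inl ` hyperpath_edge k j"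
    | e where "e \<in> F0" "f = glue (Inserted p 1) v0 ` e"
    using f(2) by (auto simp: edge_set_def)
  then show thesis
  proof cases
    case (1 j)
    then obtain u where u: "v = Inl u" "u \<in> hyperpath_edge k j"
      using f by auto
    show thesis
    proof (cases u)
      case (Joint m)
      then show thesis
        using joint[of m j] u 1 by auto
    next
      case (Inserted a i)
      then show thesis
        using inserted[of j i] u 1 by auto
    qed
  next
    case (2 e)
    then obtain u where "v = glue (Inserted p 1) v0 u"
      using f by auto
    then show thesis
      using coalesced other[of u] 2 by (auto simp: glue_def split: if_splits)
  qed
qed

text \<open>The bounds on \<open>j\<close> keep the edges away from both ends of the path before and
  after the shift, so all their joints have degree 2. The conditions on \<open>p\<close> and
  \<open>p'\<close> match the glued vertices.\<close>

lemma contrib_translate: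
  assumes I: "I \<subseteq> {1..r}" and F0: "F0 \<subseteq> hedges H0"
    and j: "\<And>j. j \<in> I \<Longrightarrow> 2 \<le> j \<and> j + s < r \<and> (j = p \<longleftrightarrow> j + s = p')"
    and p: "F0 = {} \<or> p' = p + s \<and> 1 \<le> p \<and> p' \<le> r"
  shows "contrib d p' ((+) s ` I) F0 = contrib d p I F0"
  unfolding contrib_def
proof (rule part_edge_set_shift[OF I F0])
  show "F0 = {} \<or> p' = p + s"
    using p by auto
  fix v assume "v \<in> \<Union>(edge_set p I F0)"
  then show "weight p' (shift s v) = weight p v"
    using I
  proof (cases rule: edge_set_vertex_cases)
    case (joint a m)
    then show ?thesis
      using j[of a] by (auto simp: weight_Joint)
  next
    case (inserted a i)
    then show ?thesis
      using j[of a] by (auto simp: weight_Inserted)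
  next
    case coalesced
    then show ?thesis
      using p k by (auto simp: weight_Inserted simp del: One_nat_def)
  next
    case (other u)
    then show ?thesis
      by (simp add: weight_Inr)
  qed
qed

text \<open>\<open>I\<close> is an interval that contains \<open>p\<close>, and as the edges of
  \<open>H0\<close> take up one class, it has at most \<open>l - 2\<close> elements.\<close>

lemma contrib_near_glue:
  assumes nz: "contrib d p I F0 \<noteq> 0" and I: "I \<subseteq> {1..r}" and F0: "F0 \<subseteq> hedges H0" "F0 \<noteq> {}"
    and d: "d \<le> k * (l - 1) + 2" "l \<ge> 1" and i: "i \<in> I"
  shows "p + 3 \<le> i + l \<and> i + 3 \<le> p + l"
proof -
  have card: "card I + 2 \<le> l"
    using contrib_card[OF nz I F0(1) d] F0(2) by simp
  have "p \<in> I"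
    using contrib_unglued[OF I F0(1) i] F0(2) nz by blast
  have fin: "finite I"
    using I finite_subset by auto
  have sub: "{i..p} \<subseteq> I" "{p..i} \<subseteq> I"
    using contrib_convex[OF nz I F0(1) i \<open>p \<in> I\<close>] contrib_convex[OF nz I F0(1) \<open>p \<in> I\<close> i] by auto
  show ?thesis
    using card card_mono[OF fin sub(1)] card_mono[OF fin sub(2)] by auto
qed

lemma sum_contrib_glued:
  assumes l: "2 \<le> l" "2 * l \<le> r + 1" and d: "d \<le> k * (l - 1) + 2" and F0: "F0 \<subseteq> hedges H0" "F0 \<noteq> {}"
  shows "(\<Sum>I\<in>Pow {1..r}. contrib d l I F0) = (\<Sum>I\<in>Pow {1..r}. contrib d (l - 1) I F0)"
proof -
  have near: "I \<subseteq> {p + 3 - l..p + l - 3}" if "contrib d p I F0 \<noteq> 0" "I \<subseteq> {1..r}" for p I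
  proof
    fix i assume "i \<in> I"
    then show "i \<in> {p + 3 - l..p + l - 3}"
      using contrib_near_glue[OF that F0 d _ \<open>i \<in> I\<close>] l by auto
  qed
  \<comment> \<open>For \<open>p = l - 1\<close> and \<open>p = l\<close> the neighbourhoods of
    \<open>near\<close> are \<open>{2..2 * l - 4}\<close> and \<open>{3..2 * l - 3}\<close>. Both
    avoid the end edges 1 and \<open>r\<close> and differ by a shift by one.\<close>
  have "(\<Sum>I\<in>Pow {1..r}. contrib d (l - 1) I F0) = (\<Sum>I\<in>Pow {2..2 * l - 4}. contrib d (l - 1) I F0)"
  proof (rule sum.mono_neutral_right)
    show "Pow {2..2 * l - 4} \<subseteq> Pow {1..r}"
      using l by (intro Pow_mono) auto
    show "\<forall>I\<in>Pow {1..r} - Pow {2..2 * l - 4}. contrib d (l - 1) I F0 = 0"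
      using near[of "l - 1"] l by fastforce
  qed simp
  also have "\<dots> = (\<Sum>I\<in>Pow {3..2 * l - 3}. contrib d l I F0)"
  proof (rule sum.reindex_bij_witness[of _ "(`) (\<lambda>i. i - 1)" "(`) ((+) 1)"])
    fix I assume I: "I \<in> Pow {2..2 * l - 4}"
    show "(\<lambda>i. i - 1) ` (+) 1 ` I = I"
      by (simp add: image_image)
    show "(+) 1 ` I \<in> Pow {3..2 * l - 3}"
      using I by force
    show "contrib d l ((+) 1 ` I) F0 = contrib d (l - 1) I F0"
    proof (rule contrib_translate)
      fix j assume "j \<in> I"
      then have "2 \<le> j" "j \<le> 2 * l - 4"
        using I by auto
      then show "2 \<le> j \<and> j + 1 < r \<and> (j = l - 1 \<longleftrightarrow> j + 1 = l)"
        using l by auto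
    next
      have "{2..2 * l - 4} \<subseteq> {1..r}"
        using l by auto
      then show "I \<subseteq> {1..r}"
        using I by blast
    qed (use l F0 in auto)
  next
    fix I assume I: "I \<in> Pow {3..2 * l - 3}"
    have "(\<lambda>i. 1 + (i - 1)) ` I = (\<lambda>i. i) ` I"
      using I by (intro image_cong) auto
    then show "(+) 1 ` (\<lambda>i. i - 1) ` I = I"
      by (simp add: image_image)
    show "(\<lambda>i. i - 1) ` I \<in> Pow {2..2 * l - 4}"
      using I by force
  qed
  also have "\<dots> = (\<Sum>I\<in>Pow {1..r}. contrib d l I F0)"
  proof (rule sum.mono_neutral_left)
    show "Pow {3..2 * l - 3} \<subseteq> Pow {1..r}"
      using l by (intro Pow_mono) auto
    show "\<forall>I\<in>Pow {1..r} - Pow {3..2 * l - 3}. contrib d l I F0 = 0"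
      using near[of l] l by fastforce
  qed simp
  finally show ?thesis ..
qed

text \<open>By \<open>contrib_convex\<close> only intervals contribute, and by
  \<open>contrib_card\<close> only those of at most \<open>l - 1\<close> edges. Here
  \<open>m\<close> is the length and \<open>a\<close> the number of edges before the
  interval.\<close>

lemma sum_contrib_path:
  assumes l: "1 \<le> l" "l \<le> r" and d: "d \<le> k * (l - 1) + 2"
  shows "(\<Sum>I\<in>Pow {1..r} - {{}}. contrib d p I {}) =
    (\<Sum>m=1..l - 1. \<Sum>a=0..r - m. contrib d p {a + 1..a + m} {})"
proof -
  let ?S = "Sigma {1..l - 1} (\<lambda>m. {0..r - m})" and ?i = "\<lambda>(m, a). {a + 1..a + m :: nat}"
  have inj: "inj_on ?i ?S"
  proof (rule inj_onI, clarify)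
    fix m a m' a' :: nat
    assume m: "m \<in> {1..l - 1}" "m' \<in> {1..l - 1}" and eq: "{a + 1..a + m} = {a' + 1..a' + m'}"
    then have "a + 1 = a' + 1 \<and> a + m = a' + m'"
      by (subst (asm) Icc_eq_Icc) auto
    then show "m = m' \<and> a = a'"
      by auto
  qed
  have "(\<Sum>m=1..l - 1. \<Sum>a=0..r - m. contrib d p {a + 1..a + m} {}) = (\<Sum>P\<in>?S. contrib d p (?i P) {})"
    by (simp add: sum.Sigma split_def)
  also have "\<dots> = (\<Sum>I\<in>?i ` ?S. contrib d p I {})"
    by (subst sum.reindex[OF inj]) (simp add: o_def)
  also have "\<dots> = (\<Sum>I\<in>Pow {1..r} - {{}}. contrib d p I {})"
  proof (rule sum.mono_neutral_left)
    show "?i ` ?S \<subseteq> Pow {1..r} - {{}}"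
      using l by auto
    show "\<forall>I\<in>Pow {1..r} - {{}} - ?i ` ?S. contrib d p I {} = 0"
    proof (intro ballI, rule ccontr)
      fix I assume I: "I \<in> Pow {1..r} - {{}} - ?i ` ?S" and nz: "contrib d p I {} \<noteq> 0"
      have fin: "finite I" "I \<noteq> {}" "I \<subseteq> {1..r}"
        using I finite_subset by auto
      have "I = {Min I..Max I}"
      proof (intro equalityI subsetI)
        fix j assume "j \<in> {Min I..Max I}"
        then show "j \<in> I"
          using contrib_convex[OF nz fin(3) _ Min_in[OF fin(1,2)] Max_in[OF fin(1,2)], of j] by simp
      qed (use fin in simp)
      moreover have "1 \<le> Min I" "Min I \<le> Max I" "Max I \<le> r"
        using fin Min_in[OF fin(1,2)] Max_in[OF fin(1,2)] by auto
      moreover have "card I < l"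
        using contrib_card[OF nz fin(3) _ d l(1)] by simp
      moreover have "card {Min I..Max I} = Max I + 1 - Min I"
        by simp
      ultimately have "I = ?i (card I, Min I - 1)" "(card I, Min I - 1) \<in> ?S"
        by auto
      then show False
        using I by blast
    qed
  qed simp
  finally show ?thesis ..
qed

section \<open>Intervals of path edges\<close>

abbreviation interval_contrib :: "nat \<Rightarrow> nat \<Rightarrow> nat \<Rightarrow> nat \<Rightarrow> real" where
  "interval_contrib d p m a \<equiv> contrib d p {a + 1..a + m} {}"

lemma interval_translate:
  assumes "1 \<le> a" "a + s + m < r" and "\<And>j. \<lbrakk>a < j; j \<le> a + m\<rbrakk> \<Longrightarrow> j = p \<longleftrightarrow> j + s = p'"
  shows "interval_contrib d p' m (a + s) = interval_contrib d p m a"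
proof -
  have "(+) s ` {a + 1..a + m} = {a + s + 1..a + s + m}"
    by (simp add: ac_simps)
  moreover have "contrib d p' ((+) s ` {a + 1..a + m}) {} = contrib d p {a + 1..a + m} {}"
    using assms by (intro contrib_translate) auto
  ultimately show ?thesis by (simp only:)
qed

text \<open>Moving the glue position changes degrees on the path only at the two vertices in
  question, and the interval contains neither.\<close>

lemma interval_unglued:
  assumes "a + m \<le> r" "p \<notin> {a + 1..a + m}" "p' \<notin> {a + 1..a + m}"
  shows "interval_contrib d p' m a = interval_contrib d p m a"
proof -
  have "edge_set p' {a + 1..a + m} {} = edge_set p {a + 1..a + m} {}"
    by (simp add: edge_set_def)
  moreover have "weight p' v = weight p v" if "v \<in> \<Union>(edge_set p {a + 1..a + m} {})" for v
  proof -
    have I: "{a + 1..a + m} \<subseteq> {1..r}"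
      using assms(1) by auto
    from that I show ?thesis
    proof (cases rule: edge_set_vertex_cases)
      case (joint j i)
      then have "i \<le> r"
        using assms(1) by auto
      then show ?thesis
        using joint by (simp add: weight_Joint)
    next
      case (inserted j i)
      then show ?thesis
        using assms by (auto simp: weight_Inserted)
    qed (simp_all add: weight_Inr)
  qed
  ultimately show ?thesis
    unfolding contrib_def by (metis part_cong)
qed

text \<open>The interval \<open>{a + 1..a + m}\<close> contains \<open>l - 1\<close> or \<open>l\<close> just for \<open>a \<in> {c..l - 1}\<close>, and translation
  by one matches all but the extreme ones of these.\<close>

lemma sum_interval_contrib_diff:
  assumes l: "2 \<le> l" "2 * l \<le> r + 1" and m: "1 \<le> m" "m \<le> l - 1"
  defines "c \<equiv> l - 1 - m"
  shows "(\<Sum>a=0..r - m. interval_contrib d l m a) - (\<Sum>a=0..r - m. interval_contrib d (l - 1) m a) =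
    interval_contrib d l m c + interval_contrib d l m (Suc c)
      - interval_contrib d (l - 1) m c - interval_contrib d (l - 1) m (l - 1)"
proof -
  let ?f = "interval_contrib d l m" and ?h = "interval_contrib d (l - 1) m"
  have c: "c + m = l - 1"
    using m by (simp add: c_def)
  have "(\<Sum>a=0..r - m. ?f a) - (\<Sum>a=0..r - m. ?h a) = (\<Sum>a=0..r - m. ?f a - ?h a)"
    by (simp add: sum_subtractf)
  also have "\<dots> = (\<Sum>a=c..c + m. ?f a - ?h a)"
  proof (rule sum.mono_neutral_right)
    show "\<forall>a\<in>{0..r - m} - {c..c + m}. ?f a - ?h a = 0"
    proof
      fix a assume a: "a \<in> {0..r - m} - {c..c + m}"
      have "a + m \<le> r" "l - 1 \<notin> {a + 1..a + m}" "l \<notin> {a + 1..a + m}"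
        using a c l m by auto
      then show "?f a - ?h a = 0"
        using interval_unglued[of a m "l - 1" l d] by simp
    qed
  qed (use c l m in auto)
  also have "\<dots> = (\<Sum>a=c..c + m. ?f a) - (\<Sum>a=c..c + m. ?h a)"
    by (simp add: sum_subtractf)
  also have "\<dots> = ?f c + ?f (Suc c) - ?h c - ?h (c + m)"
  proof (rule sum_shifted_difference)
    fix a assume a: "c < a" "a < c + m"
    then have "?f (a + 1) = ?h a"
      using c l m by (intro interval_translate) auto
    then show "?f (Suc a) = ?h a" by simp
  qed (use m in simp)
  finally show ?thesis
    by (simp only: c)
qed

text \<open>For \<open>m < l - 1\<close> the four extreme intervals stay away from the ends of the
  path. The two that end with the glued edge are translates of each other, and so are the two that
  avoid it.\<close>

lemma sum_interval_contrib_eq: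
  assumes l: "2 \<le> l" "2 * l \<le> r + 1" and m: "1 \<le> m" "m < l - 1"
  shows "(\<Sum>a=0..r - m. interval_contrib d l m a) = (\<Sum>a=0..r - m. interval_contrib d (l - 1) m a)"
proof -
  let ?c = "l - 1 - m"
  have "interval_contrib d l m (?c + 1) = interval_contrib d (l - 1) m ?c"
    using l m by (intro interval_translate) auto
  moreover have "?c + 1 = Suc ?c"
    by simp
  ultimately have 1: "interval_contrib d l m (Suc ?c) = interval_contrib d (l - 1) m ?c"
    by (simp only:)
  have "interval_contrib d (l - 1) m (?c + m) = interval_contrib d l m ?c"
    using l m by (intro interval_translate) auto
  moreover have "?c + m = l - 1"
    using m by simp
  ultimately have 2: "interval_contrib d (l - 1) m (l - 1) = interval_contrib d l m ?c"
    by (simp only:)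
  have "m \<le> l - 1"
    using m by simp
  from sum_interval_contrib_diff[OF l m(1) this, of d] 1 2 show ?thesis
    by linarith
qed

section \<open>The extreme intervals as one path with two variable weights\<close>

definition path_weight :: "nat \<Rightarrow> real \<Rightarrow> real \<Rightarrow> path_vertex + 'a \<Rightarrow> real" where
  "path_weight n s t = (\<lambda>v. if v \<in> Inl ` range Joint then 2 * \<alpha> else \<alpha>)
     (Inl (Joint 0) := s, Inl (Inserted n 1) := t)"

text \<open>The interval does not reach the right end and can be glued on its last edge only. Hence
  its weights deviate from the interior pattern at most at the first joint and at one inserted
  vertex of the last edge.\<close>

lemma interval_path_weight:
  assumes "s + n < r" and "\<And>j. \<lbrakk>1 \<le> j; j \<le> n; j + s = p\<rbrakk> \<Longrightarrow> j = n"
  shows "interval_contrib d p n s = part k d entry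
    (path_weight n (if s = 0 then \<alpha> else 2 * \<alpha>)
      (if p = n + s then \<alpha> * (1 + real (vertex_degree H0 v0)) else \<alpha>)) (edge_set n {1..n} {})"
proof -
  let ?w = "path_weight n (if s = 0 then \<alpha> else 2 * \<alpha>)
      (if p = n + s then \<alpha> * (1 + real (vertex_degree H0 v0)) else \<alpha>)"
  have sub: "{1..n} \<subseteq> {1..r}"
    using assms(1) by auto
  have "weight p (shift s v) = ?w v" if "v \<in> \<Union>(edge_set n {1..n} {})" for v
    using that sub
  proof (cases rule: edge_set_vertex_cases)
    case (joint j i)
    then have "i + s < r"
      using assms(1) by auto
    then show ?thesis
      using joint by (auto simp: weight_Joint path_weight_def)
  next
    case (inserted j i)
    have "j + s \<le> r" "1 \<le> j"
      using inserted assms(1) by auto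
    moreover have "j + s = p \<longleftrightarrow> j = n \<and> p = n + s"
      using inserted assms(2)[of j] by auto
    ultimately show ?thesis
      using inserted by (auto simp: weight_Inserted path_weight_def)
  qed auto
  then have "part k d entry (weight p) (edge_set p ((+) s ` {1..n}) {}) = part k d entry ?w (edge_set n {1..n} {})"
    by (intro part_edge_set_shift[OF sub]) auto
  moreover have "(+) s ` {1..n} = {s + 1..s + n}"
    by simp
  ultimately show ?thesis
    by (simp only: contrib_def)
qed

text \<open>The chain of edges costs \<open>k * n\<close> entries, and a loop is appended at each of
  the two vertices whose weights vary.\<close>

lemma eulerian_path_config:
  assumes n: "1 \<le> n" "n \<le> r"
  shows "\<exists>g. g \<in> configs (\<Union>(edge_set n {1..n} {})) k (k * n + 2) \<and> used_edges k g = edge_set n {1..n} {} \<and>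
    config_coeff k g \<noteq> 0 \<and> loop_count k g (Inl (Joint 0)) > 0 \<and> loop_count k g (Inl (Inserted n 1)) > 0"
proof -
  let ?e = "\<lambda>j. Inl ` hyperpath_edge k j :: (path_vertex + 'a) set"
  let ?F = "edge_set n {1..n} {}"
  have F: "?F = ?e ` {1..n}"
    by (simp add: edge_set_def)
  have "\<exists>g. eulerian_config k (n * k) (?e ` {1..n}) (\<Union>(?e ` {1..n})) g"
  proof (rule eulerian_config_chain[OF k])
    fix j
    show "finite (?e j) \<and> card (?e j) = k" if "1 \<le> j"
      using that k by (simp add: card_image card_hyperpath_edge)
    have "Inl (Joint j) \<in> ?e j \<inter> ?e (Suc j)"
      by auto
    then show "?e j \<inter> ?e (Suc j) \<noteq> {}"
      by blast
  qed (use n in simp)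
  then obtain g where g: "eulerian_config k (n * k) ?F (\<Union>?F) g"
    unfolding F by blast
  let ?u = "Inl (Joint 0) :: path_vertex + 'a" and ?v = "Inl (Inserted n 1) :: path_vertex + 'a"
  have "?u \<in> ?e 1" "?v \<in> ?e n"
    using k by auto
  then have uv: "?u \<in> \<Union>?F" "?v \<in> \<Union>?F"
    unfolding F using n by (meson UN_I atLeastAtMost_iff order_refl)+
  let ?loop = "\<lambda>p i. if i = p then [replicate (k - 1) p] else []"
  have k2: "k \<ge> 2"
    using k by simp
  let ?g = "\<lambda>i. (g i @ ?loop ?u i) @ ?loop ?v i"
  have "eulerian_config k (n * k + 1) (?F \<union> {}) (\<Union>?F \<union> {?u}) (\<lambda>i. g i @ ?loop ?u i)"
    by (rule eulerian_config_append[OF g eulerian_config_loop[OF k2]]) (use uv in blast)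
  then have "eulerian_config k (n * k + 1 + 1) (?F \<union> {} \<union> {}) (\<Union>?F \<union> {?u} \<union> {?v}) ?g"
    by (rule eulerian_config_append[OF _ eulerian_config_loop[OF k2]]) (use uv in blast)
  moreover have "\<Union>?F \<union> {?u} \<union> {?v} = \<Union>?F"
    using uv by blast
  ultimately have eul: "eulerian_config k (k * n + 2) ?F (\<Union>?F) ?g"
    by (simp only: Un_empty_right add.assoc one_add_one mult.commute)
  moreover have "loop_count k ?g ?u > 0" "loop_count k ?g ?v > 0"
    by (simp_all add: loop_count_def)
  ultimately show ?thesis
    using eulerian_config_coeff[OF eul] unfolding eulerian_config_def by blast
qed

text \<open>Without edges only the degrees matter, and changing the glue position interchanges the
  degrees of two inserted vertices.\<close>

lemma loop_part_glued:
  assumes p: "p \<in> {1..r}" "p' \<in> {1..r}"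
  shows "loop_part k d entry (weight p') (verts (glued p')) = loop_part k d entry (weight p) (verts (glued p))"
proof -
  let ?x = "Inl (Inserted p 1)" and ?x' = "Inl (Inserted p' 1)"
  let ?\<pi> = "transpose ?x ?x'"
  have V: "verts (glued p') = verts (glued p)"
    using p by (simp only: verts_glued)
  have x: "?x \<in> verts (glued p)" "?x' \<in> verts (glued p)"
    using p glued_vert by (auto simp only: verts_glued)
  then have "?\<pi> ` verts (glued p) = verts (glued p)"
    by (intro transpose_image_eq) simp
  moreover have "weight p' (?\<pi> v) = weight p v" if "v \<in> verts (glued p)" for v
  proof -
    consider "v = ?x" | "v = ?x'" | "v \<noteq> ?x" "v \<noteq> ?x'"
      by blast
    then show ?thesis
    proof cases
      case 3
      then have "?\<pi> v = v"
        by simp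
      have "v \<in> Inl ` verts (hyperpath k r) \<union> Inr ` (verts H0 - {v0})"
        using that p(1) by (simp only: verts_glued)
      then consider j where "v = Inl (Joint j)" "j \<le> r"
        | j i where "v = Inl (Inserted j i)" "1 \<le> j" "j \<le> r" "1 \<le> i" "i \<le> k - 2"
        | u where "v = Inr u" "u \<noteq> v0"
        by (auto simp: hyperpath_def)
      then show ?thesis
        unfolding \<open>?\<pi> v = v\<close>
        by cases (use 3 in \<open>auto simp: weight_Joint weight_Inserted weight_Inr\<close>)
    qed (use p k in \<open>auto simp: weight_Inserted simp del: One_nat_def\<close>)
  qed
  ultimately show ?thesis
    using loop_part_image[of ?\<pi> "verts (glued p)" "weight p'" "weight p" k d entry] V by simp
qed

section \<open>Comparison of the traces\<close>

lemma tensor_trace_glued: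
  assumes p: "p \<in> {1..r}" and d: "d > 0"
  shows "tensor_trace (verts (glued p)) k (A_alpha \<alpha> k (glued p)) d =
    real ((k - 1) ^ (card (verts (glued p)) - 1)) *
    (loop_part k d entry (weight p) (verts (glued p)) +
      ((\<Sum>F0\<in>Pow (hedges H0) - {{}}. \<Sum>I\<in>Pow {1..r}. contrib d p I F0)
       + (\<Sum>I\<in>Pow {1..r} - {{}}. contrib d p I {})))"
proof -
  have "weight p = (\<lambda>v. \<alpha> * real (vertex_degree (glued p) v))"
    by (simp add: weight_def fun_eq_iff)
  then show ?thesis
    using tensor_trace_A_alpha[OF k_uniform_glued[OF p], of d \<alpha>] k d sum_edge_sets[of d p]
    by (simp add: entry_def)
qed

text \<open>Loops, edge sets that meet \<open>H0\<close> and intervals shorter than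
  \<open>l - 1\<close> cancel. The four extreme intervals of length \<open>l - 1\<close> remain,
  because two of them now reach the left end.\<close>

lemma tensor_trace_glued_diff:
  assumes l: "2 \<le> l" "2 * l \<le> r + 1" and d: "0 < d" "d \<le> k * (l - 1) + 2"
  defines "w \<equiv> \<lambda>s t. part k d entry (path_weight (l - 1) s t) (edge_set (l - 1) {1..l - 1} {})"
    and "t \<equiv> \<alpha> * (1 + real (vertex_degree H0 v0))"
  shows "tensor_trace (verts (glued l)) k (A_alpha \<alpha> k (glued l)) d
      - tensor_trace (verts (glued (l - 1))) k (A_alpha \<alpha> k (glued (l - 1))) d =
    real ((k - 1) ^ (card (verts (glued l)) - 1)) *
      (w (2 * \<alpha>) t + w \<alpha> \<alpha> - (w \<alpha> t + w (2 * \<alpha>) \<alpha>))"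
proof -
  have p: "l \<in> {1..r}" "l - 1 \<in> {1..r}"
    using l by auto
  have V: "verts (glued (l - 1)) = verts (glued l)"
    using p by (simp only: verts_glued)
  let ?S = "\<lambda>p m. \<Sum>a=0..r - m. interval_contrib d p m a"
  have split_last: "(\<Sum>m=1..l - 1. f m) = f (l - 1) + (\<Sum>m\<in>{1..<l - 1}. f m)" for f :: "nat \<Rightarrow> real"
  proof -
    have "{1..l - 1} = insert (l - 1) {1..<l - 1}"
      using l by auto
    then show ?thesis by simp
  qed
  have initial_eq: "(\<Sum>m\<in>{1..<l - 1}. ?S l m) = (\<Sum>m\<in>{1..<l - 1}. ?S (l - 1) m)"
    by (rule sum.cong[OF refl], rule sum_interval_contrib_eq[OF l]) auto
  have glued_eq: "(\<Sum>F0\<in>Pow (hedges H0) - {{}}. \<Sum>I\<in>Pow {1..r}. contrib d l I F0)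
      = (\<Sum>F0\<in>Pow (hedges H0) - {{}}. \<Sum>I\<in>Pow {1..r}. contrib d (l - 1) I F0)"
    by (rule sum.cong[OF refl], rule sum_contrib_glued[OF l d(2)]) auto
  have "(\<Sum>I\<in>Pow {1..r} - {{}}. contrib d l I {}) - (\<Sum>I\<in>Pow {1..r} - {{}}. contrib d (l - 1) I {})
      = (\<Sum>m=1..l - 1. ?S l m) - (\<Sum>m=1..l - 1. ?S (l - 1) m)"
    using sum_contrib_path[of l d] l d p by simp
  also have "\<dots> = ?S l (l - 1) - ?S (l - 1) (l - 1)"
    unfolding split_last initial_eq by simp
  also have "\<dots> = interval_contrib d l (l - 1) 0 + interval_contrib d l (l - 1) 1
      - interval_contrib d (l - 1) (l - 1) 0 - interval_contrib d (l - 1) (l - 1) (l - 1)"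
    using sum_interval_contrib_diff[OF l, of "l - 1" d] l by simp
  also have "\<dots> = w (2 * \<alpha>) t + w \<alpha> \<alpha> - (w \<alpha> t + w (2 * \<alpha>) \<alpha>)"
  proof -
    \<comment> \<open>Offset 0 puts the first joint at the end of the path, hence the weight
      \<alpha> there; \<open>t\<close> appears if the last edge is the glued one. The interval with
      offset \<open>l - 1\<close> ends at index \<open>2 * l - 2\<close>, which is below
      \<open>r\<close> by the bound on \<open>l\<close>.\<close>
    have "interval_contrib d l (l - 1) 0 = w \<alpha> \<alpha>"
      unfolding w_def using l by (subst interval_path_weight) auto
    moreover have "interval_contrib d l (l - 1) 1 = w (2 * \<alpha>) t"
      unfolding w_def t_def using l by (subst interval_path_weight) auto
    moreover have "interval_contrib d (l - 1) (l - 1) 0 = w \<alpha> t"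
      unfolding w_def t_def using l by (subst interval_path_weight) auto
    moreover have "interval_contrib d (l - 1) (l - 1) (l - 1) = w (2 * \<alpha>) \<alpha>"
      unfolding w_def using l by (subst interval_path_weight) auto
    ultimately show ?thesis by simp
  qed
  finally have "(\<Sum>I\<in>Pow {1..r} - {{}}. contrib d l I {}) =
      (\<Sum>I\<in>Pow {1..r} - {{}}. contrib d (l - 1) I {}) + (w (2 * \<alpha>) t + w \<alpha> \<alpha> - (w \<alpha> t + w (2 * \<alpha>) \<alpha>))"
    by linarith
  moreover have "loop_part k d entry (weight (l - 1)) (verts (glued l)) = loop_part k d entry (weight l) (verts (glued l))"
    using loop_part_glued[OF p] V by simp
  ultimately show ?thesis
    unfolding V tensor_trace_glued[OF p(1) d(1)] tensor_trace_glued[OF p(2) d(1), unfolded V]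
      glued_eq right_diff_distrib[symmetric]
    by (intro arg_cong[where f = "(*) _"]) linarith
qed

text \<open>Only the vertices of the path are counted, which is enough to place the decisive degree
  within the range that the order admits.\<close>

lemma card_verts_glued:
  assumes "p \<in> {1..r}"
  shows "r * (k - 1) + 1 \<le> card (verts (glued p))"
proof -
  have fin: "finite (verts (hyperpath k r))"
    using k_uniform_path by (simp add: k_uniform_def)
  have "verts (hyperpath k r) = Joint ` {0..r} \<union> case_prod Inserted ` ({1..r} \<times> {1..k - 2})"
    by (auto simp: hyperpath_def)
  also have "card \<dots> = card (Joint ` {0..r}) + card (case_prod Inserted ` ({1..r} \<times> {1..k - 2}))"
    by (intro card_Un_disjoint) auto
  also have "\<dots> = (r + 1) + r * (k - 2)"
    by (subst (1 2) card_image) (auto simp: inj_on_def)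
  also have "\<dots> = r * (k - 1) + 1"
  proof -
    obtain n where "k = n + 2"
      using k le_Suc_ex[of 2 k] by auto
    then show ?thesis by simp
  qed
  finally have "r * (k - 1) + 1 = card (Inl ` verts (hyperpath k r) :: (path_vertex + 'a) set)"
    by (simp add: card_image)
  also have "\<dots> \<le> card (verts (glued p))"
    using k_uniform_glued[OF assms]
    by (intro card_mono) (auto simp only: verts_glued[OF assms] k_uniform_def)
  finally show ?thesis .
qed

theorem S_alpha_less_glued:
  assumes l: "2 \<le> l" "2 * l \<le> r + 1"
  shows "S_alpha_less \<alpha> k (glued (l - 1)) (glued l)"
proof -
  define T where "T = (\<lambda>p d. tensor_trace (verts (glued p)) k (A_alpha \<alpha> k (glued p)) d)"
  define D where "D = k * (l - 1) + 2"
  let ?F = "edge_set (l - 1) {1..l - 1} {}"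
  let ?t = "\<alpha> * (1 + real (vertex_degree H0 v0))"
  let ?u = "Inl (Joint 0) :: path_vertex + 'a" and ?v = "Inl (Inserted (l - 1) 1) :: path_vertex + 'a"
  let ?W = "\<lambda>v :: path_vertex + 'a. if v \<in> Inl ` range Joint then 2 * \<alpha> else \<alpha>"
  have p: "l \<in> {1..r}" "l - 1 \<in> {1..r}"
    using l by auto
  have V: "verts (glued (l - 1)) = verts (glued l)"
    using p by (simp only: verts_glued)
  have fin: "finite (\<Union>?F)"
    using l by (intro finite_Union_edge_set) auto
  have entry_pos: "entry > 0"
    using \<alpha> by (simp add: entry_def)
  \<comment> \<open>Strict because \<open>v0\<close> lies on an edge of \<open>H0\<close>.\<close>
  have t: "\<alpha> < ?t"
    using \<alpha> degree_v0 by (simp add: algebra_simps)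
  have scale: "real ((k - 1) ^ (card (verts (glued l)) - 1)) > 0"
    using k by simp
  note mixed = fin _ _ entry_pos \<alpha>(1) _ \<alpha>(1) t
  have nonneg: "T (l - 1) d \<le> T l d" if "0 < d" "d \<le> D" for d
  proof -
    have "part k d entry (path_weight (l - 1) \<alpha> ?t) ?F + part k d entry (path_weight (l - 1) (2 * \<alpha>) \<alpha>) ?F
        \<le> part k d entry (path_weight (l - 1) (2 * \<alpha>) ?t) ?F + part k d entry (path_weight (l - 1) \<alpha> \<alpha>) ?F"
      unfolding path_weight_def
      by (rule part_mixed_difference_nonneg[OF mixed]) (use \<alpha> in auto)
    then have "0 \<le> T l d - T (l - 1) d"
      unfolding T_def tensor_trace_glued_diff[OF l that[unfolded D_def]] using scale
      by (intro mult_nonneg_nonneg) auto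
    then show ?thesis by simp
  qed
  have less: "T (l - 1) D < T l D"
  proof -
    have "1 \<le> l - 1" "l - 1 \<le> r"
      using l by auto
    from eulerian_path_config[OF this] obtain g where g: "g \<in> configs (\<Union>?F) k D" "used_edges k g = ?F" "config_coeff k g \<noteq> 0"
      "loop_count k g ?u > 0" "loop_count k g ?v > 0"
      unfolding D_def by blast
    have "part k D entry (path_weight (l - 1) \<alpha> ?t) ?F + part k D entry (path_weight (l - 1) (2 * \<alpha>) \<alpha>) ?F
        < part k D entry (path_weight (l - 1) (2 * \<alpha>) ?t) ?F + part k D entry (path_weight (l - 1) \<alpha> \<alpha>) ?F"
      unfolding path_weight_def
      by (rule part_mixed_difference_pos[OF mixed g]) (use \<alpha> in auto)
    then have "0 < T l D - T (l - 1) D"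
      unfolding T_def by (subst tensor_trace_glued_diff[OF l]) (use scale in \<open>auto simp: D_def\<close>)
    then show ?thesis by simp
  qed
  \<comment> \<open>The order asks for the first degree at which the traces differ. It is at most
    \<open>D\<close>, where \<open>nonneg\<close> still fixes the sign of the difference.\<close>
  define d where "d = (LEAST d. T (l - 1) d \<noteq> T l d)"
  have neq: "T (l - 1) d \<noteq> T l d"
    unfolding d_def by (rule LeastI[of _ D]) (use less in simp)
  have "d \<le> D"
    unfolding d_def by (rule Least_le) (use less in simp)
  have eq: "T (l - 1) t = T l t" if "t < d" for t
    using not_less_Least[OF that[unfolded d_def]] by simp
  have "T (l - 1) 0 = T l 0"
    by (simp only: T_def tensor_trace_def V simp_thms if_True)
  then have "d \<noteq> 0"
    using neq by metis
  then have "T (l - 1) d < T l d"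
    using nonneg[of d] neq \<open>d \<le> D\<close> by simp
  \<comment> \<open>The power of \<open>k - 1\<close> is at least 2, so it suffices that
    \<open>D + 1\<close> is at most twice the number of vertices.\<close>
  moreover have "D \<le> card (verts (glued l)) * (k - 1) ^ (card (verts (glued l)) - 1) - 1"
  proof -
    let ?n = "card (verts (glued l))"
    have n: "r * (k - 1) + 1 \<le> ?n"
      by (rule card_verts_glued[OF p(1)])
    obtain j where j: "k = j + 3"
      using k le_Suc_ex by (metis add.commute)
    have r3: "r \<ge> 3"
      using l by simp
    have "k * (l - 1) + 3 \<le> (r * (k - 1) + 1) * 2"
    proof -
      have "2 * (l - 1) \<le> r - 1"
        using l by simp
      then have "l - 1 \<le> r"
        by simp
      then have "k * (l - 1) \<le> k * r"
        by (rule mult_left_mono) simp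
      moreover have "k * r + 3 \<le> (r * (k - 1) + 1) * 2"
        using r3 j by (simp add: algebra_simps)
      ultimately show ?thesis by linarith
    qed
    also have "\<dots> \<le> ?n * (k - 1) ^ (?n - 1)"
    proof (rule mult_mono)
      have "r * (k - 1) > 0"
        using r3 k by simp
      then have "?n - 1 \<noteq> 0"
        using n by linarith
      then have "k - 1 \<le> (k - 1) ^ (?n - 1)"
        using k by (intro self_le_power) auto
      then show "2 \<le> (k - 1) ^ (?n - 1)"
        using k by linarith
    qed (use n in auto)
    finally show ?thesis
      by (simp add: D_def)
  qed
  ultimately show ?thesis
    unfolding S_alpha_less_def using k_uniform_glued p V eq \<open>d \<noteq> 0\<close> \<open>d \<le> D\<close>
    by (intro conjI bexI[of _ d]) (auto simp: T_def)
qed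

end

theorem lemma4p3:
  fixes \<alpha> :: real and k r l :: nat
    and H0 :: "'a hypergraph" and v0 :: 'a
    and x y :: path_vertex
  assumes "k \<ge> 3" and "0 < \<alpha>" and "\<alpha> < 1"
    and "r \<ge> 3" and "2 \<le> l" and "int l \<le> \<lceil>real r / 2\<rceil>"
    and "k_uniform k H0" and "v0 \<in> verts H0"
    and "vertex_degree H0 v0 \<ge> 1"
    and "cored_vertex (hyperpath k r) x" and "x \<in> hyperpath_edge k l"
    and "cored_vertex (hyperpath k r) y" and "y \<in> hyperpath_edge k (l - 1)"
  shows "S_alpha_less \<alpha> k
           (coalescence (hyperpath k r) y H0 v0)
           (coalescence (hyperpath k r) x H0 v0)"
proof -
  interpret path_coalescence k r H0 v0 \<alpha>
    using assms by unfold_locales auto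
  have l: "2 * l \<le> r + 1"
    using assms(6) by linarith
  \<comment> \<open>Any cored vertex on the edge of index \<open>p\<close> is exchanged for
    \<open>Inserted p 1\<close>, which reduces the claim to the positions \<open>l\<close> and
    \<open>l - 1\<close>.\<close>
  have twin: "tensor_trace (verts (coalescence (hyperpath k r) z H0 v0)) k
        (A_alpha \<alpha> k (coalescence (hyperpath k r) z H0 v0)) d = tensor_trace (verts (glued p)) k (A_alpha \<alpha> k (glued p)) d"
      "k_uniform k (coalescence (hyperpath k r) z H0 v0)"
      "card (verts (coalescence (hyperpath k r) z H0 v0)) = card (verts (glued p))"
    if z: "cored_vertex (hyperpath k r) z" "z \<in> hyperpath_edge k p" and p: "p \<in> {1..r}" for z p d
  proof -
    have "z \<in> verts (hyperpath k r)"
      using z by (simp add: cored_vertex_def)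
    then show "k_uniform k (coalescence (hyperpath k r) z H0 v0)"
      by (intro k_uniform_coalescence k_uniform_path H0)
    show "card (verts (coalescence (hyperpath k r) z H0 v0)) = card (verts (glued p))"
      using verts_coalescence[OF \<open>z \<in> verts (hyperpath k r)\<close> v0] verts_glued[OF p] by simp
    show "tensor_trace (verts (coalescence (hyperpath k r) z H0 v0)) k
        (A_alpha \<alpha> k (coalescence (hyperpath k r) z H0 v0)) d = tensor_trace (verts (glued p)) k (A_alpha \<alpha> k (glued p)) d"
    proof (rule tensor_trace_coalescence_twin[OF k_uniform_path H0 _ glued_vert[OF p] \<open>z \<in> verts (hyperpath k r)\<close>])
      fix e assume "e \<in> hedges (hyperpath k r)"
      then show "Inserted p 1 \<in> e \<longleftrightarrow> z \<in> e"
        using cored_hyperpath_twins[OF z, of e] p k by auto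
    qed (use k in simp)
  qed
  have p: "l \<in> {1..r}" "l - 1 \<in> {1..r}"
    using l assms by auto
  show ?thesis
    using S_alpha_less_glued[OF assms(5) l] twin(2)[OF assms(10,11) p(1)] twin(2)[OF assms(12,13) p(2)]
    unfolding S_alpha_less_def twin(1,3)[OF assms(10,11) p(1)] twin(1,3)[OF assms(12,13) p(2)]
    by blast
qed

end
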